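(* Let $G=NH$, $\lambda\in\mathfrak n^*$ and the unitary representation $\pi$ of $G$ on $L^2(H,d\mu_H)$ be as in the context. Assume that the smooth map $H\to\mathfrak n^*$, $h\mapsto Ad(h^{-1})^*\lambda$, is an immersion at the identity of $H$. Then there exists a relatively compact neighborhood $\mathcal O$ of the identity in $H$ such that for every nonzero continuous function $\mathbf f:H\to\mathbb C$ supported on $\mathcal O$ there exists a countable set $\Gamma\subset G$ such that $\{\pi(\gamma)\mathbf f:\gamma\in\Gamma\}$ is a frame for $L^2(H,d\mu_H)$. Moreover, $\mathbf f$ can be chosen to be as smooth as desired.
   Context: Setting. $G$ is a Lie group with Lie algebra $\mathfrak g=\mathfrak n\oplus\mathfrak h$ (direct sum of vector spaces), where $\mathfrak n$ is an ideal of $\mathfrak g$ which is an exponential solvable Lie algebra and $\mathfrak h$ is a subalgebra, with $\dim\mathfrak n=n\ge r=\dim\mathfrak h$. $N=\exp(\mathfrak n)$ is a closed connected normal subgroup of $G$ and $\exp:\mathfrak n\to N$ is a global diffeomorphism with inverse $\log$. $H$ is a closed connected subgroup of $G$ with Lie algebra $\mathfrak h$, $G=NH$ and $N\cap H=\{e\}$. $\mu_H$ is a fixed left Haar measure on $H$. $\lambda\in\mathfrak n^*$ is a linear functional vanishing on $[\mathfrak n,\mathfrak n]$, so that $\chi_\lambda(\exp X)=e^{2\pi i\langle\lambda,X\rangle}$ is a unitary character of $N$. For $h\in H$, $Ad(h^{-1})^*\lambda\in\mathfrak n^*$ is defined by $\langle Ad(h^{-1})^*\lambda,X\rangle=\langle\lambda,Ad(h^{-1})X\rangle$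 for $X\in\mathfrak n$. The representation $\pi=\mathrm{ind}_N^{NH}(\chi_\lambda)$ acts on $L^2(H,d\mu_H)$ by $[\pi(x)\mathbf f](h)=e^{2\pi i\langle Ad(h^{-1})^*\lambda,\log x\rangle}\mathbf f(h)$ for $x\in N$ and $[\pi(z)\mathbf f](h)=\mathbf f(z^{-1}h)$ for $z\in H$. A countable family $\{\mathbf f_k\}_{k\in I}$ in a Hilbert space $\mathfrak H$ is a frame if there are constants $0<A\le B<\infty$ (frame bounds) with $A\|\mathbf g\|^2\le\sum_{k\in I}|\langle\mathbf g,\mathbf f_k\rangle|^2\le B\|\mathbf g\|^2$ for all $\mathbf g\in\mathfrak H$. A function is supported on $\mathcal O$ if its (closed) support is contained in $\mathcal O$. "As smooth as desired" means $\mathbf f$ can be taken of class $C^k$ for any $k$, or $C^\infty$. *)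

theory Defs
  imports "HOL-Analysis.Analysis" "HOL-Algebra.Coset"
begin

text \<open>
  Model spaces of manifolds are finite-dimensional normed spaces.  Unlike \<^class>\<open>euclidean_space\<close>,
  the following class does not exclude the space of dimension 0, so that discrete groups
  are Lie groups too.
\<close>

class finite_dim_normed = real_normed_vector +
  assumes finite_spanning_set: "\<exists>B. finite B \<and> (\<forall>x. \<exists>c. x = (\<Sum>b\<in>B. c b *\<^sub>R b))"

instance euclidean_space \<subseteq> finite_dim_normed
proof
  show "\<exists>B. finite B \<and> (\<forall>x::'a. \<exists>c. x = (\<Sum>b\<in>B. c b *\<^sub>R b))"
    by (intro exI[of _ Basis] conjI finite_Basis allI)
       (metis euclidean_representation)
qed

text \<open>To be used for open \<open>S\<close> and finite-dimensional domain only: there it suffices to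
  iterate directional derivatives.\<close>

primrec Ck_on :: "nat \<Rightarrow> 'a::real_normed_vector set \<Rightarrow> ('a \<Rightarrow> 'b::real_normed_vector) \<Rightarrow> bool" where
  "Ck_on 0 S f \<longleftrightarrow> continuous_on S f"
| "Ck_on (Suc k) S f \<longleftrightarrow>
     (\<forall>x\<in>S. f differentiable (at x)) \<and>
     (\<forall>v. Ck_on k S (\<lambda>x. frechet_derivative f (at x) v))"

definition smooth_on :: "'a::real_normed_vector set \<Rightarrow> ('a \<Rightarrow> 'b::real_normed_vector) \<Rightarrow> bool" where
  "smooth_on S f \<longleftrightarrow> (\<forall>k. Ck_on k S f)"

text \<open>A chart consists of its domain and the coordinate map, whose values outside the domain
  are irrelevant.\<close>

type_synonym ('a, 'e) chart = "'a set \<times> ('a \<Rightarrow> 'e)"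
type_synonym ('a, 'e) atlas = "('a, 'e) chart set"

definition chart_inv :: "('a, 'e) chart \<Rightarrow> 'e \<Rightarrow> 'a" where
  "chart_inv c = the_inv_into (fst c) (snd c)"

definition points :: "('a, 'e) atlas \<Rightarrow> 'a set" where
  "points A = (\<Union>c\<in>A. fst c)"

text \<open>The topology of a manifold is the subspace topology of its set of points.  It is Hausdorff
  and second countable because the surrounding type is.\<close>

definition smooth_manifold ::
    "('a::{t2_space, second_countable_topology}, 'e::finite_dim_normed) atlas \<Rightarrow> bool" where
  "smooth_manifold A \<longleftrightarrow>
     (\<forall>c\<in>A. openin (top_of_set (points A)) (fst c) \<and> open (snd c ` fst c) \<and>
            homeomorphism (fst c) (snd c ` fst c) (snd c) (chart_inv c)) \<and>
     (\<forall>c\<in>A. \<forall>d\<in>A. smooth_on (snd c ` (fst c \<inter> fst d)) (snd d \<circ> chart_inv c))"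

definition smooth_map ::
    "('a::topological_space, 'e::real_normed_vector) atlas \<Rightarrow>
     ('b::topological_space, 'f::real_normed_vector) atlas \<Rightarrow> ('a \<Rightarrow> 'b) \<Rightarrow> bool" where
  "smooth_map A B F \<longleftrightarrow>
     F ` points A \<subseteq> points B \<and> continuous_on (points A) F \<and>
     (\<forall>c\<in>A. \<forall>d\<in>B. smooth_on (snd c ` (fst c \<inter> F -` fst d)) (snd d \<circ> F \<circ> chart_inv c))"

definition diffeomorphism ::
    "('a::topological_space, 'e::real_normed_vector) atlas \<Rightarrow>
     ('b::topological_space, 'f::real_normed_vector) atlas \<Rightarrow> ('a \<Rightarrow> 'b) \<Rightarrow> bool" where
  "diffeomorphism A B F \<longleftrightarrow>
     bij_betw F (points A) (points B) \<and> smooth_map A B F \<and>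
     smooth_map B A (the_inv_into (points A) F)"

definition vector_space_atlas :: "('e, 'e) atlas" where
  "vector_space_atlas = {(UNIV, id)}"

definition prod_atlas :: "('a, 'e) atlas \<Rightarrow> ('b, 'f) atlas \<Rightarrow> ('a \<times> 'b, 'e \<times> 'f) atlas" where
  "prod_atlas A B = {(fst c \<times> fst d, map_prod (snd c) (snd d)) | c d. c \<in> A \<and> d \<in> B}"

text \<open>The tangent space at every point \<open>x\<close> is the model space, by means of one chart chosen
  around \<open>x\<close>.  For \<^const>\<open>vector_space_atlas\<close> this is the usual identification.\<close>

definition chart_at :: "('a, 'e) atlas \<Rightarrow> 'a \<Rightarrow> ('a, 'e) chart" where
  "chart_at A x = (SOME c. c \<in> A \<and> x \<in> fst c)"

definition tangent_map ::
    "('a, 'e::real_normed_vector) atlas \<Rightarrow> ('b, 'f::real_normed_vector) atlas \<Rightarrow>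
     ('a \<Rightarrow> 'b) \<Rightarrow> 'a \<Rightarrow> 'e \<Rightarrow> 'f" where
  "tangent_map A B F x =
     frechet_derivative (snd (chart_at B (F x)) \<circ> F \<circ> chart_inv (chart_at A x))
       (at (snd (chart_at A x) x))"

definition immersion_at ::
    "('a, 'e::real_normed_vector) atlas \<Rightarrow> ('b, 'f::real_normed_vector) atlas \<Rightarrow>
     ('a \<Rightarrow> 'b) \<Rightarrow> 'a \<Rightarrow> bool" where
  "immersion_at A B F x \<longleftrightarrow> inj (tangent_map A B F x)"

definition lie_group ::
    "('a::{t2_space, second_countable_topology}) monoid \<Rightarrow>
     ('a, 'e::finite_dim_normed) atlas \<Rightarrow> bool" where
  "lie_group G A \<longleftrightarrow>
     group G \<and> smooth_manifold A \<and> points A = carrier G \<and>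
     smooth_map (prod_atlas A A) A (\<lambda>(x, y). x \<otimes>\<^bsub>G\<^esub> y) \<and>
     smooth_map A A (\<lambda>x. inv\<^bsub>G\<^esub> x)"

definition Ad ::
    "'a monoid \<Rightarrow> ('a, 'e::real_normed_vector) atlas \<Rightarrow> 'a \<Rightarrow> 'e \<Rightarrow> 'e" where
  "Ad G A g = tangent_map A A (\<lambda>x. g \<otimes>\<^bsub>G\<^esub> x \<otimes>\<^bsub>G\<^esub> inv\<^bsub>G\<^esub> g) \<one>\<^bsub>G\<^esub>"

text \<open>The bracket \<open>[X, Y] = ad X Y\<close>, where \<open>ad\<close> is the differential of \<^const>\<open>Ad\<close> at the
  identity.\<close>

definition lie_bracket ::
    "'a monoid \<Rightarrow> ('a, 'e::real_normed_vector) atlas \<Rightarrow> 'e \<Rightarrow> 'e \<Rightarrow> 'e" where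
  "lie_bracket G A X Y = tangent_map A vector_space_atlas (\<lambda>g. Ad G A g Y) \<one>\<^bsub>G\<^esub> X"

definition one_parameter_subgroup ::
    "('a::topological_space) monoid \<Rightarrow> ('a, 'e::real_normed_vector) atlas \<Rightarrow> (real \<Rightarrow> 'a) \<Rightarrow> bool"
  where
  "one_parameter_subgroup G A \<gamma> \<longleftrightarrow>
     smooth_map vector_space_atlas A \<gamma> \<and> (\<forall>s t. \<gamma> (s + t) = \<gamma> s \<otimes>\<^bsub>G\<^esub> \<gamma> t)"

definition lie_exp ::
    "('a::topological_space) monoid \<Rightarrow> ('a, 'e::real_normed_vector) atlas \<Rightarrow> 'e \<Rightarrow> 'a" where
  "lie_exp G A X =
     (THE g. \<exists>\<gamma>. one_parameter_subgroup G A \<gamma> \<and>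
                 tangent_map vector_space_atlas A \<gamma> 0 1 = X \<and> g = \<gamma> 1)"

definition lie_ideal :: "('e::real_vector \<Rightarrow> 'e \<Rightarrow> 'e) \<Rightarrow> 'e set \<Rightarrow> bool" where
  "lie_ideal br I \<longleftrightarrow> subspace I \<and> (\<forall>X. \<forall>Y\<in>I. br X Y \<in> I)"

definition lie_subalgebra :: "('e::real_vector \<Rightarrow> 'e \<Rightarrow> 'e) \<Rightarrow> 'e set \<Rightarrow> bool" where
  "lie_subalgebra br L \<longleftrightarrow> subspace L \<and> (\<forall>X\<in>L. \<forall>Y\<in>L. br X Y \<in> L)"

primrec derived_series :: "('e::real_vector \<Rightarrow> 'e \<Rightarrow> 'e) \<Rightarrow> nat \<Rightarrow> 'e set" where
  "derived_series br 0 = UNIV"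
| "derived_series br (Suc k) =
     span {br X Y | X Y. X \<in> derived_series br k \<and> Y \<in> derived_series br k}"

definition lie_solvable :: "('e::real_vector \<Rightarrow> 'e \<Rightarrow> 'e) \<Rightarrow> bool" where
  "lie_solvable br \<longleftrightarrow> (\<exists>k. derived_series br k = {0})"

text \<open>A solvable Lie algebra is exponential if the exponential map onto a connected Lie group
  with that Lie algebra is a global diffeomorphism; such a group is simply connected and hence
  determined by the Lie algebra.\<close>

definition exponential_solvable ::
    "('a::{t2_space, second_countable_topology}) monoid \<Rightarrow>
     ('a, 'e::finite_dim_normed) atlas \<Rightarrow> bool" where
  "exponential_solvable N A \<longleftrightarrow>
     lie_solvable (lie_bracket N A) \<and> diffeomorphism vector_space_atlas A (lie_exp N A)"

definition lie_log ::
    "('a::topological_space) monoid \<Rightarrow> ('a, 'e::real_normed_vector) atlas \<Rightarrow> 'a \<Rightarrow> 'e" where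
  "lie_log N A = the_inv_into UNIV (lie_exp N A)"

text \<open>A closed subgroup carries the smooth structure that makes it an embedded submanifold; its
  topology is the subspace topology by definition of \<^const>\<open>smooth_manifold\<close>.\<close>

definition closed_lie_subgroup ::
    "('a::{t2_space, second_countable_topology}) monoid \<Rightarrow> ('a, 'g::finite_dim_normed) atlas \<Rightarrow>
     'a set \<Rightarrow> ('a, 'h::finite_dim_normed) atlas \<Rightarrow> bool" where
  "closed_lie_subgroup G A H B \<longleftrightarrow>
     subgroup H G \<and> closedin (top_of_set (carrier G)) H \<and>
     lie_group (G\<lparr>carrier := H\<rparr>) B \<and>
     smooth_map B A (\<lambda>x. x) \<and> (\<forall>x\<in>H. immersion_at B A (\<lambda>x. x) x)"

text \<open>The differential at the identity of the inclusion of a subgroup with atlas \<open>B\<close> identifies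
  the Lie algebra of the subgroup with a subset of the Lie algebra of \<open>G\<close>.\<close>

definition lie_incl ::
    "'a monoid \<Rightarrow> ('a, 'g::real_normed_vector) atlas \<Rightarrow> ('a, 'h::real_normed_vector) atlas \<Rightarrow> 'h \<Rightarrow> 'g"
  where
  "lie_incl G A B = tangent_map B A (\<lambda>x. x) \<one>\<^bsub>G\<^esub>"

definition sub_lie_algebra ::
    "'a monoid \<Rightarrow> ('a, 'g::real_normed_vector) atlas \<Rightarrow> ('a, 'h::real_normed_vector) atlas \<Rightarrow> 'g set"
  where
  "sub_lie_algebra G A B = range (lie_incl G A B)"

definition direct_sum_decomposition :: "'e::real_vector set \<Rightarrow> 'e set \<Rightarrow> bool" where
  "direct_sum_decomposition V W \<longleftrightarrow>
     subspace V \<and> subspace W \<and> V \<inter> W = {0} \<and> (\<forall>x. \<exists>v\<in>V. \<exists>w\<in>W. x = v + w)"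

text \<open>The restriction of \<open>Ad g\<close> to the ideal belonging to the normal subgroup with atlas \<open>B\<close>,
  read in the Lie algebra of that subgroup.\<close>

definition Ad_on ::
    "'a monoid \<Rightarrow> ('a, 'g::real_normed_vector) atlas \<Rightarrow> ('a, 'n::real_normed_vector) atlas \<Rightarrow>
     'a \<Rightarrow> 'n \<Rightarrow> 'n" where
  "Ad_on G A B g X = the_inv (lie_incl G A B) (Ad G A g (lie_incl G A B X))"

text \<open>\<open>coad G A B g lam\<close> is the functional mapping \<open>X\<close> to \<open>lam (Ad g X)\<close>, written \<open>Ad(g)\<^sup>*lam\<close>.\<close>

definition coad ::
    "'a monoid \<Rightarrow> ('a, 'g::real_normed_vector) atlas \<Rightarrow> ('a, 'n::real_normed_vector) atlas \<Rightarrow>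
     'a \<Rightarrow> ('n \<Rightarrow>\<^sub>L real) \<Rightarrow> ('n \<Rightarrow>\<^sub>L real)" where
  "coad G A B g lam = Blinfun (\<lambda>X. blinfun_apply lam (Ad_on G A B g X))"

text \<open>Regularity is automatic here: \<open>H\<close> will be locally compact and second countable.\<close>

definition left_haar_measure ::
    "('a::topological_space) monoid \<Rightarrow> 'a measure \<Rightarrow> bool" where
  "left_haar_measure H \<mu> \<longleftrightarrow>
     space \<mu> = carrier H \<and> sets \<mu> = sets (restrict_space borel (carrier H)) \<and>
     (\<forall>h\<in>carrier H. \<forall>E\<in>sets \<mu>. emeasure \<mu> (h <#\<^bsub>H\<^esub> E) = emeasure \<mu> E) \<and>
     (\<forall>K. K \<subseteq> carrier H \<and> compact K \<longrightarrow> emeasure \<mu> K < \<infinity>) \<and>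
     emeasure \<mu> (carrier H) \<noteq> 0"

text \<open>Elements of \<open>L\<^sup>2\<close> are represented by square integrable functions; everything below depends
  on them only up to null sets.\<close>

definition L2_functions :: "'a measure \<Rightarrow> ('a \<Rightarrow> complex) set" where
  "L2_functions \<mu> = {f \<in> borel_measurable \<mu>. integrable \<mu> (\<lambda>x. (cmod (f x))\<^sup>2)}"

definition L2_inner :: "'a measure \<Rightarrow> ('a \<Rightarrow> complex) \<Rightarrow> ('a \<Rightarrow> complex) \<Rightarrow> complex" where
  "L2_inner \<mu> f g = (LINT x|\<mu>. f x * cnj (g x))"

definition L2_norm_sq :: "'a measure \<Rightarrow> ('a \<Rightarrow> complex) \<Rightarrow> real" where
  "L2_norm_sq \<mu> f = (LINT x|\<mu>. (cmod (f x))\<^sup>2)"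

definition L2_frame :: "'a measure \<Rightarrow> 'i set \<Rightarrow> ('i \<Rightarrow> 'a \<Rightarrow> complex) \<Rightarrow> bool" where
  "L2_frame \<mu> I f \<longleftrightarrow>
     countable I \<and> (\<forall>k\<in>I. f k \<in> L2_functions \<mu>) \<and>
     (\<exists>a b. 0 < a \<and> a \<le> b \<and>
       (\<forall>g\<in>L2_functions \<mu>.
          (\<lambda>k. (cmod (L2_inner \<mu> g (f k)))\<^sup>2) summable_on I \<and>
          a * L2_norm_sq \<mu> g \<le> (\<Sum>\<^sub>\<infinity>k\<in>I. (cmod (L2_inner \<mu> g (f k)))\<^sup>2) \<and>
          (\<Sum>\<^sub>\<infinity>k\<in>I. (cmod (L2_inner \<mu> g (f k)))\<^sup>2) \<le> b * L2_norm_sq \<mu> g))"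

definition rep_N ::
    "'a::topological_space monoid \<Rightarrow> ('a, 'g::real_normed_vector) atlas \<Rightarrow>
     'a set \<Rightarrow> ('a, 'n::real_normed_vector) atlas \<Rightarrow> ('n \<Rightarrow>\<^sub>L real) \<Rightarrow>
     'a \<Rightarrow> ('a \<Rightarrow> complex) \<Rightarrow> 'a \<Rightarrow> complex" where
  "rep_N G A N AN lam x f h =
     exp (2 * of_real pi * \<i> *
          of_real (blinfun_apply (coad G A AN (inv\<^bsub>G\<^esub> h) lam) (lie_log (G\<lparr>carrier := N\<rparr>) AN x))) * f h"

definition rep_H :: "'a monoid \<Rightarrow> 'a \<Rightarrow> ('a \<Rightarrow> complex) \<Rightarrow> 'a \<Rightarrow> complex" where
  "rep_H G z f h = f (inv\<^bsub>G\<^esub> z \<otimes>\<^bsub>G\<^esub> h)"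

text \<open>An element \<open>x z\<close> of \<open>G = N H\<close>, with \<open>x\<close> in \<open>N\<close> and \<open>z\<close> in \<open>H\<close>, acts as \<open>\<pi>(x) \<pi>(z)\<close>.\<close>

definition induced_rep ::
    "'a::topological_space monoid \<Rightarrow> ('a, 'g::real_normed_vector) atlas \<Rightarrow>
     'a set \<Rightarrow> ('a, 'n::real_normed_vector) atlas \<Rightarrow> 'a set \<Rightarrow> ('n \<Rightarrow>\<^sub>L real) \<Rightarrow>
     'a \<Rightarrow> ('a \<Rightarrow> complex) \<Rightarrow> 'a \<Rightarrow> complex" where
  "induced_rep G A N AN H lam g f =
     (let (x, z) = (THE (x, z). x \<in> N \<and> z \<in> H \<and> g = x \<otimes>\<^bsub>G\<^esub> z)
      in rep_N G A N AN lam x (rep_H G z f))"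

definition supported_on :: "'a::topological_space set \<Rightarrow> ('a \<Rightarrow> complex) \<Rightarrow> 'a set \<Rightarrow> bool" where
  "supported_on H f S \<longleftrightarrow> (top_of_set H) closure_of {h \<in> H. f h \<noteq> 0} \<subseteq> S"

definition relatively_compact_nbhd :: "'a::topological_space set \<Rightarrow> 'a \<Rightarrow> 'a set \<Rightarrow> bool" where
  "relatively_compact_nbhd H x S \<longleftrightarrow>
     S \<subseteq> H \<and> (\<exists>U. openin (top_of_set H) U \<and> x \<in> U \<and> U \<subseteq> S) \<and>
     compact ((top_of_set H) closure_of S)"

end

theory Submission
  imports Defs
begin

text \<open>
  Since \<open>h \<mapsto> Ad(h\<^sup>-\<^sup>1)\<^sup>*\<lambda>\<close> is an immersion at the identity, there are
  \<open>Y\<^sub>1, \<dots>, Y\<^sub>r\<close> in the Lie algebra of \<open>N\<close> such that the functions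
  \<open>h \<mapsto> \<langle>Ad(h\<^sup>-\<^sup>1)\<^sup>*\<lambda>, Y\<^sub>i\<rangle>\<close> are coordinates on a compact neighbourhood \<open>S\<close> of the
  identity.  In these coordinates Haar measure is comparable to Lebesgue measure, and the characters
  belonging to a suitably scaled lattice spanned by the \<open>Y\<^sub>i\<close> become the exponentials of a cube
  containing the image of \<open>S\<close>.  By Parseval's identity their coefficients control the \<open>L\<^sup>2\<close> norm of
  functions supported on \<open>S\<close>.  Next choose a discrete set \<open>Z \<subseteq> H\<close> for which
  \<open>\<Sum>z\<in>Z. |f (z\<^sup>-\<^sup>1 h)|\<^sup>2\<close> lies between two positive constants.  Applying the local estimate to
  \<open>g\<close> times the conjugate of each translate \<open>f (z\<^sup>-\<^sup>1 \<cdot>)\<close>, and summing over \<open>z\<close>, gives the frame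
  inequalities for the functions \<open>\<pi>(exp (Ad z Y) z) f\<close>.
\<close>

subsection \<open>Finite-dimensional normed spaces\<close>

text \<open>Haar measure is known only through invariance, without a smooth density, so it is
  compared with Lebesgue measure up to constants. That suffices: for a measure r dx with c1 <= r <=
  c2, Parseval's identity survives as a two-sided inequality, and frame bounds absorb the constants.
  The neighbourhood is chosen before f; the function influences only the set Z of translations. One
  local system at the identity serves all of H because left translation by z carries the character
  of Y to that of Ad(z) Y, again an element of the Lie algebra of N. That Ad(g) preserves this Lie
  algebra is derived from continuity of conjugation on N, with no appeal to the exponential map.
  Dimension 0 is separate: H is then discrete, while the coordinate spaces \<open>real ^ 'n\<close>
  always have positive dimension.\<close>

lemma finite_basis_exists:
  obtains B :: "'a::finite_dim_normed set" where "finite B" "independent B" "span B = UNIV"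
proof -
  obtain B0 :: "'a set" where B0: "finite B0" "\<And>x. \<exists>c. x = (\<Sum>b\<in>B0. c b *\<^sub>R b)"
    using finite_spanning_set by blast
  have sp: "span B0 = UNIV"
    using B0 by (auto simp: span_finite image_iff)
  obtain B where "B \<subseteq> B0" "independent B" "B0 \<subseteq> span B"
    using maximal_independent_subset[of B0] by metis
  then show thesis
    using that[of B] finite_subset[OF _ B0(1)] sp span_mono[of B0 "span B"] unfolding span_span by blast
qed

text \<open>An index type for coordinates.  It has one element too many in dimension 0, and it is
  well-ordered because the change of variables formula for \<open>real ^ 'n\<close> requires that.\<close>

typedef (overloaded) 'a coord_index = "{..<max 1 (dim (UNIV :: 'a::finite_dim_normed set))}"
  by (rule exI[of _ 0]) auto

instance coord_index :: (finite_dim_normed) finite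
proof
  have "(UNIV :: 'a coord_index set) = Abs_coord_index ` {..<max 1 (dim (UNIV :: 'a set))}"
    using type_definition.Abs_image[OF type_definition_coord_index] by auto
  then show "finite (UNIV :: 'a coord_index set)" by (metis finite_imageI finite_lessThan)
qed

instantiation coord_index :: (finite_dim_normed) wellorder
begin

definition less_eq_coord_index :: "'a coord_index \<Rightarrow> 'a coord_index \<Rightarrow> bool" where
  "less_eq_coord_index x y \<longleftrightarrow> Rep_coord_index x \<le> Rep_coord_index y"

definition less_coord_index :: "'a coord_index \<Rightarrow> 'a coord_index \<Rightarrow> bool" where
  "less_coord_index x y \<longleftrightarrow> Rep_coord_index x < Rep_coord_index y"

instance
proof
  fix P :: "'a coord_index \<Rightarrow> bool" and a
  assume *: "\<And>x. (\<And>y. y < x \<Longrightarrow> P y) \<Longrightarrow> P x"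
  show "P a"
    by (induction "Rep_coord_index a" arbitrary: a rule: less_induct)
       (auto intro: * simp: less_coord_index_def)
qed (auto simp: less_eq_coord_index_def less_coord_index_def Rep_coord_index_inject)

end

lemma card_coord_index: "CARD('a::finite_dim_normed coord_index) = max 1 (dim (UNIV :: 'a set))"
  using type_definition.card[OF type_definition_coord_index] by simp

text \<open>The index type always has an element, so its cardinality matches a basis only in
  positive dimension.\<close>

lemma coordinate_isomorphism:
  assumes "dim (UNIV :: 'a::finite_dim_normed set) \<noteq> 0"
  obtains L :: "real ^ 'a::finite_dim_normed coord_index \<Rightarrow> 'a" where "linear L" "bij L"
proof -
  obtain B :: "'a set" where B: "finite B" "independent B" "span B = UNIV"
    using finite_basis_exists by blast
  have "card B = CARD('a coord_index)"
    using B assms unfolding card_coord_index by (metis dim_eq_card dim_span max_def not_less_eq_eq One_nat_def le_0_eq)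
  then obtain e :: "'a coord_index \<Rightarrow> 'a" where e: "bij_betw e UNIV B"
    using B(1) by (metis finite_class.finite_UNIV finite_same_card_bij)
  define L :: "real ^ 'a coord_index \<Rightarrow> 'a" where "L x = (\<Sum>i\<in>UNIV. (x $ i) *\<^sub>R e i)" for x
  have lin: "linear L"
    by (rule linearI) (auto simp: L_def scaleR_add_left sum.distrib scaleR_sum_right)
  have inj: "inj L"
    unfolding linear_injective_0[OF lin]
  proof (intro allI impI)
    fix x assume "L x = 0"
    define c where "c b = x $ (inv_into UNIV e b)" for b
    have "(\<Sum>b\<in>B. c b *\<^sub>R b) = (\<Sum>i\<in>UNIV. c (e i) *\<^sub>R e i)"
      using sum.reindex_bij_betw[OF e, of "\<lambda>b. c b *\<^sub>R b"] by simp
    also have "\<dots> = L x"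
      using e unfolding L_def c_def by (auto simp: bij_betw_def)
    finally have "(\<Sum>b\<in>B. c b *\<^sub>R b) = 0" using \<open>L x = 0\<close> by simp
    then have "\<forall>b\<in>B. c b = 0" using B(1,2) independentD by blast
    then have "x $ i = 0" for i
      using e unfolding c_def bij_betw_def by (metis inv_into_f_f rangeI iso_tuple_UNIV_I)
    then show "x = 0" by (simp add: vec_eq_iff)
  qed
  have "surj L"
  proof -
    have "y \<in> range L" for y
    proof -
      have "y \<in> span B" using B by simp
      then obtain c where y: "y = (\<Sum>b\<in>B. c b *\<^sub>R b)" using B(1) by (auto simp: span_finite)
      have "y = L (\<chi> i. c (e i))"
        using sum.reindex_bij_betw[OF e, of "\<lambda>b. c b *\<^sub>R b"] by (simp add: L_def y)
      then show ?thesis by blast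
    qed
    then show ?thesis by auto
  qed
  with inj lin that show thesis by (auto simp: bij_def)
qed

lemma dim_0_imp_0:
  fixes x :: "'a::finite_dim_normed"
  assumes "dim (UNIV :: 'a set) = 0"
  shows "x = 0"
proof -
  obtain B :: "'a set" where B: "finite B" "independent B" "span B = UNIV"
    using finite_basis_exists by blast
  then have "B = {}" using assms by (metis card_0_eq dim_eq_card dim_span)
  then show ?thesis using B(3) by auto
qed

text \<open>On the compact unit sphere the norm of the image attains its minimum, positive by
  injectivity; homogeneity spreads the bound. It expresses continuity of the inverse.\<close>

lemma linear_bij_bounded_below:
  fixes L :: "'e::euclidean_space \<Rightarrow> 'a::real_normed_vector"
  assumes "linear L" "inj L"
  obtains m where "m > 0" "\<And>x. m * norm x \<le> norm (L x)"
proof -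
  have bl: "bounded_linear L" using assms(1) linear_conv_bounded_linear by blast
  have "continuous_on (sphere 0 1) (\<lambda>x. norm (L x))"
    by (intro continuous_on_norm linear_continuous_on bl)
  moreover have "compact (sphere 0 1 :: 'e set)" "sphere 0 1 \<noteq> ({} :: 'e set)" by auto
  ultimately obtain x0 :: 'e where x0: "x0 \<in> sphere 0 1" "\<And>x. x \<in> sphere 0 1 \<Longrightarrow> norm (L x0) \<le> norm (L x)"
    using continuous_attains_inf by metis
  have "L x0 \<noteq> 0" using x0(1) assms linear_injective_0 by fastforce
  show thesis
  proof (rule that[of "norm (L x0)"])
    show "norm (L x0) > 0" using \<open>L x0 \<noteq> 0\<close> by simp
    fix x :: 'e
    show "norm (L x0) * norm x \<le> norm (L x)"
    proof (cases "x = 0")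
      case False
      have "norm (L x0) \<le> norm (L (x /\<^sub>R norm x))" using False by (intro x0(2)) simp
      then show ?thesis using False assms(1) by (simp add: linear_scale field_simps)
    qed simp
  qed
qed

text \<open>Coordinates reduce this to Euclidean space, where linear maps are bounded; the lower
  bound for \<open>L\<close> converts the Euclidean norm of the coordinates back into the given
  norm.\<close>

lemma linear_imp_bounded_linear:
  fixes f :: "'a::finite_dim_normed \<Rightarrow> 'b::real_normed_vector"
  assumes f: "linear f"
  shows "bounded_linear f"
proof (cases "dim (UNIV :: 'a set) = 0")
  case True
  then have "f = (\<lambda>x. 0)" using dim_0_imp_0[OF True] f linear_0 by (metis (full_types))
  then show ?thesis by simp
next
  case False
  then obtain L :: "real ^ 'a coord_index \<Rightarrow> 'a" where L: "linear L" "bij L"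
    by (rule coordinate_isomorphism)
  obtain m where m: "m > 0" "\<And>x. m * norm x \<le> norm (L x)"
    using linear_bij_bounded_below[OF L(1) bij_is_inj[OF L(2)]] by blast
  have "bounded_linear (f \<circ> L)"
    using linear_compose[OF L(1) f] linear_conv_bounded_linear by blast
  then obtain K where K: "K \<ge> 0" "\<And>x. norm (f (L x)) \<le> norm x * K"
    using bounded_linear.nonneg_bounded by (metis comp_apply)
  have "norm (f y) \<le> norm y * (K / m)" for y
  proof -
    obtain x where x: "y = L x" using L(2) by (metis bij_pointE)
    have "norm (f y) \<le> norm x * K" using K x by simp
    also have "\<dots> \<le> (norm y / m) * K" using m x K(1) by (intro mult_right_mono) (auto simp: field_simps)
    finally show ?thesis by simp
  qed
  then show ?thesis using f by (intro bounded_linear_intro[where K = "K / m"]) (simp_all add: linear_add linear_scale)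
qed

lemma coordinate_homeomorphism:
  assumes "dim (UNIV :: 'a::finite_dim_normed set) \<noteq> 0"
  obtains L :: "real ^ 'a::finite_dim_normed coord_index \<Rightarrow> 'a" and L' where "bounded_linear L" "bounded_linear L'"
    "\<And>x. L' (L x) = x" "\<And>y. L (L' y) = y"
proof -
  obtain L :: "real ^ 'a coord_index \<Rightarrow> 'a" where L: "linear L" "bij L"
    by (rule coordinate_isomorphism[OF assms])
  have inv: "inv_into UNIV L (L x) = x" "L (inv_into UNIV L y) = y" for x y
    using L(2) by (auto simp: bij_def surj_f_inv_f)
  have "linear (inv_into UNIV L)"
  proof (rule linearI)
    fix x y :: 'a and r :: real
    have "L (inv_into UNIV L x + inv_into UNIV L y) = x + y" "L (r *\<^sub>R inv_into UNIV L x) = r *\<^sub>R x"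
      using L(1) inv(2) by (simp_all add: linear_add linear_scale)
    then show "inv_into UNIV L (x + y) = inv_into UNIV L x + inv_into UNIV L y"
      "inv_into UNIV L (r *\<^sub>R x) = r *\<^sub>R inv_into UNIV L x"
      using inv(1) by metis+
  qed
  then show thesis
    using that[of L "inv_into UNIV L"] linear_imp_bounded_linear L(1) inv linear_conv_bounded_linear[of L] by auto
qed

instance prod :: (finite_dim_normed, finite_dim_normed) finite_dim_normed
proof
  obtain A :: "'a set" where A: "finite A" "\<And>x. \<exists>c. x = (\<Sum>b\<in>A. c b *\<^sub>R b)"
    using finite_spanning_set by blast
  obtain B :: "'b set" where B: "finite B" "\<And>x. \<exists>c. x = (\<Sum>b\<in>B. c b *\<^sub>R b)"
    using finite_spanning_set by blast
  let ?C = "(\<lambda>a. (a, 0 :: 'b)) ` A \<union> (\<lambda>b. (0 :: 'a, b)) ` B"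
  have span: "span ?C = UNIV"
  proof -
    have "(x, y) \<in> span ?C" for x y
    proof -
      obtain c d where c: "x = (\<Sum>b\<in>A. c b *\<^sub>R b)" and d: "y = (\<Sum>b\<in>B. d b *\<^sub>R b)"
        using A(2) B(2) by metis
      have "(x, y) = (\<Sum>b\<in>A. c b *\<^sub>R (b, 0)) + (\<Sum>b\<in>B. d b *\<^sub>R (0, b))"
        unfolding c d by (auto simp: prod_eq_iff fst_sum snd_sum)
      also have "\<dots> \<in> span ?C"
        by (intro span_add span_sum span_scale span_base) auto
      finally show ?thesis .
    qed
    then show ?thesis by auto
  qed
  show "\<exists>B. finite B \<and> (\<forall>x::'a \<times> 'b. \<exists>c. x = (\<Sum>b\<in>B. c b *\<^sub>R b))"
  proof (intro exI[of _ ?C] conjI allI)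
    show fin: "finite ?C" using A B by auto
    show "\<exists>c. x = (\<Sum>b\<in>?C. c b *\<^sub>R b)" for x
      using span span_finite[OF fin] by auto
  qed
qed

subsection \<open>Calculus of \<open>C\<^sup>k\<close> maps\<close>

text \<open>Openness makes the two functions agree near each point, so that they share derivatives
  there and not only values.\<close>

lemma Ck_on_cong:
  assumes "open S" "\<And>x. x \<in> S \<Longrightarrow> f x = g x" "Ck_on k S f"
  shows "Ck_on k S g"
  using assms
proof (induction k arbitrary: f g)
  case 0
  then show ?case using continuous_on_cong by (metis Ck_on.simps(1))
next
  case (Suc k)
  have D: "(g has_derivative frechet_derivative f (at x)) (at x)" if "x \<in> S" for x
    using Suc.prems that has_derivative_transform_within_open[of f _ x UNIV S g]
    by (auto simp: frechet_derivative_works)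
  then have "frechet_derivative f (at x) = frechet_derivative g (at x)" if "x \<in> S" for x
    using that frechet_derivative_at by blast
  then have "Ck_on k S (\<lambda>x. frechet_derivative g (at x) v)" for v
    using Suc.IH[of "\<lambda>x. frechet_derivative f (at x) v"] Suc.prems by auto
  with D show ?case by (auto simp: differentiable_def)
qed

text \<open>\<open>frechet_derivative\<close> is a choice; uniqueness of derivatives lets any
  explicitly computed family \<open>f'\<close> take its place in an induction on the order.\<close>

lemma Ck_on_SucI:
  assumes "open S" "\<And>x. x \<in> S \<Longrightarrow> (f has_derivative f' x) (at x)" "\<And>v. Ck_on k S (\<lambda>x. f' x v)"
  shows "Ck_on (Suc k) S f"
proof -
  have "f' x = frechet_derivative f (at x)" if "x \<in> S" for x
    using assms(2)[OF that] frechet_derivative_at by blast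
  then have "Ck_on k S (\<lambda>x. frechet_derivative f (at x) v)" for v
    by (intro Ck_on_cong[OF assms(1) _ assms(3)[of v]]) auto
  then show ?thesis using assms(2) by (auto simp: differentiable_def)
qed

lemma Ck_on_has_derivative:
  assumes "Ck_on (Suc k) S f" "x \<in> S"
  shows "(f has_derivative frechet_derivative f (at x)) (at x)"
  using assms by (auto simp: frechet_derivative_works)

lemma Ck_on_Suc_imp: "Ck_on (Suc k) S f \<Longrightarrow> Ck_on k S f"
proof (induction k arbitrary: f)
  case 0
  then show ?case
    by (auto intro!: continuous_at_imp_continuous_on differentiable_imp_continuous_within)
next
  case (Suc k)
  then show ?case by (metis Ck_on.simps(2))
qed

lemma Ck_on_subset: "Ck_on k S f \<Longrightarrow> T \<subseteq> S \<Longrightarrow> Ck_on k T f"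
  by (induction k arbitrary: f) (auto intro: continuous_on_subset)

lemma Ck_on_imp_continuous: "Ck_on k S f \<Longrightarrow> continuous_on S f"
  by (induction k) (use Ck_on_Suc_imp in \<open>auto simp del: Ck_on.simps(2)\<close>)

lemma Ck_on_local:
  assumes "\<And>x. x \<in> S \<Longrightarrow> \<exists>T. open T \<and> x \<in> T \<and> Ck_on k T f"
  shows "Ck_on k S f"
  using assms
proof (induction k arbitrary: f)
  case 0
  have "continuous (at x) f" if "x \<in> S" for x
    using 0[OF that] by (auto simp: continuous_on_eq_continuous_at)
  then show ?case by (auto simp: continuous_at_imp_continuous_on)
next
  case (Suc k)
  have "f differentiable (at x)" if "x \<in> S" for x using Suc.prems[OF that] by auto
  moreover have "Ck_on k S (\<lambda>x. frechet_derivative f (at x) v)" for v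
    using Suc.prems by (intro Suc.IH) fastforce
  ultimately show ?case by simp
qed

lemma Ck_on_const: "open S \<Longrightarrow> Ck_on k S (\<lambda>x. c)"
proof (induction k arbitrary: c)
  case (Suc k)
  show ?case
    by (rule Ck_on_SucI[OF Suc.prems, where f' = "\<lambda>_ _. 0"]) (use Suc in auto)
qed auto

lemma Ck_on_bounded_linear_compose:
  assumes "open S" "bounded_linear b" "Ck_on k S f"
  shows "Ck_on k S (\<lambda>x. b (f x))"
  using assms(3)
proof (induction k arbitrary: f)
  case 0
  then show ?case using assms(2) by (auto intro: bounded_linear.continuous_on)
next
  case (Suc k)
  show ?case
  proof (rule Ck_on_SucI[OF assms(1)])
    fix x assume "x \<in> S"
    show "((\<lambda>x. b (f x)) has_derivative (\<lambda>v. b (frechet_derivative f (at x) v))) (at x)"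
      using Ck_on_has_derivative[OF Suc.prems \<open>x \<in> S\<close>] by (rule bounded_linear.has_derivative[OF assms(2)])
  next
    show "Ck_on k S (\<lambda>x. b (frechet_derivative f (at x) v))" for v
      using Suc.prems by (intro Suc.IH) auto
  qed
qed

lemma Ck_on_id: "open S \<Longrightarrow> Ck_on k S (\<lambda>x. x)"
proof (cases k)
  case (Suc j)
  assume S: "open S"
  show ?thesis unfolding Suc
    by (rule Ck_on_SucI[OF S, where f' = "\<lambda>_ v. v"]) (auto intro: Ck_on_const S)
qed auto

lemma Ck_on_bounded_linear: "open S \<Longrightarrow> bounded_linear b \<Longrightarrow> Ck_on k S b"
  using Ck_on_bounded_linear_compose[OF _ _ Ck_on_id] by blast

lemma Ck_on_add:
  assumes "open S" "Ck_on k S f" "Ck_on k S g"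
  shows "Ck_on k S (\<lambda>x. f x + g x)"
  using assms(2,3)
proof (induction k arbitrary: f g)
  case 0
  then show ?case by (auto intro: continuous_on_add)
next
  case (Suc k)
  show ?case
  proof (rule Ck_on_SucI[OF assms(1)])
    fix x assume "x \<in> S"
    show "((\<lambda>x. f x + g x) has_derivative (\<lambda>v. frechet_derivative f (at x) v + frechet_derivative g (at x) v)) (at x)"
      using Suc.prems \<open>x \<in> S\<close> by (intro has_derivative_add Ck_on_has_derivative)
  next
    show "Ck_on k S (\<lambda>x. frechet_derivative f (at x) v + frechet_derivative g (at x) v)" for v
      using Suc.prems by (intro Suc.IH) auto
  qed
qed

lemma Ck_on_sum:
  assumes "open S" "\<And>i. i \<in> I \<Longrightarrow> Ck_on k S (f i)"
  shows "Ck_on k S (\<lambda>x. \<Sum>i\<in>I. f i x)"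
  using assms(2)
  by (induction I rule: infinite_finite_induct) (auto intro: Ck_on_const Ck_on_add assms(1))

lemma Ck_on_scaleR:
  assumes "open S" "Ck_on k S a" "Ck_on k S f"
  shows "Ck_on k S (\<lambda>x. a x *\<^sub>R f x)"
  using assms(2,3)
proof (induction k arbitrary: a f)
  case 0
  then show ?case by (auto intro: continuous_on_scaleR)
next
  case (Suc k)
  show ?case
  proof (rule Ck_on_SucI[OF assms(1)])
    fix x assume "x \<in> S"
    show "((\<lambda>x. a x *\<^sub>R f x) has_derivative (\<lambda>v. a x *\<^sub>R frechet_derivative f (at x) v + frechet_derivative a (at x) v *\<^sub>R f x)) (at x)"
      using Suc.prems \<open>x \<in> S\<close> by (intro has_derivative_scaleR Ck_on_has_derivative)
  next
    show "Ck_on k S (\<lambda>x. a x *\<^sub>R frechet_derivative f (at x) v + frechet_derivative a (at x) v *\<^sub>R f x)" for v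
      by (rule Ck_on_add[OF assms(1)]; rule Suc.IH)
         (use Suc.prems Suc.prems[THEN Ck_on_Suc_imp] in auto)
  qed
qed

lemma Ck_on_Pair:
  assumes "open S" "Ck_on k S f" "Ck_on k S g"
  shows "Ck_on k S (\<lambda>x. (f x, g x))"
proof -
  have "bounded_linear (\<lambda>x :: 'b. (x, 0 :: 'c))" "bounded_linear (\<lambda>y :: 'c. (0 :: 'b, y))"
    by (auto intro!: bounded_linear_Pair bounded_linear_ident bounded_linear_zero)
  then have "Ck_on k S (\<lambda>x. (f x, 0) + (0, g x))"
    by (intro Ck_on_add[OF assms(1)] Ck_on_bounded_linear_compose[OF assms(1) _ assms(2)]
        Ck_on_bounded_linear_compose[OF assms(1) _ assms(3)])
  then show ?thesis by simp
qed

lemma bounded_linear_representation: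
  fixes B :: "'a::finite_dim_normed set"
  assumes "independent B" "span B = UNIV"
  shows "bounded_linear (\<lambda>x. representation B x b)"
  by (rule linear_imp_bounded_linear, rule linearI)
     (use assms in \<open>auto simp: representation_add representation_scale\<close>)

text \<open>The derivative of a composition is expanded in a basis of the intermediate space, which
  reduces its dependence on the base point to finitely many directional derivatives.\<close>

lemma Ck_on_compose:
  fixes f :: "'a::real_normed_vector \<Rightarrow> 'b::finite_dim_normed"
  assumes "open S" "open T" "f ` S \<subseteq> T" "Ck_on k S f" "Ck_on k T g"
  shows "Ck_on k S (\<lambda>x. g (f x))"
  using assms(4,5)
proof (induction k arbitrary: g)
  case 0
  then show ?case using assms(3) by (auto intro: continuous_on_compose2)
next
  case (Suc k)
  obtain B :: "'b set" where B: "finite B" "independent B" "span B = UNIV"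
    using finite_basis_exists by blast
  let ?D = "\<lambda>x v. frechet_derivative g (at (f x)) (frechet_derivative f (at x) v)"
  show ?case
  proof (rule Ck_on_SucI[OF assms(1)])
    fix x assume x: "x \<in> S"
    show "((\<lambda>x. g (f x)) has_derivative ?D x) (at x)"
      using x assms(3)
      by (rule_tac has_derivative_compose[OF Ck_on_has_derivative[OF Suc.prems(1)]
          Ck_on_has_derivative[OF Suc.prems(2)]]) auto
  next
    fix v
    have "Ck_on k S (\<lambda>x. \<Sum>b\<in>B. representation B (frechet_derivative f (at x) v) b *\<^sub>R
        frechet_derivative g (at (f x)) b)" (is "Ck_on k S ?E")
      using Suc.prems Ck_on_Suc_imp[OF Suc.prems(1)]
      by (intro Ck_on_sum[OF assms(1)] Ck_on_scaleR[OF assms(1)] Suc.IH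
          Ck_on_bounded_linear_compose[OF assms(1) bounded_linear_representation[OF B(2,3)]]) auto
    moreover have "?E x = ?D x v" if x: "x \<in> S" for x
    proof -
      have lin: "linear (frechet_derivative g (at (f x)))"
        using Suc.prems(2) x assms(3) by (intro linear_frechet_derivative) auto
      have "frechet_derivative f (at x) v =
          (\<Sum>b\<in>B. representation B (frechet_derivative f (at x) v) b *\<^sub>R b)"
        using B sum_representation_eq[of B _ B] by auto
      then have "?D x v = frechet_derivative g (at (f x))
          (\<Sum>b\<in>B. representation B (frechet_derivative f (at x) v) b *\<^sub>R b)" by simp
      then show ?thesis using lin by (simp add: linear_sum linear_scale)
    qed
    ultimately show "Ck_on k S (\<lambda>x. ?D x v)"
      by (rule_tac Ck_on_cong[OF assms(1), of ?E]) auto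
  qed
qed

lemma smooth_on_imp_Ck: "smooth_on S f \<Longrightarrow> Ck_on k S f"
  by (simp add: smooth_on_def)

lemma smooth_on_differentiable: "smooth_on S f \<Longrightarrow> x \<in> S \<Longrightarrow> f differentiable (at x)"
  using smooth_on_imp_Ck[of S f 1] by simp

lemma smooth_on_local:
  assumes "\<And>x. x \<in> S \<Longrightarrow> \<exists>T. open T \<and> x \<in> T \<and> smooth_on T f"
  shows "smooth_on S f"
  unfolding smooth_on_def using assms[unfolded smooth_on_def] by (intro allI Ck_on_local) blast

lemma smooth_on_eq:
  assumes "open S" "\<And>x. x \<in> S \<Longrightarrow> f x = g x" "smooth_on S f"
  shows "smooth_on S g"
  using assms(3) Ck_on_cong[OF assms(1,2)] unfolding smooth_on_def by simp

lemma smooth_on_subset: "smooth_on S f \<Longrightarrow> T \<subseteq> S \<Longrightarrow> smooth_on T f"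
  unfolding smooth_on_def by (auto intro: Ck_on_subset)

lemma smooth_on_compose:
  fixes f :: "'a::real_normed_vector \<Rightarrow> 'b::finite_dim_normed"
  assumes "open S" "open T" "f ` S \<subseteq> T" "smooth_on S f" "smooth_on T g"
  shows "smooth_on S (\<lambda>x. g (f x))"
  using assms(4,5) Ck_on_compose[OF assms(1-3)] unfolding smooth_on_def by metis

lemma smooth_on_Pair:
  "open S \<Longrightarrow> smooth_on S f \<Longrightarrow> smooth_on S g \<Longrightarrow> smooth_on S (\<lambda>x. (f x, g x))"
  unfolding smooth_on_def by (simp add: Ck_on_Pair)

lemma smooth_on_bounded_linear: "open S \<Longrightarrow> bounded_linear b \<Longrightarrow> smooth_on S b"
  unfolding smooth_on_def by (simp add: Ck_on_bounded_linear)

lemma smooth_on_const: "open S \<Longrightarrow> smooth_on S (\<lambda>x. c)"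
  unfolding smooth_on_def by (simp add: Ck_on_const)

subsection \<open>Smooth maps between manifolds\<close>

locale manifold =
  fixes A :: "('a::{t2_space, second_countable_topology}, 'e::finite_dim_normed) atlas"
  assumes smooth_manifold: "smooth_manifold A"
begin

lemma chart_subset: "c \<in> A \<Longrightarrow> fst c \<subseteq> points A"
  by (auto simp: points_def)

lemma chart_openin: "c \<in> A \<Longrightarrow> openin (top_of_set (points A)) (fst c)"
  and chart_open_image: "c \<in> A \<Longrightarrow> open (snd c ` fst c)"
  and chart_homeomorphism: "c \<in> A \<Longrightarrow> homeomorphism (fst c) (snd c ` fst c) (snd c) (chart_inv c)"
  and transition_smooth: "c \<in> A \<Longrightarrow> d \<in> A \<Longrightarrow> smooth_on (snd c ` (fst c \<inter> fst d)) (snd d \<circ> chart_inv c)"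
  using smooth_manifold unfolding smooth_manifold_def by auto

lemma chart_inv_chart [simp]: "c \<in> A \<Longrightarrow> x \<in> fst c \<Longrightarrow> chart_inv c (snd c x) = x"
  using chart_homeomorphism by (auto simp: homeomorphism_def)

lemma chart_chart_inv: "c \<in> A \<Longrightarrow> u \<in> snd c ` fst c \<Longrightarrow> snd c (chart_inv c u) = u"
  by auto

lemma chart_inv_in: "c \<in> A \<Longrightarrow> u \<in> snd c ` fst c \<Longrightarrow> chart_inv c u \<in> fst c"
  by auto

lemma continuous_on_chart_inv: "c \<in> A \<Longrightarrow> continuous_on (snd c ` fst c) (chart_inv c)"
  and continuous_on_chart: "c \<in> A \<Longrightarrow> continuous_on (fst c) (snd c)"
  using chart_homeomorphism by (auto simp: homeomorphism_def)

lemma chart_image_open: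
  assumes "c \<in> A" "openin (top_of_set (points A)) V"
  shows "open (snd c ` (fst c \<inter> V))"
proof -
  obtain T where T: "open T" "V = points A \<inter> T" using assms(2) by (auto simp: openin_open)
  have "snd c ` (fst c \<inter> V) = snd c ` fst c \<inter> chart_inv c -` T"
    using T chart_subset[OF assms(1)] chart_inv_chart[OF assms(1)] by force
  also have "open \<dots>"
    using continuous_open_preimage[OF continuous_on_chart_inv[OF assms(1)] chart_open_image[OF assms(1)] T(1)] .
  finally show ?thesis .
qed

lemma chart_vimage_open:
  assumes "c \<in> A" "continuous_on (points A) F" "F ` points A \<subseteq> X" "openin (top_of_set X) V"
  shows "open (snd c ` (fst c \<inter> F -` V))"
proof -
  have "openin (top_of_set (points A)) (points A \<inter> F -` V)"
    using assms(2-4) continuous_openin_preimage by (metis Pi_I image_subset_iff)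
  from chart_image_open[OF assms(1) this] show ?thesis
    using chart_subset[OF assms(1)] by (metis Int_assoc Int_absorb2)
qed

lemma smooth_map_imp_chart:
  assumes "smooth_map A B F" "c \<in> A" "d \<in> B"
  shows "smooth_on (snd c ` (fst c \<inter> F -` fst d)) (\<lambda>u. snd d (F (chart_inv c u)))"
  using assms unfolding smooth_map_def comp_def by blast

lemma smooth_map_id: "smooth_map A A (\<lambda>x. x)"
  unfolding smooth_map_def using transition_smooth by (auto simp: comp_def vimage_def)

lemma chart_at: "x \<in> points A \<Longrightarrow> chart_at A x \<in> A" "x \<in> points A \<Longrightarrow> x \<in> fst (chart_at A x)"
proof -
  have "x \<in> points A \<Longrightarrow> \<exists>c. c \<in> A \<and> x \<in> fst c" by (auto simp: points_def)
  from someI_ex[OF this] show "x \<in> points A \<Longrightarrow> chart_at A x \<in> A" "x \<in> points A \<Longrightarrow> x \<in> fst (chart_at A x)"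
    unfolding chart_at_def by auto
qed

end

lemma smooth_mapD:
  assumes "smooth_map A B F"
  shows "F ` points A \<subseteq> points B" "continuous_on (points A) F"
  using assms by (auto simp: smooth_map_def)

text \<open>No single chart of \<open>B\<close> need contain the image of a chart domain of
  \<open>A\<close>, so smoothness is checked near each point, with a chart of \<open>B\<close>
  chosen around \<open>F x\<close>.\<close>

lemma smooth_map_compose:
  fixes F :: "'a::{t2_space, second_countable_topology} \<Rightarrow> 'b::{t2_space, second_countable_topology}"
    and A :: "('a, 'e::finite_dim_normed) atlas" and B :: "('b, 'f::finite_dim_normed) atlas"
    and C :: "('c::{t2_space, second_countable_topology}, 'g::finite_dim_normed) atlas"
  assumes "smooth_manifold A" "smooth_manifold B" "smooth_manifold C"
    and "smooth_map A B F" "smooth_map B C K"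
  shows "smooth_map A C (\<lambda>x. K (F x))"
proof -
  interpret A: manifold A by standard fact
  interpret B: manifold B by standard fact
  interpret C: manifold C by standard fact
  note F = smooth_mapD[OF assms(4)] note K = smooth_mapD[OF assms(5)]
  show ?thesis unfolding smooth_map_def
  proof (intro conjI ballI)
    show "(\<lambda>x. K (F x)) ` points A \<subseteq> points C" using F K by auto
    show KF: "continuous_on (points A) (\<lambda>x. K (F x))"
      using continuous_on_compose2[OF K(2) F(2,1)] .
    fix c d assume c: "c \<in> A" and d: "d \<in> C"
    show "smooth_on (snd c ` (fst c \<inter> (\<lambda>x. K (F x)) -` fst d)) (snd d \<circ> (\<lambda>x. K (F x)) \<circ> chart_inv c)"
    proof (rule smooth_on_local)
      fix u assume "u \<in> snd c ` (fst c \<inter> (\<lambda>x. K (F x)) -` fst d)"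
      then obtain x where x: "x \<in> fst c" "K (F x) \<in> fst d" "u = snd c x" by auto
      then have "F x \<in> points B" using F A.chart_subset[OF c] by auto
      then obtain b where b: "b \<in> B" "F x \<in> fst b" by (auto simp: points_def)
      let ?S = "snd c ` (fst c \<inter> F -` fst b)"
      let ?f = "\<lambda>u. snd b (F (chart_inv c u))"
      let ?T = "snd b ` (fst b \<inter> K -` fst d)"
      have S: "smooth_on ?S ?f"
        by (rule A.smooth_map_imp_chart[OF assms(4) c b(1)])
      have T: "smooth_on ?T (\<lambda>u. snd d (K (chart_inv b u)))"
        by (rule B.smooth_map_imp_chart[OF assms(5) b(1) d])
      have oS: "open ?S"
        by (rule A.chart_vimage_open[OF c F(2) F(1) B.chart_openin[OF b(1)]])
      have oT: "open ?T"
        by (rule B.chart_vimage_open[OF b(1) K(2) K(1) C.chart_openin[OF d]])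
      \<comment> \<open>The coordinates for which \<open>F\<close> lands in the domain of
        \<open>b\<close> and \<open>K\<close> afterwards in that of \<open>d\<close>; there the
        intermediate chart cancels.\<close>
      define R where "R = ?S \<inter> ?f -` ?T"
      have oR: "open R" unfolding R_def
        by (rule continuous_open_preimage[OF Ck_on_imp_continuous[OF smooth_on_imp_Ck[OF S]] oS oT])
      have "smooth_on R (\<lambda>u. snd d (K (chart_inv b (?f u))))"
        by (rule smooth_on_compose[OF oR oT _ smooth_on_subset[OF S] T]) (auto simp: R_def)
      then have "smooth_on R (snd d \<circ> (\<lambda>x. K (F x)) \<circ> chart_inv c)"
      proof (rule smooth_on_eq[OF oR, rotated])
        fix u assume "u \<in> R"
        then have "F (chart_inv c u) \<in> fst b" using c by (auto simp: R_def)
        then show "snd d (K (chart_inv b (?f u))) = (snd d \<circ> (\<lambda>x. K (F x)) \<circ> chart_inv c) u"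
          using b by simp
      qed
      moreover have "u \<in> R"
        using x b c by (auto simp: R_def)
      ultimately show "\<exists>T. open T \<and> u \<in> T \<and> smooth_on T (snd d \<circ> (\<lambda>x. K (F x)) \<circ> chart_inv c)"
        using oR by blast
    qed
  qed
qed

lemma smooth_manifold_vector_space: "smooth_manifold (vector_space_atlas :: ('a::{finite_dim_normed, second_countable_topology}, 'a) atlas)"
proof -
  have "chart_inv (UNIV, id :: 'a \<Rightarrow> 'a) = id"
    by (rule ext) (simp add: chart_inv_def the_inv_into_f_eq)
  then show ?thesis
    unfolding smooth_manifold_def vector_space_atlas_def points_def homeomorphism_def
    using smooth_on_bounded_linear[OF open_UNIV bounded_linear_ident]
    by (auto simp: id_def comp_def)
qed

lemma chart_inv_prod:
  assumes "inj_on (snd c) (fst c)" "inj_on (snd d) (fst d)" "u \<in> snd c ` fst c" "v \<in> snd d ` fst d"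
  shows "chart_inv (fst c \<times> fst d, map_prod (snd c) (snd d)) (u, v) = (chart_inv c u, chart_inv d v)"
  unfolding chart_inv_def
  by (rule the_inv_into_f_eq) (use assms in \<open>auto simp: the_inv_into_f_f intro!: map_prod_inj_on\<close>)

lemma points_prod_atlas: "points (prod_atlas A B) = points A \<times> points B"
proof
  show "points (prod_atlas A B) \<subseteq> points A \<times> points B"
    by (auto simp: points_def prod_atlas_def)
  show "points A \<times> points B \<subseteq> points (prod_atlas A B)"
    unfolding points_def prod_atlas_def by clarsimp (metis fst_conv mem_Sigma_iff)
qed

lemma (in manifold) inj_on_chart: "c \<in> A \<Longrightarrow> inj_on (snd c) (fst c)"
  by (metis chart_inv_chart inj_on_inverseI)

lemma smooth_on_prod_fst:
  fixes f :: "'a::finite_dim_normed \<Rightarrow> 'c::real_normed_vector" and T :: "'b::real_normed_vector set"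
  assumes "open S" "open T" "smooth_on S f"
  shows "smooth_on (S \<times> T) (\<lambda>w. f (fst w))"
  by (rule smooth_on_compose[OF open_Times[OF assms(1,2)] assms(1) _ _ assms(3)])
     (auto intro: smooth_on_bounded_linear open_Times assms bounded_linear_fst)

lemma smooth_on_prod_snd:
  fixes f :: "'b::finite_dim_normed \<Rightarrow> 'c::real_normed_vector" and S :: "'a::real_normed_vector set"
  assumes "open S" "open T" "smooth_on T f"
  shows "smooth_on (S \<times> T) (\<lambda>w. f (snd w))"
  by (rule smooth_on_compose[OF open_Times[OF assms(1,2)] assms(2) _ _ assms(3)])
     (auto intro: smooth_on_bounded_linear open_Times assms bounded_linear_snd)

lemma smooth_manifold_prod:
  fixes A :: "('a::{t2_space, second_countable_topology}, 'e::finite_dim_normed) atlas"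
    and B :: "('b::{t2_space, second_countable_topology}, 'f::finite_dim_normed) atlas"
  assumes "smooth_manifold A" "smooth_manifold B"
  shows "smooth_manifold (prod_atlas A B)"
proof -
  interpret A: manifold A by standard fact
  interpret B: manifold B by standard fact
  show ?thesis unfolding smooth_manifold_def
  proof (intro conjI ballI)
    fix p assume "p \<in> prod_atlas A B"
    then obtain c d where p: "p = (fst c \<times> fst d, map_prod (snd c) (snd d))" "c \<in> A" "d \<in> B"
      by (auto simp: prod_atlas_def)
    have im: "snd p ` fst p = (snd c ` fst c) \<times> (snd d ` fst d)"
      unfolding p by (auto simp: map_prod_def image_iff)
    note inv = chart_inv_prod[OF A.inj_on_chart[OF p(2)] B.inj_on_chart[OF p(3)]]
    show "openin (top_of_set (points (prod_atlas A B))) (fst p)"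
      unfolding points_prod_atlas using A.chart_openin[OF p(2)] B.chart_openin[OF p(3)]
      by (auto simp: p intro: openin_Times)
    show "open (snd p ` fst p)"
      unfolding im using A.chart_open_image[OF p(2)] B.chart_open_image[OF p(3)] by (rule open_Times)
    show "homeomorphism (fst p) (snd p ` fst p) (snd p) (chart_inv p)"
    proof (rule homeomorphismI)
      show "continuous_on (fst p) (snd p)"
        unfolding p fst_conv snd_conv map_prod_def case_prod_beta
        by (intro continuous_on_Pair continuous_on_compose2[OF A.continuous_on_chart[OF p(2)]]
            continuous_on_compose2[OF B.continuous_on_chart[OF p(3)]] continuous_on_fst continuous_on_snd
            continuous_on_id) auto
      have "continuous_on (snd p ` fst p) (\<lambda>w. (chart_inv c (fst w), chart_inv d (snd w)))"
        unfolding im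
        by (intro continuous_on_Pair continuous_on_compose2[OF A.continuous_on_chart_inv[OF p(2)]]
            continuous_on_compose2[OF B.continuous_on_chart_inv[OF p(3)]] continuous_on_fst continuous_on_snd
            continuous_on_id) auto
      then show "continuous_on (snd p ` fst p) (chart_inv p)"
        by (rule continuous_on_eq) (auto simp: im, auto simp: p inv)
      show "chart_inv p ` snd p ` fst p \<subseteq> fst p"
        by (auto simp: p inv A.chart_inv_chart[OF p(2)] B.chart_inv_chart[OF p(3)])
      show "chart_inv p (snd p x) = x" if "x \<in> fst p" for x
        using that by (auto simp: p inv A.chart_inv_chart[OF p(2)] B.chart_inv_chart[OF p(3)])
      show "snd p (chart_inv p y) = y" if "y \<in> snd p ` fst p" for y
        using that by (auto simp: p inv A.chart_inv_chart[OF p(2)] B.chart_inv_chart[OF p(3)])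
    qed simp
    fix q assume "q \<in> prod_atlas A B"
    then obtain c' d' where q: "q = (fst c' \<times> fst d', map_prod (snd c') (snd d'))" "c' \<in> A" "d' \<in> B"
      by (auto simp: prod_atlas_def)
    let ?C = "snd c ` (fst c \<inter> fst c')" and ?D = "snd d ` (fst d \<inter> fst d')"
    have im2: "snd p ` (fst p \<inter> fst q) = ?C \<times> ?D"
      unfolding p q by (auto simp: map_prod_def image_iff)
    have o: "open ?C" "open ?D"
      using A.chart_image_open[OF p(2) A.chart_openin[OF q(2)]]
        B.chart_image_open[OF p(3) B.chart_openin[OF q(3)]] by auto
    note oC = open_Times[OF o]
    have "smooth_on (?C \<times> ?D) (\<lambda>w. (snd c' (chart_inv c (fst w)), snd d' (chart_inv d (snd w))))"
      using smooth_on_prod_fst[OF o A.transition_smooth[OF p(2) q(2)]]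
        smooth_on_prod_snd[OF o B.transition_smooth[OF p(3) q(3)]]
      by (intro smooth_on_Pair[OF oC]) (auto simp: comp_def)
    then show "smooth_on (snd p ` (fst p \<inter> fst q)) (snd q \<circ> chart_inv p)"
      unfolding im2 by (rule smooth_on_eq[OF oC, rotated]) (auto simp: p q inv)
  qed
qed

lemma smooth_map_Pair:
  fixes A :: "('a::{t2_space, second_countable_topology}, 'e::finite_dim_normed) atlas"
    and B :: "('b::{t2_space, second_countable_topology}, 'f::finite_dim_normed) atlas"
    and C :: "('c::{t2_space, second_countable_topology}, 'g::finite_dim_normed) atlas"
  assumes "smooth_manifold A" "smooth_manifold B" "smooth_manifold C"
    and "smooth_map A B F" "smooth_map A C K"
  shows "smooth_map A (prod_atlas B C) (\<lambda>x. (F x, K x))"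
proof -
  interpret A: manifold A by standard fact
  interpret B: manifold B by standard fact
  interpret C: manifold C by standard fact
  note F = smooth_mapD[OF assms(4)] note K = smooth_mapD[OF assms(5)]
  show ?thesis unfolding smooth_map_def
  proof (intro conjI ballI)
    show "(\<lambda>x. (F x, K x)) ` points A \<subseteq> points (prod_atlas B C)"
      using F K by (auto simp: points_prod_atlas)
    show "continuous_on (points A) (\<lambda>x. (F x, K x))"
      using F K by (auto intro: continuous_on_Pair)
    fix c p assume c: "c \<in> A" and "p \<in> prod_atlas B C"
    then obtain b d where p: "p = (fst b \<times> fst d, map_prod (snd b) (snd d))" "b \<in> B" "d \<in> C"
      by (auto simp: prod_atlas_def)
    let ?S = "snd c ` (fst c \<inter> F -` fst b)" and ?T = "snd c ` (fst c \<inter> K -` fst d)"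
    have im: "snd c ` (fst c \<inter> (\<lambda>x. (F x, K x)) -` fst p) = ?S \<inter> ?T"
    proof
      show "?S \<inter> ?T \<subseteq> snd c ` (fst c \<inter> (\<lambda>x. (F x, K x)) -` fst p)"
        using A.inj_on_chart[OF c] by (auto simp: p inj_on_def)
    qed (auto simp: p)
    have o: "open (?S \<inter> ?T)"
      by (intro open_Int A.chart_vimage_open[OF c F(2) F(1) B.chart_openin[OF p(2)]]
          A.chart_vimage_open[OF c K(2) K(1) C.chart_openin[OF p(3)]])
    have "smooth_on (?S \<inter> ?T) (\<lambda>u. (snd b (F (chart_inv c u)), snd d (K (chart_inv c u))))"
      by (intro smooth_on_Pair[OF o] smooth_on_subset[OF A.smooth_map_imp_chart[OF assms(4) c p(2)]]
          smooth_on_subset[OF A.smooth_map_imp_chart[OF assms(5) c p(3)]]) auto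
    then show "smooth_on (snd c ` (fst c \<inter> (\<lambda>x. (F x, K x)) -` fst p)) (snd p \<circ> (\<lambda>x. (F x, K x)) \<circ> chart_inv c)"
      unfolding im by (rule smooth_on_eq[OF o, rotated]) (auto simp: p)
  qed
qed

lemma smooth_map_fst_snd:
  fixes A :: "('a::{t2_space, second_countable_topology}, 'e::finite_dim_normed) atlas"
    and B :: "('b::{t2_space, second_countable_topology}, 'f::finite_dim_normed) atlas"
  assumes "smooth_manifold A" "smooth_manifold B"
  shows smooth_map_fst: "smooth_map (prod_atlas A B) A fst"
    and smooth_map_snd: "smooth_map (prod_atlas A B) B snd"
proof -
  interpret A: manifold A by standard fact
  interpret B: manifold B by standard fact
  interpret P: manifold "prod_atlas A B" by standard (rule smooth_manifold_prod[OF assms])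
  show "smooth_map (prod_atlas A B) A fst" unfolding smooth_map_def
  proof (intro conjI ballI)
    fix p c' assume "p \<in> prod_atlas A B" and c': "c' \<in> A"
    then obtain c d where p: "p = (fst c \<times> fst d, map_prod (snd c) (snd d))" "c \<in> A" "d \<in> B"
      by (auto simp: prod_atlas_def)
    note inv = chart_inv_prod[OF A.inj_on_chart[OF p(2)] B.inj_on_chart[OF p(3)]]
    let ?C = "snd c ` (fst c \<inter> fst c')" and ?D = "snd d ` fst d"
    have im: "snd p ` (fst p \<inter> fst -` fst c') = ?C \<times> ?D"
      unfolding p by (auto simp: map_prod_def image_iff)
    have o: "open ?C" "open ?D"
      using A.chart_image_open[OF p(2) A.chart_openin[OF c']] B.chart_open_image[OF p(3)] by auto
    note oC = open_Times[OF o]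
    have "smooth_on (?C \<times> ?D) (\<lambda>w. snd c' (chart_inv c (fst w)))"
      using smooth_on_prod_fst[OF o A.transition_smooth[OF p(2) c']] by (simp add: comp_def)
    then show "smooth_on (snd p ` (fst p \<inter> fst -` fst c')) (snd c' \<circ> fst \<circ> chart_inv p)"
      unfolding im by (rule smooth_on_eq[OF oC, rotated]) (auto simp: p inv)
  qed (auto simp: points_prod_atlas intro: continuous_on_fst continuous_on_id)
  show "smooth_map (prod_atlas A B) B snd" unfolding smooth_map_def
  proof (intro conjI ballI)
    fix p d' assume "p \<in> prod_atlas A B" and d': "d' \<in> B"
    then obtain c d where p: "p = (fst c \<times> fst d, map_prod (snd c) (snd d))" "c \<in> A" "d \<in> B"
      by (auto simp: prod_atlas_def)
    note inv = chart_inv_prod[OF A.inj_on_chart[OF p(2)] B.inj_on_chart[OF p(3)]]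
    let ?C = "snd c ` fst c" and ?D = "snd d ` (fst d \<inter> fst d')"
    have im: "snd p ` (fst p \<inter> snd -` fst d') = ?C \<times> ?D"
      unfolding p by (auto simp: map_prod_def image_iff)
    have o: "open ?C" "open ?D"
      using B.chart_image_open[OF p(3) B.chart_openin[OF d']] A.chart_open_image[OF p(2)] by auto
    note oC = open_Times[OF o]
    have "smooth_on (?C \<times> ?D) (\<lambda>w. snd d' (chart_inv d (snd w)))"
      using smooth_on_prod_snd[OF o B.transition_smooth[OF p(3) d']] by (simp add: comp_def)
    then show "smooth_on (snd p ` (fst p \<inter> snd -` fst d')) (snd d' \<circ> snd \<circ> chart_inv p)"
      unfolding im by (rule smooth_on_eq[OF oC, rotated]) (auto simp: p inv)
  qed (auto simp: points_prod_atlas intro: continuous_on_snd continuous_on_id)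
qed

lemma smooth_map_const:
  fixes A :: "('a::{t2_space, second_countable_topology}, 'e::finite_dim_normed) atlas"
    and B :: "('b::{t2_space, second_countable_topology}, 'f::finite_dim_normed) atlas"
  assumes "smooth_manifold A" "y \<in> points B"
  shows "smooth_map A B (\<lambda>x. y)"
proof -
  interpret A: manifold A by standard fact
  show ?thesis unfolding smooth_map_def
  proof (intro conjI ballI)
    fix c d assume "c \<in> A"
    show "smooth_on (snd c ` (fst c \<inter> (\<lambda>x. y) -` fst d)) (snd d \<circ> (\<lambda>x. y) \<circ> chart_inv c)"
      using smooth_on_const[OF A.chart_open_image[OF \<open>c \<in> A\<close>]] smooth_on_const[OF open_empty]
      by (cases "y \<in> fst d") (simp_all add: comp_def)
  qed (use assms(2) in auto)
qed

subsection \<open>Tangent maps\<close>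

lemma smooth_map_has_tangent:
  fixes A :: "('a::{t2_space, second_countable_topology}, 'e::finite_dim_normed) atlas"
    and B :: "('b::{t2_space, second_countable_topology}, 'f::finite_dim_normed) atlas"
  assumes "smooth_manifold A" "smooth_manifold B" "smooth_map A B F" "x \<in> points A"
  shows "((\<lambda>u. snd (chart_at B (F x)) (F (chart_inv (chart_at A x) u)))
           has_derivative tangent_map A B F x) (at (snd (chart_at A x) x))"
proof -
  interpret A: manifold A by standard fact
  interpret B: manifold B by standard fact
  have Fx: "F x \<in> points B" using smooth_mapD(1)[OF assms(3)] assms(4) by auto
  note c = A.chart_at[OF assms(4)] and d = B.chart_at[OF Fx]
  have "snd (chart_at A x) x \<in> snd (chart_at A x) ` (fst (chart_at A x) \<inter> F -` fst (chart_at B (F x)))"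
    using c d by auto
  from smooth_on_differentiable[OF A.smooth_map_imp_chart[OF assms(3) c(1) d(1)] this]
  show ?thesis unfolding tangent_map_def frechet_derivative_works comp_def .
qed

lemma linear_tangent_map:
  fixes A :: "('a::{t2_space, second_countable_topology}, 'e::finite_dim_normed) atlas"
    and B :: "('b::{t2_space, second_countable_topology}, 'f::finite_dim_normed) atlas"
  assumes "smooth_manifold A" "smooth_manifold B" "smooth_map A B F" "x \<in> points A"
  shows "linear (tangent_map A B F x)"
  using has_derivative_linear[OF smooth_map_has_tangent[OF assms]] .

lemma tangent_map_eqI:
  assumes "((\<lambda>u. snd (chart_at B (F x)) (F (chart_inv (chart_at A x) u)))
           has_derivative D) (at (snd (chart_at A x) x))"
  shows "tangent_map A B F x = D"
  unfolding tangent_map_def comp_def using frechet_derivative_at[OF assms] by simp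

text \<open>The chain rule, as both factors use the same chart around \<open>F x\<close>. The
  composite is allowed to be any \<open>L\<close> agreeing with it on the points of
  \<open>A\<close>, because group identities hold only on the carrier.\<close>

lemma tangent_map_compose:
  fixes A :: "('a::{t2_space, second_countable_topology}, 'e::finite_dim_normed) atlas"
    and B :: "('b::{t2_space, second_countable_topology}, 'f::finite_dim_normed) atlas"
    and C :: "('c::{t2_space, second_countable_topology}, 'g::finite_dim_normed) atlas"
  assumes M: "smooth_manifold A" "smooth_manifold B" "smooth_manifold C"
    and S: "smooth_map A B F" "smooth_map B C K" and x: "x \<in> points A"
    and L: "\<And>y. y \<in> points A \<Longrightarrow> L y = K (F y)"
  shows "tangent_map A C L x v = tangent_map B C K (F x) (tangent_map A B F x v)"
proof -
  interpret A: manifold A by standard fact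
  interpret B: manifold B by standard fact
  note F = smooth_mapD[OF S(1)]
  have Fx: "F x \<in> points B" using F x by auto
  note c = A.chart_at[OF x] and b = B.chart_at[OF Fx]
  let ?c = "chart_at A x" and ?b = "chart_at B (F x)" and ?d = "chart_at C (K (F x))"
  let ?R = "snd ?c ` (fst ?c \<inter> F -` fst ?b)"
  have oR: "open ?R" by (rule A.chart_vimage_open[OF c(1) F(2,1) B.chart_openin[OF b(1)]])
  have "snd ?c x \<in> ?R" using c b by auto
  have 1: "chart_inv ?c (snd ?c x) = x" using c by simp
  have "((\<lambda>u. snd ?d (K (chart_inv ?b (snd ?b (F (chart_inv ?c u)))))) has_derivative
      (\<lambda>v. tangent_map B C K (F x) (tangent_map A B F x v))) (at (snd ?c x))"
    by (rule has_derivative_compose[OF smooth_map_has_tangent[OF M(1,2) S(1) x]])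
       (use smooth_map_has_tangent[OF M(2,3) S(2) Fx] in \<open>simp add: 1\<close>)
  then have "((\<lambda>u. snd ?d (L (chart_inv ?c u))) has_derivative
      (\<lambda>v. tangent_map B C K (F x) (tangent_map A B F x v))) (at (snd ?c x))"
  proof (rule has_derivative_transform_within_open[OF _ oR \<open>snd ?c x \<in> ?R\<close>])
    fix u assume "u \<in> ?R"
    then obtain y where y: "y \<in> fst ?c" "F y \<in> fst ?b" "u = snd ?c y" by auto
    then show "snd ?d (K (chart_inv ?b (snd ?b (F (chart_inv ?c u))))) = snd ?d (L (chart_inv ?c u))"
      using b c A.chart_subset[OF c(1)] L by (simp add: subset_iff)
  qed
  then have "tangent_map A C L x = (\<lambda>v. tangent_map B C K (F x) (tangent_map A B F x v))"
    by (intro tangent_map_eqI) (simp add: L[OF x])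
  then show ?thesis by simp
qed

lemma tangent_map_id:
  fixes A :: "('a::{t2_space, second_countable_topology}, 'e::finite_dim_normed) atlas"
  assumes "smooth_manifold A" "x \<in> points A" "\<And>y. y \<in> points A \<Longrightarrow> F y = y"
  shows "tangent_map A A F x = id"
proof -
  interpret A: manifold A by standard fact
  note c = A.chart_at[OF assms(2)]
  let ?c = "chart_at A x"
  have "((\<lambda>u. u) has_derivative id) (at (snd ?c x))" unfolding id_def by (rule has_derivative_ident)
  then have "((\<lambda>u. snd ?c (F (chart_inv ?c u))) has_derivative id) (at (snd ?c x))"
    by (rule has_derivative_transform_within_open[OF _ A.chart_open_image[OF c(1)]])
       (use c A.chart_subset[OF c(1)] assms(3) in \<open>auto simp: subset_iff\<close>)
  then show ?thesis by (intro tangent_map_eqI) (simp add: assms)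
qed

text \<open>A curve that is differentiable after composition with an immersion need only be continuous for
  its velocity to be tangent to the image.\<close>

lemma velocity_in_range:
  fixes j :: "'a::real_normed_vector \<Rightarrow> 'b::real_normed_vector" and w :: "real \<Rightarrow> 'a"
  assumes j: "(j has_derivative D) (at u)" and P: "bounded_linear P" "\<And>x. P (D x) = x"
    and w: "isCont w 0" "w 0 = u"
    and Y: "((\<lambda>t. j (w t)) has_vector_derivative Y) (at 0)"
  shows "D (P Y) = Y"
proof -
  have D: "bounded_linear D" using j has_derivative_bounded_linear by blast
  \<comment> \<open>Since \<open>P\<close> is a left inverse of \<open>D\<close>, the map D P is a
    projection onto the range of \<open>D\<close> and \<open>Q\<close> is the complementary
    projection. The goal is that \<open>Q\<close> kills \<open>Y\<close>.\<close>
  define Q where "Q y = y - D (P y)" for y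
  have Q: "bounded_linear Q" unfolding Q_def
    by (intro bounded_linear_sub bounded_linear_ident bounded_linear_compose[OF D P(1)])
  note linQ = bounded_linear.linear[OF Q] and linP = bounded_linear.linear[OF P(1)]
  define e where "e x = j x - j u - D (x - u)" for x
  \<comment> \<open>The relative size of the first order remainder. Division by zero yields 0, so
    \<open>r\<close> vanishes at \<open>u\<close> and is continuous there.\<close>
  define r where "r x = norm (e x) / norm (x - u)" for x
  define q where "q t = (j (w t) - j u) /\<^sub>R t" for t
  have r0: "r u = 0" by (simp add: r_def)
  have e: "norm (e x) = r x * norm (x - u)" for x
    using linear_0[OF bounded_linear.linear[OF D]] by (cases "x = u") (auto simp: r_def e_def)
  have "(r \<longlongrightarrow> 0) (at u)"
    using j unfolding has_derivative_iff_norm r_def e_def by blast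
  then have "isCont r u" by (simp add: isCont_def r0)
  then have "isCont (\<lambda>t. r (w t)) 0"
    using w by (intro isCont_o2[of 0 w r]) auto
  then have rw: "((\<lambda>t. r (w t)) \<longlongrightarrow> 0) (at 0)" by (simp add: isCont_def w(2) r0)
  have q: "(q \<longlongrightarrow> Y) (at 0)"
  proof -
    have "((\<lambda>t. (j (w t) - j u - t *\<^sub>R Y) /\<^sub>R norm t) \<longlongrightarrow> 0) (at 0)"
      using Y w(2) by (simp add: has_vector_derivative_def has_derivative_def)
    then have "((\<lambda>t. norm ((j (w t) - j u - t *\<^sub>R Y) /\<^sub>R norm t)) \<longlongrightarrow> 0) (at 0)"
      by (rule tendsto_norm_zero)
    moreover have "norm ((j (w t) - j u - t *\<^sub>R Y) /\<^sub>R norm t) = norm (q t - Y)" if "t \<noteq> 0" for t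
    proof -
      have "q t - Y = (j (w t) - j u - t *\<^sub>R Y) /\<^sub>R t" using that by (simp add: q_def scaleR_diff_right)
      then show ?thesis by simp
    qed
    ultimately have "((\<lambda>t. norm (q t - Y)) \<longlongrightarrow> 0) (at 0)"
      by (elim Lim_transform_eventually) (auto simp: eventually_at_filter)
    then show ?thesis by (rule LIM_zero_cancel[OF tendsto_norm_zero_cancel])
  qed
  obtain K where K: "K > 0" "\<And>x. norm (Q x) \<le> norm x * K" using bounded_linear.pos_bounded[OF Q] by blast
  obtain p where p: "p > 0" "\<And>x. norm (P x) \<le> norm x * p" using bounded_linear.pos_bounded[OF P(1)] by blast
  \<comment> \<open>\<open>Q\<close> annihilates the linear part, so only the remainder contributes
    to \<open>Q (q t)\<close>. The displacement of \<open>w\<close> is itself bounded by that of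
    \<open>j\<close> plus p r times itself; the factor 1 - p r absorbs this term without a division.
    As t tends to 0, r tends to 0 and the inequality forces \<open>Q Y = 0\<close>.\<close>
  have "norm (Q (q t)) * (1 - p * r (w t)) \<le> K * r (w t) * p * norm (q t)" if "t \<noteq> 0" for t
  proof -
    let ?d = "w t - u"
    have rn: "r (w t) \<ge> 0" by (simp add: r_def)
    have "Q (j (w t) - j u) = Q (e (w t))"
    proof -
      have "j (w t) - j u = e (w t) + D ?d" by (simp add: e_def)
      moreover have "Q (D ?d) = 0" by (simp add: Q_def P(2))
      ultimately show ?thesis using linQ by (simp add: linear_add)
    qed
    then have "norm (Q (j (w t) - j u)) \<le> K * (r (w t) * norm ?d)"
      using K(2)[of "e (w t)"] by (simp add: e mult.commute)
    then have 1: "norm (Q (q t)) \<le> K * r (w t) * norm ?d / \<bar>t\<bar>"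
      using that linQ by (simp add: q_def linear_scale divide_simps mult.commute mult.assoc)
    have "?d = P (j (w t) - j u) - P (e (w t))"
      using P(2) linP by (simp add: e_def linear_diff)
    then have "norm ?d \<le> norm (P (j (w t) - j u)) + norm (P (e (w t)))"
      by (metis norm_triangle_ineq4)
    also have "\<dots> \<le> norm (j (w t) - j u) * p + r (w t) * norm ?d * p"
      using p(2)[of "j (w t) - j u"] p(2)[of "e (w t)"] by (simp add: e)
    finally have 2: "norm ?d * (1 - p * r (w t)) \<le> p * norm (j (w t) - j u)"
      by (simp add: algebra_simps)
    show ?thesis
    proof (cases "1 - p * r (w t) \<ge> 0")
      case True
      have "norm (Q (q t)) * (1 - p * r (w t)) \<le> K * r (w t) * norm ?d / \<bar>t\<bar> * (1 - p * r (w t))"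
        using 1 True by (rule mult_right_mono)
      also have "\<dots> = K * r (w t) / \<bar>t\<bar> * (norm ?d * (1 - p * r (w t)))" by simp
      also have "\<dots> \<le> K * r (w t) / \<bar>t\<bar> * (p * norm (j (w t) - j u))"
        using 2 K rn by (intro mult_left_mono) auto
      also have "\<dots> = K * r (w t) * p * norm (q t)" by (simp add: q_def divide_simps)
      finally show ?thesis .
    next
      case False
      then have "norm (Q (q t)) * (1 - p * r (w t)) \<le> 0" by (simp add: mult_nonneg_nonpos)
      also have "0 \<le> K * r (w t) * p * norm (q t)" using K p rn by simp
      finally show ?thesis .
    qed
  qed
  then have "norm (Q Y) * (1 - p * 0) \<le> K * 0 * p * norm Y"
    by (intro tendsto_le[OF _ _ _, of "at (0::real)" "\<lambda>t. K * r (w t) * p * norm (q t)" _ "\<lambda>t. norm (Q (q t)) * (1 - p * r (w t))"]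
        tendsto_intros rw q bounded_linear.tendsto[OF Q]) (auto simp: eventually_at_filter)
  then show ?thesis by (simp add: Q_def)
qed

text \<open>Both manifolds carry the subspace topology, so the restriction of \<open>F\<close> to
  the submanifold is continuous. The image under \<open>F\<close> of a coordinate line of
  \<open>B\<close> is thus a continuous curve in a chart of \<open>B\<close>, differentiable in
  \<open>A\<close>, and \<open>velocity_in_range\<close> applies. Smoothness of \<open>F\<close> as
  a map of \<open>B\<close> into itself is never established.\<close>

lemma tangent_map_range:
  fixes A :: "('a::{t2_space, second_countable_topology}, 'e::finite_dim_normed) atlas"
    and B :: "('a, 'f::finite_dim_normed) atlas"
  assumes M: "smooth_manifold A" "smooth_manifold B"
    and S: "smooth_map B A (\<lambda>x. x)" "smooth_map A A F"
    and im: "immersion_at B A (\<lambda>x. x) e"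
    and F: "F ` points B \<subseteq> points B" "F e = e" and e: "e \<in> points B"
  shows "tangent_map A A F e (tangent_map B A (\<lambda>x. x) e X) \<in> range (tangent_map B A (\<lambda>x. x) e)"
proof -
  interpret A: manifold A by standard fact
  interpret B: manifold B by standard fact
  have sub: "points B \<subseteq> points A" using smooth_mapD(1)[OF S(1)] by auto
  have eA: "e \<in> points A" using e sub by auto
  let ?b = "chart_at B e" and ?a = "chart_at A e"
  note b = B.chart_at[OF e] and a = A.chart_at[OF eA]
  let ?D = "tangent_map B A (\<lambda>x. x) e"
  let ?u = "snd ?b e"
  let ?j = "\<lambda>u. snd ?a (chart_inv ?b u)"
  have j: "(?j has_derivative ?D) (at ?u)"
    using smooth_map_has_tangent[OF M(2,1) S(1) e] .
  have linD: "linear ?D" by (rule linear_tangent_map[OF M(2,1) S(1) e])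
  obtain P where P: "linear P" "P \<circ> ?D = id"
    using linear_injective_left_inverse[OF linD] im unfolding immersion_at_def by blast
  have cF: "continuous_on (points B) F"
    using smooth_mapD(2)[OF S(2)] sub continuous_on_subset by blast
  define w where "w t = snd ?b (F (chart_inv ?b (?u + t *\<^sub>R X)))" for t :: real
  have w0: "w 0 = ?u" using b F by (simp add: w_def)
  let ?O = "snd ?b ` (fst ?b \<inter> F -` fst ?b)"
  have oO: "open ?O"
    by (rule B.chart_vimage_open[OF b(1) cF F(1) B.chart_openin[OF b(1)]])
  have uO: "?u \<in> ?O" using b F by auto
  define T where "T = (\<lambda>t. ?u + t *\<^sub>R X) -` ?O"
  have oT: "open T" unfolding T_def by (rule open_vimage[OF oO]) (intro continuous_intros)
  have "0 \<in> T" using uO by (simp add: T_def)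
  have "continuous_on T w" unfolding w_def
  proof (rule continuous_on_compose2[OF B.continuous_on_chart[OF b(1)]])
    show "continuous_on T (\<lambda>t. F (chart_inv ?b (?u + t *\<^sub>R X)))"
    proof (rule continuous_on_compose2[OF cF])
      show "continuous_on T (\<lambda>t. chart_inv ?b (?u + t *\<^sub>R X))"
        by (rule continuous_on_compose2[OF B.continuous_on_chart_inv[OF b(1)]])
           (auto intro!: continuous_intros simp: T_def)
    qed (use B.chart_subset[OF b(1)] B.chart_inv_in[OF b(1)] in \<open>auto simp: T_def\<close>)
  qed (use b in \<open>auto simp: T_def\<close>)
  then have cw: "isCont w 0" using oT \<open>0 \<in> T\<close> by (simp add: continuous_on_eq_continuous_at)
  have line: "((\<lambda>t. ?u + t *\<^sub>R X) has_derivative (\<lambda>t. t *\<^sub>R X)) (at 0)"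
    by (auto intro!: derivative_eq_intros)
  have "((\<lambda>t. ?j (?u + t *\<^sub>R X)) has_derivative (\<lambda>t. ?D (t *\<^sub>R X))) (at 0)"
    by (rule has_derivative_compose[OF line]) (use j in simp)
  moreover have "((\<lambda>u. snd ?a (F (chart_inv ?a u))) has_derivative tangent_map A A F e) (at (?j (?u + 0 *\<^sub>R X)))"
    using smooth_map_has_tangent[OF M(1,1) S(2) eA] b F by simp
  ultimately have "((\<lambda>t. snd ?a (F (chart_inv ?a (?j (?u + t *\<^sub>R X))))) has_derivative
      (\<lambda>t. tangent_map A A F e (?D (t *\<^sub>R X)))) (at 0)"
    by (rule has_derivative_compose)
  define W where "W = T \<inter> (\<lambda>t. ?u + t *\<^sub>R X) -` (snd ?b ` (fst ?b \<inter> (\<lambda>x. x) -` fst ?a))"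
  have oW: "open W" unfolding W_def
    by (intro open_Int oT open_vimage B.chart_vimage_open[OF b(1) smooth_mapD(2)[OF S(1)] _ A.chart_openin[OF a(1)]] continuous_intros)
       (use sub in auto)
  have "0 \<in> W" using \<open>0 \<in> T\<close> a b by (auto simp: W_def)
  have "((\<lambda>t. ?j (w t)) has_derivative (\<lambda>t. tangent_map A A F e (?D (t *\<^sub>R X)))) (at 0)"
  proof (rule has_derivative_transform_within_open[OF _ oW \<open>0 \<in> W\<close>])
    fix t assume "t \<in> W"
    then have "?u + t *\<^sub>R X \<in> ?O" "?u + t *\<^sub>R X \<in> snd ?b ` (fst ?b \<inter> fst ?a)" by (auto simp: W_def T_def)
    moreover have "F (chart_inv ?b y) \<in> fst ?b" if "y \<in> ?O" for y using that b by auto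
    moreover have "chart_inv ?b y \<in> fst ?a" if "y \<in> snd ?b ` (fst ?b \<inter> fst ?a)" for y using that b by auto
    ultimately have "F (chart_inv ?b (?u + t *\<^sub>R X)) \<in> fst ?b" "chart_inv ?b (?u + t *\<^sub>R X) \<in> fst ?a" by blast+
    then show "snd ?a (F (chart_inv ?a (?j (?u + t *\<^sub>R X)))) = ?j (w t)"
      using a b by (simp add: w_def)
  qed fact
  moreover have "tangent_map A A F e (?D (t *\<^sub>R X)) = t *\<^sub>R tangent_map A A F e (?D X)" for t
    using linD linear_tangent_map[OF M(1,1) S(2) eA] by (simp add: linear_scale)
  ultimately have "((\<lambda>t. ?j (w t)) has_vector_derivative tangent_map A A F e (?D X)) (at 0)"
    unfolding has_vector_derivative_def by simp
  from velocity_in_range[OF j linear_imp_bounded_linear[OF P(1)] _ cw w0 this]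
  have "?D (P (tangent_map A A F e (?D X))) = tangent_map A A F e (?D X)"
    using P(2) by (metis comp_apply id_apply)
  then show ?thesis by (metis rangeI)
qed

section \<open>Smooth dependence of tangent maps on a parameter\<close>

lemma smooth_on_frechet_derivative:
  "smooth_on S f \<Longrightarrow> smooth_on S (\<lambda>x. frechet_derivative f (at x) v)"
  unfolding smooth_on_def by (metis Ck_on.simps(2))

lemma smooth_map_to_vector_space:
  fixes M :: "('b::{t2_space, second_countable_topology}, 'f::finite_dim_normed) atlas"
    and F :: "'b \<Rightarrow> 'c::real_normed_vector"
  assumes "smooth_manifold M" and *: "\<And>c. c \<in> M \<Longrightarrow> smooth_on (snd c ` fst c) (\<lambda>u. F (chart_inv c u))"
  shows "smooth_map M vector_space_atlas F"
proof -
  interpret M: manifold M by standard fact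
  show ?thesis unfolding smooth_map_def
  proof (intro conjI ballI)
    show "F ` points M \<subseteq> points vector_space_atlas" by (simp add: points_def vector_space_atlas_def)
    show "continuous_on (points M) F"
      unfolding continuous_on_eq_continuous_within
    proof
      fix h assume "h \<in> points M"
      then obtain c where c: "c \<in> M" "h \<in> fst c" by (auto simp: points_def)
      have "continuous_on (fst c) (\<lambda>h. F (chart_inv c (snd c h)))"
        by (rule continuous_on_compose2[OF Ck_on_imp_continuous[OF smooth_on_imp_Ck[OF *[OF c(1)]]] M.continuous_on_chart[OF c(1)]]) auto
      then have "continuous_on (fst c) F" by (rule continuous_on_eq) (use c in auto)
      then have "continuous (at h within fst c) F" using c by (simp add: continuous_on_eq_continuous_within)
      moreover have "at h within fst c = at h within points M"
      proof -
        obtain U where "open U" "fst c = points M \<inter> U"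
          using M.chart_openin[OF c(1)] by (auto simp: openin_open)
        then show ?thesis using c(2) by (intro at_within_nhd[of h U]) auto
      qed
      ultimately show "continuous (at h within points M) F" by (simp add: continuous_within)
    qed
    fix c d assume c: "c \<in> M" and "d \<in> (vector_space_atlas :: ('c, 'c) atlas)"
    then have d: "d = (UNIV, id)" by (simp add: vector_space_atlas_def)
    show "smooth_on (snd c ` (fst c \<inter> F -` fst d)) (snd d \<circ> F \<circ> chart_inv c)"
      using *[OF c] by (simp add: d comp_def)
  qed
qed

text \<open>All \<open>F h\<close> fix \<open>e\<close>, so their tangent maps are read in one chart
  around \<open>e\<close>. In coordinates they are the partial derivatives in direction (0, X) of a
  smooth function of two variables, evaluated along a slice.\<close>

lemma smooth_map_tangent_family:
  fixes A :: "('a::{t2_space, second_countable_topology}, 'e::finite_dim_normed) atlas"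
    and M :: "('b::{t2_space, second_countable_topology}, 'f::finite_dim_normed) atlas"
    and F :: "'b \<Rightarrow> 'a \<Rightarrow> 'a" and b :: "'e \<Rightarrow> 'c::real_normed_vector"
  assumes "smooth_manifold A" "smooth_manifold M"
    and S: "smooth_map (prod_atlas M A) A (\<lambda>p. F (fst p) (snd p))"
    and e: "e \<in> points A" "\<And>h. h \<in> points M \<Longrightarrow> F h e = e" and bl: "bounded_linear b"
  shows "smooth_map M vector_space_atlas (\<lambda>h. b (tangent_map A A (F h) e X))"
proof -
  interpret A: manifold A by standard fact
  interpret M: manifold M by standard fact
  interpret P: manifold "prod_atlas M A" by standard (rule smooth_manifold_prod[OF assms(2,1)])
  note a = A.chart_at[OF e(1)]
  let ?a = "chart_at A e"
  let ?T = "\<lambda>h. b (tangent_map A A (F h) e X)"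
  have *: "smooth_on (snd c ` fst c) (\<lambda>u. ?T (chart_inv c u))" if c: "c \<in> M" for c
  proof -
    let ?p = "(fst c \<times> fst ?a, map_prod (snd c) (snd ?a))"
    have p: "?p \<in> prod_atlas M A" unfolding prod_atlas_def using c a by blast
    note inv = chart_inv_prod[OF M.inj_on_chart[OF c] A.inj_on_chart[OF a(1)]]
    define R where "R = snd ?p ` (fst ?p \<inter> (\<lambda>p. F (fst p) (snd p)) -` fst ?a)"
    define q where "q w = snd ?a ((\<lambda>p. F (fst p) (snd p)) (chart_inv ?p w))" for w
    have q: "smooth_on R q" unfolding R_def q_def
      by (rule P.smooth_map_imp_chart[OF S p a(1)])
    have oR: "open R" unfolding R_def
      by (rule P.chart_vimage_open[OF p smooth_mapD(2)[OF S] smooth_mapD(1)[OF S] A.chart_openin[OF a(1)]])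
    have inR: "(u, snd ?a e) \<in> R" if "u \<in> snd c ` fst c" for u
      using that e(2) a(2) M.chart_subset[OF c] by (force simp: R_def)
    have der: "tangent_map A A (F (chart_inv c u)) e X = frechet_derivative q (at (u, snd ?a e)) (0, X)"
      if u: "u \<in> snd c ` fst c" for u
    proof -
      have Fe: "F (chart_inv c u) e = e" using u e(2) M.chart_subset[OF c] M.chart_inv_in[OF c u] by auto
      have "(q has_derivative frechet_derivative q (at (u, snd ?a e))) (at (u, snd ?a e))"
        using smooth_on_differentiable[OF q inR[OF u]] by (simp add: frechet_derivative_works)
      then have "((\<lambda>x. q (u, x)) has_derivative (\<lambda>v. frechet_derivative q (at (u, snd ?a e)) (0, v))) (at (snd ?a e))"
        by (rule has_derivative_compose[of "Pair u", rotated]) (auto intro!: derivative_eq_intros)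
      then have "((\<lambda>x. snd ?a (F (chart_inv c u) (chart_inv ?a x))) has_derivative (\<lambda>v. frechet_derivative q (at (u, snd ?a e)) (0, v))) (at (snd ?a e))"
        by (rule has_derivative_transform_within_open[OF _ A.chart_open_image[OF a(1)]])
           (use a u in \<open>auto simp: q_def inv\<close>)
      then have "tangent_map A A (F (chart_inv c u)) e = (\<lambda>v. frechet_derivative q (at (u, snd ?a e)) (0, v))"
        by (intro tangent_map_eqI) (simp add: Fe)
      then show ?thesis by simp
    qed
    note oc = M.chart_open_image[OF c]
    have "smooth_on (snd c ` fst c) (\<lambda>u. b (frechet_derivative q (at (u, snd ?a e)) (0, X)))"
    proof (rule smooth_on_compose[OF oc open_UNIV])
      show "smooth_on (snd c ` fst c) (\<lambda>u. frechet_derivative q (at (u, snd ?a e)) (0, X))"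
        by (rule smooth_on_compose[OF oc oR _ _ smooth_on_frechet_derivative[OF q]])
           (use inR in \<open>auto intro: smooth_on_Pair[OF oc smooth_on_bounded_linear[OF oc bounded_linear_ident] smooth_on_const[OF oc]]\<close>)
    qed (auto intro: smooth_on_bounded_linear bl)
    then show ?thesis by (rule smooth_on_eq[OF oc, rotated]) (simp add: der)
  qed
  show ?thesis by (rule smooth_map_to_vector_space[OF assms(2) *])
qed

lemma smooth_map_cong:
  fixes A :: "('a::{t2_space, second_countable_topology}, 'e::finite_dim_normed) atlas"
    and B :: "('b::{t2_space, second_countable_topology}, 'f::finite_dim_normed) atlas"
  assumes "smooth_manifold A" "smooth_manifold B" "smooth_map A B F"
    and eq: "\<And>x. x \<in> points A \<Longrightarrow> F x = K x"
  shows "smooth_map A B K"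
proof -
  interpret A: manifold A by standard fact
  interpret B: manifold B by standard fact
  note F = smooth_mapD[OF assms(3)]
  show ?thesis unfolding smooth_map_def
  proof (intro conjI ballI)
    show "K ` points A \<subseteq> points B" using F(1) eq by auto
    show "continuous_on (points A) K" using F(2) eq by (rule continuous_on_eq)
    fix c d assume c: "c \<in> A" and d: "d \<in> B"
    have sub: "x \<in> points A" if "x \<in> fst c" for x using A.chart_subset[OF c] that by auto
    then have "fst c \<inter> K -` fst d = fst c \<inter> F -` fst d" using eq by auto
    then have R: "snd c ` (fst c \<inter> K -` fst d) = snd c ` (fst c \<inter> F -` fst d)" by simp
    show "smooth_on (snd c ` (fst c \<inter> K -` fst d)) (snd d \<circ> K \<circ> chart_inv c)"
      unfolding R
    proof (rule smooth_on_eq[OF A.chart_vimage_open[OF c F(2,1) B.chart_openin[OF d]]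
          _ A.smooth_map_imp_chart[OF assms(3) c d]])
      fix u assume "u \<in> snd c ` (fst c \<inter> F -` fst d)"
      then have "chart_inv c u \<in> points A" using sub c by auto
      then show "snd d (F (chart_inv c u)) = (snd d \<circ> K \<circ> chart_inv c) u" by (simp add: eq)
    qed
  qed
qed

lemma chart_at_vector_space [simp]: "chart_at vector_space_atlas x = (UNIV, id)"
  unfolding chart_at_def vector_space_atlas_def by (rule some_equality) auto

lemma points_vector_space [simp]: "points vector_space_atlas = UNIV"
  by (simp add: points_def vector_space_atlas_def)

subsection \<open>The adjoint representation\<close>

locale lie =
  fixes G :: "('a::{t2_space, second_countable_topology}) monoid" (structure)
    and A :: "('a, 'g::finite_dim_normed) atlas"
  assumes lie_group: "lie_group G A"
begin

sublocale group G using lie_group by (simp add: lie_group_def)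

sublocale manifold A using lie_group by (unfold_locales) (simp add: lie_group_def)

lemma points [simp]: "points A = carrier G"
  using lie_group by (simp add: lie_group_def)

lemma smooth_map_mult:
  fixes M :: "('m::{t2_space, second_countable_topology}, 'f::finite_dim_normed) atlas"
  assumes "smooth_manifold M" "smooth_map M A f" "smooth_map M A k"
  shows "smooth_map M A (\<lambda>x. f x \<otimes> k x)"
proof -
  have "smooth_map (prod_atlas A A) A (\<lambda>(x, y). x \<otimes> y)" using lie_group by (simp add: lie_group_def)
  from smooth_map_compose[OF assms(1) smooth_manifold_prod[OF smooth_manifold smooth_manifold] smooth_manifold
      smooth_map_Pair[OF assms(1) smooth_manifold smooth_manifold assms(2,3)] this]
  show ?thesis by simp
qed

lemma smooth_map_inv:
  fixes M :: "('m::{t2_space, second_countable_topology}, 'f::finite_dim_normed) atlas"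
  assumes "smooth_manifold M" "smooth_map M A f"
  shows "smooth_map M A (\<lambda>x. inv (f x))"
proof -
  have "smooth_map A A (\<lambda>x. inv x)" using lie_group by (simp add: lie_group_def)
  from smooth_map_compose[OF assms(1) smooth_manifold smooth_manifold assms(2) this]
  show ?thesis .
qed

lemma smooth_map_conj:
  "g \<in> carrier G \<Longrightarrow> smooth_map A A (\<lambda>x. g \<otimes> x \<otimes> inv g)"
  by (intro smooth_map_mult smooth_manifold smooth_map_id smooth_map_const) auto

lemma linear_Ad: "g \<in> carrier G \<Longrightarrow> linear (Ad G A g)"
  unfolding Ad_def by (intro linear_tangent_map smooth_manifold smooth_map_conj) auto

lemma Ad_mult:
  assumes "g \<in> carrier G" "h \<in> carrier G"
  shows "Ad G A (g \<otimes> h) X = Ad G A g (Ad G A h X)"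
proof -
  have 1: "h \<otimes> \<one> \<otimes> inv h = \<one>" using assms by simp
  show ?thesis
    unfolding Ad_def
    using tangent_map_compose[OF smooth_manifold smooth_manifold smooth_manifold
        smooth_map_conj[OF assms(2)] smooth_map_conj[OF assms(1)], of \<one> "\<lambda>x. (g \<otimes> h) \<otimes> x \<otimes> inv (g \<otimes> h)" X]
    unfolding 1 using assms by (simp add: inv_mult_group m_assoc)
qed

lemma Ad_one: "Ad G A \<one> = id"
  unfolding Ad_def by (rule tangent_map_id[OF smooth_manifold]) auto

end

locale lie_pair = lie G AG for G :: "('a::{t2_space, second_countable_topology}) monoid" (structure)
    and AG :: "('a, 'g::finite_dim_normed) atlas" +
  fixes N :: "'a set" and AN :: "('a, 'n::finite_dim_normed) atlas"
    and H :: "'a set" and AH :: "('a, 'h::finite_dim_normed) atlas"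
  assumes N: "closed_lie_subgroup G AG N AN" "N \<lhd> G"
    and H: "closed_lie_subgroup G AG H AH"
begin

sublocale LN: lie "G\<lparr>carrier := N\<rparr>" AN
  using N by unfold_locales (simp add: closed_lie_subgroup_def)

sublocale LH: lie "G\<lparr>carrier := H\<rparr>" AH
  using H by unfold_locales (simp add: closed_lie_subgroup_def)

lemma pointsN: "points AN = N" and pointsH: "points AH = H"
  using LN.points LH.points by auto

lemma subgroupN: "subgroup N G" and subgroupH: "subgroup H G"
  using N H by (auto simp: closed_lie_subgroup_def)

lemma H_carrier: "h \<in> H \<Longrightarrow> h \<in> carrier G" and N_carrier: "h \<in> N \<Longrightarrow> h \<in> carrier G"
  using subgroupH subgroupN by (auto dest: subgroup.mem_carrier)

lemma smooth_inclN: "smooth_map AN AG (\<lambda>x. x)" and smooth_inclH: "smooth_map AH AG (\<lambda>x. x)"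
  using N H by (auto simp: closed_lie_subgroup_def)

lemma lie_incl: "linear (lie_incl G AG AN)" "inj (lie_incl G AG AN)"
proof -
  have 1: "\<one> \<in> N" using subgroupN by (rule subgroup.one_closed)
  then show "linear (lie_incl G AG AN)" unfolding lie_incl_def
    by (intro linear_tangent_map LN.smooth_manifold smooth_manifold smooth_inclN) (simp add: pointsN)
  show "inj (lie_incl G AG AN)"
    using N(1) 1 unfolding lie_incl_def closed_lie_subgroup_def immersion_at_def by blast
qed

lemma lie_incl_left_inverse:
  obtains P where "linear P" "\<And>X. P (lie_incl G AG AN X) = X"
  using linear_injective_left_inverse[OF lie_incl] by (metis comp_apply id_apply)

text \<open>Normality makes conjugation preserve \<open>N\<close> as a set, and
  \<open>tangent_map_range\<close> turns this into invariance of its Lie algebra. Only then does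
  \<open>the_inv\<close> in \<open>Ad_on\<close> return a meaningful value.\<close>

lemma Ad_in_range:
  assumes "g \<in> carrier G"
  shows "Ad G AG g (lie_incl G AG AN X) \<in> range (lie_incl G AG AN)"
  unfolding Ad_def lie_incl_def
proof (rule tangent_map_range[OF smooth_manifold LN.smooth_manifold smooth_inclN smooth_map_conj[OF assms]])
  have 1: "\<one> \<in> N" using subgroupN by (rule subgroup.one_closed)
  then show "immersion_at AN AG (\<lambda>x. x) \<one>" "\<one> \<in> points AN"
    using N(1) unfolding closed_lie_subgroup_def pointsN by auto
  show "(\<lambda>x. g \<otimes> x \<otimes> inv g) ` points AN \<subseteq> points AN"
    unfolding pointsN using assms N(2) by (auto simp: normal_inv_iff)
  show "g \<otimes> \<one> \<otimes> inv g = \<one>" using assms by simp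
qed

lemma lie_incl_Ad_on:
  assumes "g \<in> carrier G"
  shows "lie_incl G AG AN (Ad_on G AG AN g X) = Ad G AG g (lie_incl G AG AN X)"
proof -
  obtain Y where Y: "Ad G AG g (lie_incl G AG AN X) = lie_incl G AG AN Y"
    using Ad_in_range[OF assms, of X] by auto
  then show ?thesis unfolding Ad_on_def by (simp add: the_inv_f_f lie_incl(2))
qed

lemma Ad_on_eqI: "g \<in> carrier G \<Longrightarrow> lie_incl G AG AN Y = Ad G AG g (lie_incl G AG AN X) \<Longrightarrow> Ad_on G AG AN g X = Y"
  using lie_incl_Ad_on injD[OF lie_incl(2)] by metis

lemma linear_Ad_on:
  assumes "g \<in> carrier G"
  shows "linear (Ad_on G AG AN g)"
  using linear_Ad[OF assms] lie_incl(1)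
  by (intro linearI Ad_on_eqI assms) (simp_all add: lie_incl_Ad_on[OF assms] linear_add linear_scale)

lemma Ad_on_mult:
  assumes "g \<in> carrier G" "h \<in> carrier G"
  shows "Ad_on G AG AN (g \<otimes> h) X = Ad_on G AG AN g (Ad_on G AG AN h X)"
  using assms by (intro Ad_on_eqI) (simp_all add: lie_incl_Ad_on Ad_mult)

lemma Ad_on_one: "Ad_on G AG AN \<one> X = X"
  by (intro Ad_on_eqI) (simp_all add: Ad_one)

text \<open>\<open>Blinfun\<close> is faithful on bounded linear maps only; finite dimension
  supplies boundedness.\<close>

lemma coad_apply:
  assumes "g \<in> carrier G"
  shows "blinfun_apply (coad G AG AN g lam) X = blinfun_apply lam (Ad_on G AG AN g X)"
proof -
  have "bounded_linear (\<lambda>X. blinfun_apply lam (Ad_on G AG AN g X))"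
    by (intro bounded_linear_compose[OF blinfun.bounded_linear_right] linear_imp_bounded_linear linear_Ad_on assms)
  then show ?thesis by (simp add: coad_def bounded_linear_Blinfun_apply)
qed

text \<open>Since h^-1 z is the inverse of z^-1 h, moving \<open>Y\<close> by Ad(z) has the same
  effect on the orbit function as translating its argument by z. This covariance makes the
  translated modulations of \<open>f\<close> values of the representation.\<close>

lemma coad_mult:
  assumes "h \<in> carrier G" "z \<in> carrier G"
  shows "blinfun_apply (coad G AG AN (inv h) lam) (Ad_on G AG AN z X) =
    blinfun_apply (coad G AG AN (inv (inv z \<otimes> h)) lam) X"
  using assms by (simp add: coad_apply Ad_on_mult[symmetric] inv_mult_group)

text \<open>The inverse hidden in \<open>Ad_on\<close> is replaced by a fixed linear left inverse
  \<open>P\<close> of the inclusion, defined on the whole Lie algebra of \<open>G\<close>. What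
  remains is a bounded functional of a smooth family of tangent maps.\<close>

lemma smooth_coad_apply:
  "smooth_map AH vector_space_atlas (\<lambda>h. blinfun_apply (coad G AG AN (inv h) lam) X)"
proof -
  obtain P where P: "linear P" "\<And>X. P (lie_incl G AG AN X) = X"
    by (rule lie_incl_left_inverse) blast
  let ?F = "\<lambda>h x. inv h \<otimes> x \<otimes> inv (inv h)"
  have S: "smooth_map (prod_atlas AH AG) AG (\<lambda>p. ?F (fst p) (snd p))"
    by (intro smooth_map_mult smooth_map_inv smooth_manifold_prod smooth_manifold LH.smooth_manifold
        smooth_map_snd smooth_map_compose[OF _ _ _ smooth_map_fst smooth_inclH])
  have "bounded_linear (\<lambda>Y. blinfun_apply lam (P Y))"
    by (intro bounded_linear_compose[OF blinfun.bounded_linear_right] linear_imp_bounded_linear P)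
  from smooth_map_tangent_family[OF smooth_manifold LH.smooth_manifold S _ _ this, of \<one> "lie_incl G AG AN X"]
  have *: "smooth_map AH vector_space_atlas (\<lambda>h. blinfun_apply lam (P (Ad G AG (inv h) (lie_incl G AG AN X))))"
    unfolding Ad_def by (simp add: pointsH H_carrier)
  have eq: "blinfun_apply lam (P (Ad G AG (inv h) (lie_incl G AG AN X))) = blinfun_apply (coad G AG AN (inv h) lam) X"
    if "h \<in> H" for h
    using that H_carrier by (simp add: coad_apply lie_incl_Ad_on[symmetric] P(2))
  show ?thesis
    by (rule smooth_map_cong[OF LH.smooth_manifold smooth_manifold_vector_space *]) (simp add: pointsH eq)
qed

text \<open>Smoothness is known for each evaluation at a vector. The functional-valued map is the
  finite sum of its evaluations at basis vectors times the dual functionals \<open>r b\<close>, so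
  it is differentiable and evaluation commutes with the derivative. This makes the immersion
  hypothesis available for scalar functions.\<close>

lemma tangent_coad:
  "blinfun_apply (tangent_map AH vector_space_atlas (\<lambda>h. coad G AG AN (inv h) lam) \<one> v) X =
    tangent_map AH vector_space_atlas (\<lambda>h. blinfun_apply (coad G AG AN (inv h) lam) X) \<one> v"
proof -
  let ?\<beta> = "\<lambda>h. coad G AG AN (inv h) lam" and ?c = "chart_at AH \<one>"
  obtain B :: "'n set" where B: "finite B" "independent B" "span B = UNIV"
    using finite_basis_exists by blast
  define r where "r b = Blinfun (\<lambda>X. representation B X b)" for b
  have r: "blinfun_apply (r b) X = representation B X b" for b X
    unfolding r_def by (rule bounded_linear_Blinfun_apply[OF bounded_linear_representation[OF B(2,3)], THEN fun_cong])
  have 1: "\<one> \<in> points AH" using subgroupH by (simp add: pointsH subgroup.one_closed)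
  note c = LH.chart_at[OF 1]
  have der: "((\<lambda>u. blinfun_apply (?\<beta> (chart_inv ?c u)) X) has_derivative
      tangent_map AH vector_space_atlas (\<lambda>h. blinfun_apply (?\<beta> h) X) \<one>) (at (snd ?c \<one>))" for X
    using smooth_map_has_tangent[OF LH.smooth_manifold smooth_manifold_vector_space smooth_coad_apply 1, of lam X]
    by simp
  have exp: "blinfun_apply (\<Sum>b\<in>B. blinfun_apply L b *\<^sub>R r b) X = blinfun_apply L X" for L :: "'n \<Rightarrow>\<^sub>L real" and X
  proof -
    have "blinfun_apply L X = blinfun_apply L (\<Sum>b\<in>B. representation B X b *\<^sub>R b)"
      using sum_representation_eq[of B X B] B by simp
    then show ?thesis
      by (simp add: blinfun.sum_left blinfun.sum_right blinfun.scaleR_left blinfun.scaleR_right r mult.commute)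
  qed
  let ?D = "\<lambda>v. \<Sum>b\<in>B. tangent_map AH vector_space_atlas (\<lambda>h. blinfun_apply (?\<beta> h) b) \<one> v *\<^sub>R r b"
  have "((\<lambda>u. \<Sum>b\<in>B. blinfun_apply (?\<beta> (chart_inv ?c u)) b *\<^sub>R r b) has_derivative ?D) (at (snd ?c \<one>))"
    by (intro has_derivative_sum has_derivative_scaleR_left der)
  moreover have "(\<Sum>b\<in>B. blinfun_apply L b *\<^sub>R r b) = L" for L :: "'n \<Rightarrow>\<^sub>L real"
    by (rule blinfun_eqI) (rule exp)
  ultimately have D: "((\<lambda>u. ?\<beta> (chart_inv ?c u)) has_derivative ?D) (at (snd ?c \<one>))" by simp
  have t1: "tangent_map AH vector_space_atlas ?\<beta> \<one> = ?D"
    by (rule tangent_map_eqI) (use D in simp)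
  have "((\<lambda>u. blinfun_apply (?\<beta> (chart_inv ?c u)) X) has_derivative (\<lambda>v. blinfun_apply (?D v) X)) (at (snd ?c \<one>))"
    by (rule bounded_linear.has_derivative[OF blinfun.bounded_linear_left D])
  then have "tangent_map AH vector_space_atlas (\<lambda>h. blinfun_apply (?\<beta> h) X) \<one> = (\<lambda>v. blinfun_apply (?D v) X)"
    by (intro tangent_map_eqI) simp
  then show ?thesis unfolding t1 by simp
qed

end

subsection \<open>Approximation in \<open>L\<^sup>2\<close> and Parseval's identity\<close>

lemma cmod_sq_add: "(cmod (a + b))\<^sup>2 \<le> 2 * (cmod a)\<^sup>2 + 2 * (cmod b)\<^sup>2"
proof -
  have "(cmod (a + b))\<^sup>2 \<le> (cmod a + cmod b)\<^sup>2"
    by (intro power_mono norm_triangle_ineq) auto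
  also have "\<dots> \<le> 2 * (cmod a)\<^sup>2 + 2 * (cmod b)\<^sup>2"
    using sum_squares_bound[of "cmod a" "cmod b"] by (simp add: power2_sum)
  finally show ?thesis .
qed

text \<open>The squared distance, valued in \<open>ennreal\<close> so that it makes sense without
  integrability; the price is a factor 2 in the triangle inequality.\<close>

definition L2_dist :: "'a measure \<Rightarrow> ('a \<Rightarrow> complex) \<Rightarrow> ('a \<Rightarrow> complex) \<Rightarrow> ennreal" where
  "L2_dist M F G = (\<integral>\<^sup>+x. ennreal ((cmod (F x - G x))\<^sup>2) \<partial>M)"

lemma L2_dist_triangle:
  assumes [measurable]: "F \<in> borel_measurable M" "G \<in> borel_measurable M" "K \<in> borel_measurable M"
  shows "L2_dist M F K \<le> 2 * L2_dist M F G + 2 * L2_dist M G K"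
proof -
  have "L2_dist M F K \<le> (\<integral>\<^sup>+x. ennreal (2 * (cmod (F x - G x))\<^sup>2 + 2 * (cmod (G x - K x))\<^sup>2) \<partial>M)"
    unfolding L2_dist_def using cmod_sq_add[of "F x - G x" "G x - K x" for x]
    by (intro nn_integral_mono ennreal_leI) simp
  also have "\<dots> = 2 * L2_dist M F G + 2 * L2_dist M G K"
    unfolding L2_dist_def
    by (simp add: ennreal_plus ennreal_mult nn_integral_add nn_integral_cmult)
  finally show ?thesis .
qed

definition L2_approx :: "'a measure \<Rightarrow> ('a \<Rightarrow> complex) set \<Rightarrow> ('a \<Rightarrow> complex) \<Rightarrow> bool" where
  "L2_approx M V F \<longleftrightarrow> (\<forall>\<epsilon>>0. \<exists>p\<in>V. L2_dist M F p < ennreal \<epsilon>)"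

lemma L2_approx_limit:
  assumes V: "V \<subseteq> borel_measurable M" and F: "F \<in> borel_measurable M"
    and lim: "\<And>\<epsilon>. \<epsilon> > 0 \<Longrightarrow> \<exists>G\<in>borel_measurable M. L2_approx M V G \<and> L2_dist M F G < ennreal \<epsilon>"
  shows "L2_approx M V F"
  unfolding L2_approx_def
proof (intro allI impI)
  fix \<epsilon> :: real assume "\<epsilon> > 0"
  then obtain G where G: "G \<in> borel_measurable M" "L2_approx M V G" "L2_dist M F G < ennreal (\<epsilon> / 4)"
    using lim[of "\<epsilon> / 4"] by auto
  then obtain p where p: "p \<in> V" "L2_dist M G p < ennreal (\<epsilon> / 4)"
    using \<open>\<epsilon> > 0\<close> unfolding L2_approx_def by (metis divide_pos_pos zero_less_numeral)
  have "L2_dist M F p \<le> 2 * L2_dist M F G + 2 * L2_dist M G p"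
    using V F G p by (intro L2_dist_triangle) auto
  also have "\<dots> < 2 * ennreal (\<epsilon> / 4) + 2 * ennreal (\<epsilon> / 4)"
    using G(3) p(2) by (intro add_strict_mono ennreal_mult_strict_left_mono) auto
  also have "\<dots> = ennreal \<epsilon>"
    using \<open>\<epsilon> > 0\<close> by (simp add: ennreal_plus[symmetric] ennreal_mult[symmetric] flip: ennreal_numeral)
  finally show "\<exists>p\<in>V. L2_dist M F p < ennreal \<epsilon>" using p by blast
qed

lemma L2_approx_add:
  assumes V: "V \<subseteq> borel_measurable M" "\<And>p q. p \<in> V \<Longrightarrow> q \<in> V \<Longrightarrow> (\<lambda>x. p x + q x) \<in> V"
    and [measurable]: "F \<in> borel_measurable M" "G \<in> borel_measurable M"
    and "L2_approx M V F" "L2_approx M V G"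
  shows "L2_approx M V (\<lambda>x. F x + G x)"
  unfolding L2_approx_def
proof (intro allI impI)
  fix \<epsilon> :: real assume "\<epsilon> > 0"
  then obtain p q where p: "p \<in> V" "L2_dist M F p < ennreal (\<epsilon> / 4)" and q: "q \<in> V" "L2_dist M G q < ennreal (\<epsilon> / 4)"
    using assms(5,6) unfolding L2_approx_def by (metis divide_pos_pos zero_less_numeral)
  have [measurable]: "p \<in> borel_measurable M" "q \<in> borel_measurable M" using p q V by auto
  have "L2_dist M (\<lambda>x. F x + G x) (\<lambda>x. p x + q x) \<le> (\<integral>\<^sup>+x. ennreal (2 * (cmod (F x - p x))\<^sup>2 + 2 * (cmod (G x - q x))\<^sup>2) \<partial>M)"
    unfolding L2_dist_def using cmod_sq_add[of "F x - p x" "G x - q x" for x]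
    by (intro nn_integral_mono ennreal_leI) (simp add: add_diff_add)
  also have "\<dots> = 2 * L2_dist M F p + 2 * L2_dist M G q"
    unfolding L2_dist_def
    by (simp add: ennreal_plus ennreal_mult nn_integral_add nn_integral_cmult)
  also have "\<dots> < 2 * ennreal (\<epsilon> / 4) + 2 * ennreal (\<epsilon> / 4)"
    using p q by (intro add_strict_mono ennreal_mult_strict_left_mono) auto
  also have "\<dots> = ennreal \<epsilon>"
    using \<open>\<epsilon> > 0\<close> by (simp add: ennreal_plus[symmetric] ennreal_mult[symmetric] flip: ennreal_numeral)
  finally show "\<exists>p\<in>V. L2_dist M (\<lambda>x. F x + G x) p < ennreal \<epsilon>" using V(2)[OF p(1) q(1)] by blast
qed

lemma L2_approx_scale:
  assumes V: "V \<subseteq> borel_measurable M" "\<And>c p. p \<in> V \<Longrightarrow> (\<lambda>x. c * p x) \<in> V"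
    and [measurable]: "F \<in> borel_measurable M" and "L2_approx M V F"
  shows "L2_approx M V (\<lambda>x. c * F x)"
  unfolding L2_approx_def
proof (intro allI impI)
  fix \<epsilon> :: real assume "\<epsilon> > 0"
  \<comment> \<open>The summand 1 keeps the divisor positive when c = 0.\<close>
  define C where "C = (cmod c)\<^sup>2 + 1"
  have C: "C > 0" "(cmod c)\<^sup>2 \<le> C" by (simp_all add: C_def add_nonneg_pos)
  then obtain p where p: "p \<in> V" "L2_dist M F p < ennreal (\<epsilon> / C)"
    using assms(4) \<open>\<epsilon> > 0\<close> unfolding L2_approx_def by (metis divide_pos_pos)
  have [measurable]: "p \<in> borel_measurable M" using p V by auto
  have "L2_dist M (\<lambda>x. c * F x) (\<lambda>x. c * p x) = ennreal ((cmod c)\<^sup>2) * L2_dist M F p"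
    unfolding L2_dist_def
    by (simp add: right_diff_distrib[symmetric] norm_mult power_mult_distrib ennreal_mult nn_integral_cmult del: right_diff_distrib)
  also have "\<dots> \<le> ennreal C * L2_dist M F p" using C by (intro mult_right_mono ennreal_leI) auto
  also have "\<dots> < ennreal C * ennreal (\<epsilon> / C)"
    using p C by (intro ennreal_mult_strict_left_mono) auto
  also have "\<dots> = ennreal \<epsilon>" using C \<open>\<epsilon> > 0\<close> by (simp add: ennreal_mult[symmetric])
  finally show "\<exists>p\<in>V. L2_dist M (\<lambda>x. c * F x) p < ennreal \<epsilon>" using V(2)[OF p(1)] by blast
qed

text \<open>Linearity passes from indicators to simple functions; a sequence of simple functions
  dominated by 2 |F| converges to \<open>F\<close> in the squared distance by dominated
  convergence.\<close>

lemma L2_approx_from_indicators: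
  assumes V: "V \<subseteq> borel_measurable M" "\<And>p q. p \<in> V \<Longrightarrow> q \<in> V \<Longrightarrow> (\<lambda>x. p x + q x) \<in> V"
      "\<And>c p. p \<in> V \<Longrightarrow> (\<lambda>x. c * p x) \<in> V" "(\<lambda>x. 0) \<in> V"
    and ind: "\<And>A. A \<in> sets M \<Longrightarrow> L2_approx M V (indicator A)"
    and F[measurable]: "F \<in> borel_measurable M" and fin: "(\<integral>\<^sup>+x. ennreal ((cmod (F x))\<^sup>2) \<partial>M) < \<infinity>"
  shows "L2_approx M V F"
proof (rule L2_approx_limit[OF V(1) F])
  fix \<epsilon> :: real assume "\<epsilon> > 0"
  obtain s where s: "\<And>i. simple_function M (s i)" "\<And>x. x \<in> space M \<Longrightarrow> (\<lambda>i. s i x) \<longlonglongrightarrow> F x"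
    "\<And>i x. x \<in> space M \<Longrightarrow> dist (s i x) 0 \<le> 2 * dist (F x) 0"
    using borel_measurable_implies_sequence_metric[OF F, of 0] by metis
  have sm[measurable]: "s i \<in> borel_measurable M" for i using s(1) by (rule borel_measurable_simple_function)
  have simple: "L2_approx M V (s i)" for i
  proof -
    let ?Y = "s i ` space M"
    have fin: "finite ?Y" using s(1) by (auto simp: simple_function_def)
    have approx_sum: "L2_approx M V (\<lambda>x. \<Sum>y\<in>Y. y * indicator (s i -` {y} \<inter> space M) x)" if "finite Y" for Y
      using that
    proof induction
      case empty
      have "L2_dist M (\<lambda>x. 0) (\<lambda>x. 0) = 0" by (simp add: L2_dist_def)
      then show ?case using V(4) by (auto simp: L2_approx_def intro!: bexI[of _ "\<lambda>x. 0"])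
    next
      case (insert y Y)
      have "L2_approx M V (\<lambda>x. y * indicator (s i -` {y} \<inter> space M) x)"
        by (intro L2_approx_scale V ind) auto
      moreover have "(\<lambda>x. \<Sum>y\<in>Y. y * indicator (s i -` {y} \<inter> space M) x) \<in> borel_measurable M" by measurable
      ultimately have "L2_approx M V (\<lambda>x. y * indicator (s i -` {y} \<inter> space M) x + (\<Sum>y\<in>Y. y * indicator (s i -` {y} \<inter> space M) x))"
        using insert.IH by (intro L2_approx_add[OF V(1,2)]) auto
      then show ?case unfolding sum.insert[OF insert.hyps] .
    qed
    define h where "h x = (\<Sum>y\<in>?Y. y * indicator (s i -` {y} \<inter> space M) x)" for x
    have h: "L2_approx M V h" unfolding h_def by (rule approx_sum[OF fin])
    have eq: "s i x = h x" if "x \<in> space M" for x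
    proof -
      have "h x = (\<Sum>y\<in>?Y. if y = s i x then y else 0)"
        unfolding h_def using that by (intro sum.cong) (auto simp: indicator_def)
      then show ?thesis using fin that by simp
    qed
    have "L2_dist M (s i) p = L2_dist M h p" for p
      unfolding L2_dist_def by (rule nn_integral_cong) (simp add: eq)
    then show ?thesis using h by (simp add: L2_approx_def)
  qed
  have "(\<lambda>i. L2_dist M F (s i)) \<longlonglongrightarrow> (\<integral>\<^sup>+x. 0 \<partial>M)"
    unfolding L2_dist_def
  \<comment> \<open>The constant is 10 = 2 + 2 * 2^2, from |F - s|^2 <= 2 |F|^2 + 2 |s|^2 and |s| <=
    2 |F|.\<close>
  proof (rule nn_integral_dominated_convergence[where w = "\<lambda>x. 10 * ennreal ((cmod (F x))\<^sup>2)"])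
    show "AE x in M. ennreal ((cmod (F x - s i x))\<^sup>2) \<le> 10 * ennreal ((cmod (F x))\<^sup>2)" for i
    proof (rule AE_I2)
      fix x assume x: "x \<in> space M"
      have "cmod (s i x) \<le> 2 * cmod (F x)" using s(3)[OF x] by simp
      then have "(cmod (s i x))\<^sup>2 \<le> (2 * cmod (F x))\<^sup>2" by (intro power_mono) auto
      then have "(cmod (F x - s i x))\<^sup>2 \<le> 10 * (cmod (F x))\<^sup>2"
        using cmod_sq_add[of "F x" "- s i x"] by (simp add: power_mult_distrib)
      then have "ennreal ((cmod (F x - s i x))\<^sup>2) \<le> ennreal (10 * (cmod (F x))\<^sup>2)" by (rule ennreal_leI)
      then show "ennreal ((cmod (F x - s i x))\<^sup>2) \<le> 10 * ennreal ((cmod (F x))\<^sup>2)" by (simp add: ennreal_mult)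
    qed
    show "(\<integral>\<^sup>+x. 10 * ennreal ((cmod (F x))\<^sup>2) \<partial>M) < \<infinity>"
      using fin by (simp add: nn_integral_cmult ennreal_mult_less_top)
    show "AE x in M. (\<lambda>i. ennreal ((cmod (F x - s i x))\<^sup>2)) \<longlonglongrightarrow> 0"
    proof (rule AE_I2)
      fix x assume x: "x \<in> space M"
      have "(\<lambda>i. (cmod (F x - s i x))\<^sup>2) \<longlonglongrightarrow> (cmod (F x - F x))\<^sup>2"
        by (intro tendsto_intros s(2) x)
      then show "(\<lambda>i. ennreal ((cmod (F x - s i x))\<^sup>2)) \<longlonglongrightarrow> 0"
        using tendsto_ennrealI by fastforce
    qed
  qed auto
  then have "eventually (\<lambda>i. L2_dist M F (s i) < ennreal \<epsilon>) sequentially"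
    using \<open>\<epsilon> > 0\<close> by (intro order_tendstoD) auto
  then obtain i where "L2_dist M F (s i) < ennreal \<epsilon>" by (auto simp: eventually_sequentially)
  then show "\<exists>G\<in>borel_measurable M. L2_approx M V G \<and> L2_dist M F G < ennreal \<epsilon>"
    using simple sm by blast
qed

lemma integrable_L2_mult:
  fixes F G :: "'a \<Rightarrow> complex"
  assumes [measurable]: "F \<in> borel_measurable M" "G \<in> borel_measurable M"
    and "integrable M (\<lambda>x. (cmod (F x))\<^sup>2)" "integrable M (\<lambda>x. (cmod (G x))\<^sup>2)"
  shows "integrable M (\<lambda>x. F x * G x)"
proof (rule Bochner_Integration.integrable_bound)
  show "integrable M (\<lambda>x. (cmod (F x))\<^sup>2 + (cmod (G x))\<^sup>2)" using assms by simp
  have "cmod (F x * G x) \<le> (cmod (F x))\<^sup>2 + (cmod (G x))\<^sup>2" for x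
  proof -
    have "2 * (cmod (F x) * cmod (G x)) \<le> (cmod (F x))\<^sup>2 + (cmod (G x))\<^sup>2"
      using sum_squares_bound[of "cmod (F x)" "cmod (G x)"] by simp
    moreover have "0 \<le> cmod (F x) * cmod (G x)" by simp
    ultimately show ?thesis unfolding norm_mult by linarith
  qed
  then show "AE x in M. norm (F x * G x) \<le> norm ((cmod (F x))\<^sup>2 + (cmod (G x))\<^sup>2)" by simp
qed simp

lemma borel_measurable_cnj_compose [measurable (raw)]:
  "f \<in> borel_measurable M \<Longrightarrow> (\<lambda>x. cnj (f x)) \<in> borel_measurable M"
  by (rule borel_measurable_continuous_on[OF continuous_on_cnj[OF continuous_on_id]])

text \<open>With c the coefficients of F and p = sum a e, orthonormality gives |F - p|^2 = |F|^2 -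
  sum |c|^2 + sum |a - c|^2 in integrated form. Taking a = c yields Bessel's inequality; taking p
  close to F bounds the partial sums from below. Bounded \<open>e\<close> on a finite measure makes
  every product integrable.\<close>

theorem Parseval_of_dense:
  fixes e :: "'k \<Rightarrow> 'a \<Rightarrow> complex"
  assumes "finite_measure M"
    and e[measurable]: "\<And>k. e k \<in> borel_measurable M" and e1: "\<And>k x. cmod (e k x) \<le> 1"
    and orth: "\<And>k l. k \<in> I \<Longrightarrow> l \<in> I \<Longrightarrow> (LINT x|M. e k x * cnj (e l x)) = (if k = l then 1 else 0)"
    and F[measurable]: "F \<in> borel_measurable M" and F2: "integrable M (\<lambda>x. (cmod (F x))\<^sup>2)"
    and dense: "L2_approx M {\<lambda>x. \<Sum>k\<in>K. c k * e k x | K c. finite K \<and> K \<subseteq> I} F"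
  shows "((\<lambda>k. (cmod (LINT x|M. F x * cnj (e k x)))\<^sup>2) has_sum (LINT x|M. (cmod (F x))\<^sup>2)) I"
proof -
  interpret finite_measure M by fact
  define c where "c k = (LINT x|M. F x * cnj (e k x))" for k
  let ?N = "LINT x|M. (cmod (F x))\<^sup>2"
  have e2: "integrable M (\<lambda>x. (cmod (e k x))\<^sup>2)" for k
    using e1[of k] by (intro integrable_const_bound[where B = 1]) (auto simp: power_le_one)
  have Fe: "integrable M (\<lambda>x. F x * cnj (e k x))" for k
    using e2 F2 by (intro integrable_L2_mult) auto
  have Fe': "integrable M (\<lambda>x. e k x * cnj (F x))" for k
    using e2 F2 by (intro integrable_L2_mult) auto
  have ee: "integrable M (\<lambda>x. e k x * cnj (e l x))" for k l
    using e2 by (intro integrable_L2_mult) auto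
  have cnj_c: "(LINT x|M. e k x * cnj (F x)) = cnj (c k)" for k
    unfolding c_def by (subst Bochner_Integration.integral_cnj[symmetric]) (simp add: mult.commute)
  have expand: "(LINT x|M. (cmod (F x - (\<Sum>k\<in>K. a k * e k x)))\<^sup>2) =
      ?N - (\<Sum>k\<in>K. (cmod (c k))\<^sup>2) + (\<Sum>k\<in>K. (cmod (a k - c k))\<^sup>2)"
      and expand_int: "integrable M (\<lambda>x. (cmod (F x - (\<Sum>k\<in>K. a k * e k x)))\<^sup>2)"
    if K: "finite K" "K \<subseteq> I" for K a
  proof -
    let ?p = "\<lambda>x. \<Sum>k\<in>K. a k * e k x"
    have eq: "complex_of_real ((cmod (F x - ?p x))\<^sup>2) = complex_of_real ((cmod (F x))\<^sup>2)
        - (\<Sum>k\<in>K. cnj (a k) * (F x * cnj (e k x))) - (\<Sum>k\<in>K. a k * (e k x * cnj (F x)))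
        + (\<Sum>k\<in>K. \<Sum>l\<in>K. a k * cnj (a l) * (e k x * cnj (e l x)))" for x
    proof -
      have 1: "F x * cnj (?p x) = (\<Sum>k\<in>K. cnj (a k) * (F x * cnj (e k x)))"
        by (simp add: sum_distrib_left mult_ac)
      have 2: "?p x * cnj (F x) = (\<Sum>k\<in>K. a k * (e k x * cnj (F x)))"
        by (simp add: sum_distrib_right mult.assoc)
      have "?p x * cnj (?p x) = (\<Sum>k\<in>K. \<Sum>l\<in>K. (a k * e k x) * (cnj (a l) * cnj (e l x)))"
        by (simp add: sum_product)
      then have 3: "?p x * cnj (?p x) = (\<Sum>k\<in>K. \<Sum>l\<in>K. a k * cnj (a l) * (e k x * cnj (e l x)))"
        by (simp add: mult_ac)
      show ?thesis
        unfolding complex_norm_square 1[symmetric] 2[symmetric] 3[symmetric] complex_cnj_diff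
        by (simp only: algebra_simps)
    qed
    have int: "integrable M (\<lambda>x. complex_of_real ((cmod (F x))\<^sup>2))"
      unfolding complex_of_real_integrable_eq by (rule F2)
    have "integrable M (\<lambda>x. complex_of_real ((cmod (F x - ?p x))\<^sup>2))"
      unfolding eq by (intro Bochner_Integration.integrable_add Bochner_Integration.integrable_diff int
          Bochner_Integration.integrable_sum integrable_mult_right Fe Fe' ee)
    then show "integrable M (\<lambda>x. (cmod (F x - ?p x))\<^sup>2)" unfolding complex_of_real_integrable_eq .
    have "complex_of_real (LINT x|M. (cmod (F x - ?p x))\<^sup>2) = (LINT x|M. complex_of_real ((cmod (F x - ?p x))\<^sup>2))"
      by (simp only: integral_complex_of_real)
    also have "\<dots> = (LINT x|M. complex_of_real ((cmod (F x))\<^sup>2))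
        - (\<Sum>k\<in>K. cnj (a k) * c k) - (\<Sum>k\<in>K. a k * cnj (c k))
        + (\<Sum>k\<in>K. \<Sum>l\<in>K. a k * cnj (a l) * (if k = l then 1 else 0))"
      unfolding eq using K
      by (simp add: int Fe Fe' ee cnj_c orth subset_iff Bochner_Integration.integral_add Bochner_Integration.integral_diff
          Bochner_Integration.integral_sum c_def[symmetric] del: of_real_power)
    also have "(\<Sum>k\<in>K. \<Sum>l\<in>K. a k * cnj (a l) * (if k = l then 1 else 0)) = (\<Sum>k\<in>K. a k * cnj (a k))"
      using K by (intro sum.cong refl) (simp add: if_distrib cong: if_cong)
    also have "(LINT x|M. complex_of_real ((cmod (F x))\<^sup>2))
        - (\<Sum>k\<in>K. cnj (a k) * c k) - (\<Sum>k\<in>K. a k * cnj (c k)) + (\<Sum>k\<in>K. a k * cnj (a k)) =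
        complex_of_real (?N - (\<Sum>k\<in>K. (cmod (c k))\<^sup>2) + (\<Sum>k\<in>K. (cmod (a k - c k))\<^sup>2))"
      unfolding integral_complex_of_real of_real_add of_real_diff of_real_sum complex_norm_square[symmetric]
      by (simp add: complex_norm_square algebra_simps sum.distrib sum_subtractf del: of_real_power)
    finally show "(LINT x|M. (cmod (F x - ?p x))\<^sup>2) = ?N - (\<Sum>k\<in>K. (cmod (c k))\<^sup>2) + (\<Sum>k\<in>K. (cmod (a k - c k))\<^sup>2)"
      by (simp only: of_real_eq_iff)
  qed
  have Bessel: "(\<Sum>k\<in>K. (cmod (c k))\<^sup>2) \<le> ?N" if "finite K" "K \<subseteq> I" for K
  proof -
    have "0 \<le> (LINT x|M. (cmod (F x - (\<Sum>k\<in>K. c k * e k x)))\<^sup>2)" by (intro integral_nonneg_AE) auto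
    then show ?thesis unfolding expand[OF that] by simp
  qed
  have "((\<lambda>k. (cmod (c k))\<^sup>2) has_sum ?N) I"
    unfolding has_sum_def tendsto_iff eventually_finite_subsets_at_top
  proof (intro allI impI)
    fix \<epsilon> :: real assume "\<epsilon> > 0"
    then obtain K a where K: "finite K" "K \<subseteq> I" and d: "L2_dist M F (\<lambda>x. \<Sum>k\<in>K. a k * e k x) < ennreal \<epsilon>"
      using dense unfolding L2_approx_def by force
    have "L2_dist M F (\<lambda>x. \<Sum>k\<in>K. a k * e k x) = ennreal (LINT x|M. (cmod (F x - (\<Sum>k\<in>K. a k * e k x)))\<^sup>2)"
      unfolding L2_dist_def by (rule nn_integral_eq_integral[OF expand_int[OF K]]) simp
    then have "(LINT x|M. (cmod (F x - (\<Sum>k\<in>K. a k * e k x)))\<^sup>2) < \<epsilon>"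
      using d \<open>\<epsilon> > 0\<close> by (simp add: ennreal_less_iff integral_nonneg_AE)
    moreover have "0 \<le> (\<Sum>k\<in>K. (cmod (a k - c k))\<^sup>2)" by (intro sum_nonneg) auto
    ultimately have low: "?N - \<epsilon> < (\<Sum>k\<in>K. (cmod (c k))\<^sup>2)" unfolding expand[OF K] by linarith
    show "\<exists>X. finite X \<and> X \<subseteq> I \<and> (\<forall>Y. finite Y \<and> X \<subseteq> Y \<and> Y \<subseteq> I \<longrightarrow> dist (\<Sum>k\<in>Y. (cmod (c k))\<^sup>2) ?N < \<epsilon>)"
    proof (intro exI[of _ K] conjI K allI impI)
      fix Y assume Y: "finite Y \<and> K \<subseteq> Y \<and> Y \<subseteq> I"
      then have "(\<Sum>k\<in>K. (cmod (c k))\<^sup>2) \<le> (\<Sum>k\<in>Y. (cmod (c k))\<^sup>2)" by (intro sum_mono2) auto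
      then show "dist (\<Sum>k\<in>Y. (cmod (c k))\<^sup>2) ?N < \<epsilon>"
        using low Bessel[of Y] Y by (simp add: dist_real_def)
    qed
  qed
  then show ?thesis unfolding c_def .
qed

subsection \<open>Fourier series on the unit cube\<close>

definition int_lattice :: "'e::euclidean_space set" where
  "int_lattice = {k. \<forall>b\<in>Basis. k \<bullet> b \<in> \<int>}"

definition char_fun :: "'e::euclidean_space \<Rightarrow> 'e \<Rightarrow> complex" where
  "char_fun k x = cis (2 * pi * (k \<bullet> x))"

text \<open>A density rather than a restricted space, so that measurable functions remain the Borel
  functions on the whole space.\<close>

definition unit_cube :: "'e::euclidean_space measure" where
  "unit_cube = density lborel (indicator (box 0 One))"

definition trig_poly :: "('e::euclidean_space \<Rightarrow> complex) set" where
  "trig_poly = {\<lambda>x. \<Sum>k\<in>K. c k * char_fun k x | K c. finite K \<and> K \<subseteq> int_lattice}"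

lemma countable_int_lattice: "countable (int_lattice :: 'e::euclidean_space set)"
proof -
  have count: "countable (PiE (Basis :: 'e set) (\<lambda>_. \<int> :: real set))"
    by (intro countable_PiE) (auto simp: Ints_def)
  have "int_lattice \<subseteq> (\<lambda>f. \<Sum>b\<in>Basis. f b *\<^sub>R b) ` (PiE (Basis :: 'e set) (\<lambda>_. \<int> :: real set))"
  proof
    fix k :: 'e assume "k \<in> int_lattice"
    then have "restrict (\<lambda>b. k \<bullet> b) Basis \<in> PiE (Basis :: 'e set) (\<lambda>_. \<int> :: real set)"
      by (auto simp: int_lattice_def)
    moreover have "k = (\<Sum>b\<in>Basis. restrict (\<lambda>b. k \<bullet> b) Basis b *\<^sub>R b)"
      by (simp add: euclidean_representation)
    ultimately show "k \<in> (\<lambda>f. \<Sum>b\<in>Basis. f b *\<^sub>R b) ` (PiE (Basis :: 'e set) (\<lambda>_. \<int> :: real set))" by blast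
  qed
  then show ?thesis by (rule countable_subset[OF _ countable_image[OF count]])
qed

lemma int_lattice_closed:
  "0 \<in> int_lattice" "k \<in> int_lattice \<Longrightarrow> - k \<in> int_lattice"
  "k \<in> int_lattice \<Longrightarrow> l \<in> int_lattice \<Longrightarrow> k + l \<in> int_lattice" "b \<in> Basis \<Longrightarrow> b \<in> int_lattice"
  by (auto simp: int_lattice_def inner_add_left inner_Basis)

lemma char_fun_add: "char_fun (k + l) x = char_fun k x * char_fun l x"
  by (simp add: char_fun_def cis_mult inner_add_left algebra_simps)

lemma cnj_char_fun: "cnj (char_fun k x) = char_fun (- k) x"
  by (simp add: char_fun_def cis_cnj)

lemma norm_char_fun [simp]: "cmod (char_fun k x) = 1"
  by (simp add: char_fun_def)

lemma continuous_on_char_fun: "continuous_on A (char_fun k)"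
  unfolding char_fun_def cis_conv_exp by (intro continuous_intros)

lemma measurable_char_fun [measurable]: "char_fun k \<in> borel_measurable borel"
  by (intro borel_measurable_continuous_onI continuous_on_char_fun)

lemma sets_unit_cube [simp, measurable_cong]: "sets unit_cube = sets borel"
  and space_unit_cube [simp]: "space unit_cube = UNIV"
  by (simp_all add: unit_cube_def)

lemma emeasure_unit_cube: "A \<in> sets borel \<Longrightarrow> emeasure unit_cube A = emeasure lborel (A \<inter> box 0 One)"
  unfolding unit_cube_def
  by (subst emeasure_density) (auto simp: indicator_inter_arith[symmetric] mult.commute Int_commute
      nn_integral_indicator[symmetric] simp del: nn_integral_indicator)

lemma prob_unit_cube: "emeasure (unit_cube :: 'e::euclidean_space measure) UNIV = 1"
proof -
  have "emeasure lborel (box 0 One :: 'e set) = 1"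
    by (subst emeasure_lborel_box) (auto simp: inner_sum_left inner_Basis)
  then show ?thesis by (subst emeasure_unit_cube) auto
qed

lemma finite_measure_unit_cube: "finite_measure unit_cube"
  by (rule finite_measureI) (simp add: prob_unit_cube)

lemma trig_poly_char_fun: "k \<in> int_lattice \<Longrightarrow> (\<lambda>x. c * char_fun k x) \<in> trig_poly"
  unfolding trig_poly_def by (rule CollectI, rule exI[of _ "{k}"], rule exI[of _ "\<lambda>_. c"]) auto

lemma trig_poly_add:
  assumes "p \<in> trig_poly" "q \<in> trig_poly"
  shows "(\<lambda>x. p x + q x) \<in> trig_poly"
proof -
  obtain K c where K: "finite K" "K \<subseteq> int_lattice" "p = (\<lambda>x. \<Sum>k\<in>K. c k * char_fun k x)"
    using assms(1) by (auto simp: trig_poly_def)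
  obtain L d where L: "finite L" "L \<subseteq> int_lattice" "q = (\<lambda>x. \<Sum>k\<in>L. d k * char_fun k x)"
    using assms(2) by (auto simp: trig_poly_def)
  let ?c = "\<lambda>k. (if k \<in> K then c k else 0) + (if k \<in> L then d k else 0)"
  have "p x = (\<Sum>k\<in>K \<union> L. (if k \<in> K then c k else 0) * char_fun k x)" for x
    unfolding K(3) using K(1) L(1) by (intro sum.mono_neutral_cong_left) auto
  moreover have "q x = (\<Sum>k\<in>K \<union> L. (if k \<in> L then d k else 0) * char_fun k x)" for x
    unfolding L(3) using K(1) L(1) by (intro sum.mono_neutral_cong_left) auto
  ultimately have "(\<lambda>x. p x + q x) = (\<lambda>x. \<Sum>k\<in>K \<union> L. ?c k * char_fun k x)"
    by (simp add: sum.distrib distrib_right)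
  then show ?thesis unfolding trig_poly_def
    by (intro CollectI exI[of _ "K \<union> L"] exI[of _ ?c]) (use K(1,2) L(1,2) in auto)
qed

lemma trig_poly_sum: "(\<And>i. i \<in> I \<Longrightarrow> p i \<in> trig_poly) \<Longrightarrow> (\<lambda>x. \<Sum>i\<in>I. p i x) \<in> trig_poly"
proof (induction I rule: infinite_finite_induct)
  case (insert i I)
  then show ?case by (auto intro: trig_poly_add)
qed (use trig_poly_char_fun[OF int_lattice_closed(1), of 0] in auto)

lemma trig_poly_mult:
  assumes "p \<in> trig_poly" "q \<in> trig_poly"
  shows "(\<lambda>x. p x * q x) \<in> trig_poly"
proof -
  obtain K c where K: "finite K" "K \<subseteq> int_lattice" "p = (\<lambda>x. \<Sum>k\<in>K. c k * char_fun k x)"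
    using assms(1) by (auto simp: trig_poly_def)
  obtain L d where L: "finite L" "L \<subseteq> int_lattice" "q = (\<lambda>x. \<Sum>k\<in>L. d k * char_fun k x)"
    using assms(2) by (auto simp: trig_poly_def)
  have "(\<lambda>x. p x * q x) = (\<lambda>x. \<Sum>k\<in>K. \<Sum>l\<in>L. (c k * d l) * char_fun (k + l) x)"
    unfolding K(3) L(3) by (simp add: sum_product char_fun_add mult_ac)
  also have "\<dots> \<in> trig_poly"
    using K L by (intro trig_poly_sum trig_poly_char_fun int_lattice_closed(3)) auto
  finally show ?thesis .
qed

lemma trig_poly_const: "(\<lambda>x. c) \<in> trig_poly"
  using trig_poly_char_fun[OF int_lattice_closed(1), of c] by (simp add: char_fun_def)

lemma trig_poly_measurable: "trig_poly \<subseteq> borel_measurable borel"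
  by (auto simp: trig_poly_def)

text \<open>The integrand is the character of m = k - l, a product of functions of one coordinate
  each. The integral therefore factors, and a one-dimensional factor is 1 or 0 according to whether
  the integer coordinate of m vanishes.\<close>

lemma char_fun_orthonormal:
  fixes k l :: "'e::euclidean_space"
  assumes "k \<in> int_lattice" "l \<in> int_lattice"
  shows "(LINT x|unit_cube. char_fun k x * cnj (char_fun l x)) = (if k = l then 1 else 0)"
proof -
  interpret product_sigma_finite "\<lambda>_. lborel :: real measure" by unfold_locales
  define m where "m = k - l"
  have m: "m \<bullet> b \<in> \<int>" if "b \<in> Basis" for b
    using assms that by (auto simp: m_def int_lattice_def inner_diff_left)
  let ?f = "\<lambda>b t. indicator {0<..<1} t *\<^sub>R cis (2 * pi * (m \<bullet> b) * t)"
  have f1: "(LINT t|lborel. ?f b t) = (if m \<bullet> b = 0 then 1 else 0)"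
    and fi: "integrable lborel (?f b)" if "b \<in> Basis" for b
  proof -
    let ?a = "2 * pi * (m \<bullet> b)"
    \<comment> \<open>The fundamental theorem of calculus wants a closed interval, the open cube an
      open one; they differ by the two endpoints, a null set.\<close>
    let ?g = "\<lambda>t. indicator {0..1} t *\<^sub>R cis (?a * t)"
    have [measurable]: "(\<lambda>t. cis (?a * t)) \<in> borel_measurable borel"
      unfolding cis_conv_exp by (intro borel_measurable_continuous_onI continuous_intros)
    have gi: "integrable lborel ?g"
      unfolding cis_conv_exp by (intro borel_integrable_atLeastAtMost' [unfolded set_integrable_def] continuous_intros)
    have AE: "AE t in lborel. ?g t = ?f b t"
      using AE_lborel_singleton[of "0::real"] AE_lborel_singleton[of "1::real"]
      by eventually_elim (auto simp: indicator_def)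
    show "integrable lborel (?f b)"
      using gi by (rule integrable_cong_AE_imp) (use AE in auto)
    have "(LINT t|lborel. ?f b t) = (LINT t|lborel. ?g t)"
      by (rule integral_cong_AE) (use AE in auto)
    also have "\<dots> = (if m \<bullet> b = 0 then 1 else 0)"
    proof (cases "m \<bullet> b = 0")
      case False
      have "(LINT t|lborel. ?g t) = cis (?a * 1) / (\<i> * ?a) - cis (?a * 0) / (\<i> * ?a)"
      proof (rule integral_FTC_Icc)
        show "((\<lambda>t. cis (?a * t) / (\<i> * ?a)) has_vector_derivative cis (?a * t)) (at t within {0..1})" for t
          unfolding has_vector_derivative_def using False
          by (auto intro!: derivative_eq_intros simp: scaleR_conv_of_real fun_eq_iff field_simps)
        show "continuous_on {0..1} (\<lambda>t. cis (?a * t))"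
          unfolding cis_conv_exp by (intro continuous_intros)
      qed simp
      moreover have "cis ?a = 1" using m[OF that] by (simp add: cis_multiple_2pi)
      ultimately show ?thesis using False by simp
    qed simp
    finally show "(LINT t|lborel. ?f b t) = (if m \<bullet> b = 0 then 1 else 0)" .
  qed
  have prod: "indicator (box 0 One) x *\<^sub>R char_fun m x = (\<Prod>b\<in>Basis. ?f b (x \<bullet> b))" for x :: 'e
  proof (cases "x \<in> box 0 One")
    case True
    have "char_fun m x = (\<Prod>b\<in>Basis. cis (2 * pi * (m \<bullet> b) * (x \<bullet> b)))"
      unfolding char_fun_def cis_conv_exp exp_sum[OF finite_Basis, symmetric]
      by (subst euclidean_inner) (simp add: sum_distrib_left mult_ac)
    then show ?thesis using True by (simp add: mem_box)
  next
    case False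
    then obtain b where "b \<in> Basis" "\<not> (0 < x \<bullet> b \<and> x \<bullet> b < 1)" by (auto simp: mem_box)
    then have "(\<Prod>b\<in>Basis. ?f b (x \<bullet> b)) = 0" by (intro prod_zero) (auto intro!: bexI[of _ b])
    then show ?thesis using False by simp
  qed
  have "(LINT x|unit_cube. char_fun k x * cnj (char_fun l x)) = (LINT x|unit_cube. char_fun m x)"
    by (simp add: cnj_char_fun char_fun_add[symmetric] m_def)
  also have "\<dots> = (LINT x|lborel. indicator (box 0 One) x *\<^sub>R char_fun m x)"
    using integral_density[of "char_fun m" lborel "indicator (box 0 One)"]
    by (simp add: unit_cube_def ennreal_indicator)
  also have "\<dots> = (LINT x|lborel. (\<Prod>b\<in>Basis. ?f b (x \<bullet> b)))"
    unfolding prod ..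
  also have "\<dots> = (LINT g|(\<Pi>\<^sub>M b\<in>Basis. lborel). (\<Prod>b\<in>Basis. ?f b ((\<Sum>b\<in>Basis. g b *\<^sub>R b) \<bullet> b)))"
    unfolding cis_conv_exp
    by (subst lborel_eq, subst integral_distr) measurable
  also have "\<dots> = (LINT g|(\<Pi>\<^sub>M b\<in>Basis. lborel). (\<Prod>b\<in>Basis. ?f b (g b)))"
    by simp
  also have "\<dots> = (\<Prod>b\<in>Basis. (LINT t|lborel. ?f b t))"
    by (rule product_integral_prod) (use fi in auto)
  also have "\<dots> = (\<Prod>b\<in>Basis. (if m \<bullet> b = 0 then 1 else 0))"
    by (rule prod.cong) (use f1 in auto)
  also have "\<dots> = (if k = l then 1 else 0)"
  proof (cases "k = l")
    case False
    then obtain b where "b \<in> Basis" "m \<bullet> b \<noteq> 0" by (auto simp: m_def euclidean_eq_iff[of k] inner_diff_left)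
    then have "(\<Prod>b\<in>Basis. (if m \<bullet> b = 0 then 1 else 0)) = (0::complex)"
      by (intro prod_zero) (auto intro!: bexI[of _ b])
    then show ?thesis using False by simp
  qed (simp add: m_def)
  finally show ?thesis .
qed

section \<open>Density of the trigonometric polynomials\<close>

definition torus_map :: "'e::euclidean_space \<Rightarrow> 'e \<times> 'e" where
  "torus_map x = ((\<Sum>b\<in>Basis. cos (2 * pi * (x \<bullet> b)) *\<^sub>R b), (\<Sum>b\<in>Basis. sin (2 * pi * (x \<bullet> b)) *\<^sub>R b))"

lemma torus_map_inner:
  assumes "b \<in> Basis"
  shows "fst (torus_map x) \<bullet> b = cos (2 * pi * (x \<bullet> b))" "snd (torus_map x) \<bullet> b = sin (2 * pi * (x \<bullet> b))"
  using assms by (simp_all add: torus_map_def)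

lemma continuous_on_torus_map: "continuous_on A torus_map"
  unfolding torus_map_def by (intro continuous_intros)

text \<open>Equal sines and cosines mean that coordinates differ by integers. With one point in the
  open cube and the other in the closed one, the difference lies strictly between -1 and 1; two
  boundary points could be identified.\<close>

lemma torus_map_eq:
  assumes "torus_map x = torus_map y" "x \<in> cbox 0 One" "y \<in> cbox 0 One" "x \<in> box 0 One"
  shows "x = y"
proof (rule euclidean_eqI)
  fix b :: 'a assume b: "b \<in> Basis"
  have "cos (2 * pi * (x \<bullet> b)) = cos (2 * pi * (y \<bullet> b))" "sin (2 * pi * (x \<bullet> b)) = sin (2 * pi * (y \<bullet> b))"
    using assms(1) torus_map_inner[OF b] by metis+
  then obtain n :: int where n: "2 * pi * (x \<bullet> b) = 2 * pi * (y \<bullet> b) + 2 * pi * n"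
    using sin_cos_eq_iff by metis
  then have "2 * pi * (x \<bullet> b) = 2 * pi * (y \<bullet> b + n)" by (simp add: algebra_simps)
  then have e: "x \<bullet> b = y \<bullet> b + n" by simp
  moreover have "0 < x \<bullet> b" "x \<bullet> b < 1" "0 \<le> y \<bullet> b" "y \<bullet> b \<le> 1"
    using assms(3,4) b by (auto simp: mem_box)
  ultimately have "n > -1" "n < 1" by linarith+
  then show "x \<bullet> b = y \<bullet> b" using e by simp
qed

text \<open>A function vanishing on the boundary of the cube descends to a continuous function on the
  torus, where the trigonometric polynomials separate points.\<close>

lemma trig_poly_uniform_approx:
  fixes u :: "'e::euclidean_space \<Rightarrow> real"
  assumes u: "continuous_on UNIV u" "\<And>x. x \<notin> box 0 One \<Longrightarrow> u x = 0" and "\<epsilon> > 0"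
  obtains p where "p \<in> trig_poly" "\<And>x. x \<in> cbox 0 One \<Longrightarrow> cmod (of_real (u x) - p x) < \<epsilon>"
proof -
  let ?Q = "cbox 0 One :: 'e set"
  define T where "T = torus_map ` ?Q"
  have cT: "compact T" unfolding T_def by (intro compact_continuous_image continuous_on_torus_map) auto
  define v where "v t = u (SOME x. x \<in> ?Q \<and> torus_map x = t)" for t
  have v: "v (torus_map x) = u x" if x: "x \<in> ?Q" for x
  proof -
    define y where "y = (SOME y. y \<in> ?Q \<and> torus_map y = torus_map x)"
    have "y \<in> ?Q \<and> torus_map y = torus_map x" unfolding y_def by (rule someI[of _ x]) (use x in simp)
    \<comment> \<open>If either point is interior they coincide by \<open>torus_map_eq\<close>;
      otherwise both lie outside the open cube, where \<open>u\<close> is 0.\<close>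
    then have "u y = u x"
      using torus_map_eq[of x y] torus_map_eq[of y x] u(2) x by metis
    then show ?thesis by (simp add: v_def y_def)
  qed
  \<comment> \<open>A continuous map from the compact cube onto \<open>T\<close> is a quotient map:
    the preimage of a closed set under \<open>v\<close> is the image of a compact set.\<close>
  have cv: "continuous_on T v"
    unfolding continuous_on_closed_vimage[OF compact_imp_closed[OF cT]]
  proof (intro allI impI)
    fix B :: "real set" assume "closed B"
    have "v -` B \<inter> T = torus_map ` (?Q \<inter> u -` B)" using v by (auto simp: T_def)
    moreover have "compact (?Q \<inter> u -` B)"
      by (intro compact_Int_closed closed_vimage \<open>closed B\<close> u(1)) auto
    ultimately show "closed (v -` B \<inter> T)"
      by (metis compact_continuous_image compact_imp_closed continuous_on_torus_map)
  qed
  \<comment> \<open>Stone-Weierstrass is applied in its real form, to real functions on the torus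
    whose pullbacks are complex trigonometric polynomials. The cosine and sine coordinates separate
    points.\<close>
  define R where "R f \<longleftrightarrow> continuous_on T f \<and> (\<lambda>x. complex_of_real (f (torus_map x))) \<in> trig_poly" for f :: "'e \<times> 'e \<Rightarrow> real"
  have "\<exists>g. R g \<and> (\<forall>t\<in>T. \<bar>v t - g t\<bar> < \<epsilon>)"
  proof (rule Stone_Weierstrass_HOL[OF cT _ _ _ _ _ cv \<open>\<epsilon> > 0\<close>])
    show "R (\<lambda>x. c)" for c by (simp add: R_def trig_poly_const)
    show "continuous_on T f" if "R f" for f using that by (simp add: R_def)
    show "R (\<lambda>x. f x + g x)" if "R f \<and> R g" for f g
      using that by (simp add: R_def continuous_on_add trig_poly_add)
    show "R (\<lambda>x. f x * g x)" if "R f \<and> R g" for f g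
      using that by (simp add: R_def continuous_on_mult trig_poly_mult)
    fix s t assume st: "s \<in> T \<and> t \<in> T \<and> s \<noteq> t"
    have cosR: "R (\<lambda>t. fst t \<bullet> b)" if b: "b \<in> Basis" for b
    proof -
      have eq: "complex_of_real (fst (torus_map x) \<bullet> b) = (1/2) * char_fun b x + (1/2) * char_fun (- b) x" for x
        unfolding torus_map_inner[OF b] char_fun_def
        by (simp add: complex_eq_iff inner_commute)
      show ?thesis unfolding R_def eq
        by (intro conjI continuous_intros trig_poly_add trig_poly_char_fun int_lattice_closed(2,4) b)
    qed
    have sinR: "R (\<lambda>t. snd t \<bullet> b)" if b: "b \<in> Basis" for b
    proof -
      have eq: "complex_of_real (snd (torus_map x) \<bullet> b) = (- \<i>/2) * char_fun b x + (\<i>/2) * char_fun (- b) x" for x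
        unfolding torus_map_inner[OF b] char_fun_def
        by (simp add: complex_eq_iff inner_commute)
      show ?thesis unfolding R_def eq
        by (intro conjI continuous_intros trig_poly_add trig_poly_char_fun int_lattice_closed(2,4) b)
    qed
    have "\<exists>b\<in>Basis. fst s \<bullet> b \<noteq> fst t \<bullet> b \<or> snd s \<bullet> b \<noteq> snd t \<bullet> b"
      using st euclidean_eqI[of "fst s" "fst t"] euclidean_eqI[of "snd s" "snd t"] by (metis prod_eq_iff)
    then show "\<exists>f. R f \<and> f s \<noteq> f t" using cosR sinR by blast
  qed
  then obtain g where g: "R g" "\<And>t. t \<in> T \<Longrightarrow> \<bar>v t - g t\<bar> < \<epsilon>" by blast
  show thesis
  proof (rule that)
    show "(\<lambda>x. complex_of_real (g (torus_map x))) \<in> trig_poly" using g by (simp add: R_def)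
    fix x assume x: "x \<in> ?Q"
    then have "\<bar>u x - g (torus_map x)\<bar> < \<epsilon>" using g(2)[of "torus_map x"] v[OF x] by (simp add: T_def)
    then show "cmod (of_real (u x) - of_real (g (torus_map x))) < \<epsilon>"
      by (simp only: of_real_diff[symmetric] norm_of_real)
  qed
qed

lemma AE_unit_cube: "AE x in unit_cube. x \<in> box 0 One"
  unfolding unit_cube_def by (subst AE_density) (auto simp: indicator_def)

lemma L2_approx_trig_poly_continuous:
  fixes u :: "'e::euclidean_space \<Rightarrow> real"
  assumes u: "continuous_on UNIV u" "\<And>x. x \<notin> box 0 One \<Longrightarrow> u x = 0"
  shows "L2_approx unit_cube trig_poly (\<lambda>x. of_real (u x))"
  unfolding L2_approx_def
proof (intro allI impI)
  fix \<epsilon> :: real assume \<epsilon>: "\<epsilon> > 0"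
  then obtain p :: "'e \<Rightarrow> complex" where p: "p \<in> trig_poly" "\<And>x. x \<in> cbox 0 One \<Longrightarrow> cmod (of_real (u x) - p x) < sqrt (\<epsilon> / 2)"
    using trig_poly_uniform_approx[OF u, of "sqrt (\<epsilon> / 2)"] by auto
  have "L2_dist unit_cube (\<lambda>x. of_real (u x)) p \<le> (\<integral>\<^sup>+x. ennreal (\<epsilon> / 2) \<partial>(unit_cube :: 'e measure))"
    unfolding L2_dist_def
  proof (rule nn_integral_mono_AE, use AE_unit_cube in eventually_elim)
    fix x :: 'e assume "x \<in> box 0 One"
    then have "cmod (of_real (u x) - p x) < sqrt (\<epsilon> / 2)" using p(2) box_subset_cbox by blast
    then have "(cmod (of_real (u x) - p x))\<^sup>2 \<le> (sqrt (\<epsilon> / 2))\<^sup>2" by (intro power_mono) auto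
    then show "ennreal ((cmod (of_real (u x) - p x))\<^sup>2) \<le> ennreal (\<epsilon> / 2)"
      using \<epsilon> by (intro ennreal_leI) simp
  qed
  also have "\<dots> = ennreal (\<epsilon> / 2)" by (simp add: prob_unit_cube)
  also have "\<dots> < ennreal \<epsilon>" using \<epsilon> by (simp add: ennreal_less_iff)
  finally show "\<exists>p\<in>trig_poly. L2_dist unit_cube (\<lambda>x. complex_of_real (u x)) p < ennreal \<epsilon>" using p(1) by blast
qed

text \<open>Regularity places the part of \<open>A\<close> in the open cube between a compact
  \<open>K\<close> and an open \<open>U\<close> with U - K of small measure. A Urysohn function
  equal to 1 on \<open>K\<close> and vanishing off the trace of \<open>U\<close> on the cube differs
  from the indicator only on U - K, up to a null set, and trigonometric polynomials approximate
  it.\<close>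

lemma L2_approx_trig_poly_indicator:
  fixes A :: "'e::euclidean_space set"
  assumes A: "A \<in> sets borel"
  shows "L2_approx unit_cube trig_poly (indicator A)"
proof (rule L2_approx_limit)
  interpret finite_measure "unit_cube :: 'e measure" by (rule finite_measure_unit_cube)
  show "trig_poly \<subseteq> borel_measurable unit_cube"
    using trig_poly_measurable by (auto cong: measurable_cong_sets)
  show "indicator A \<in> borel_measurable unit_cube" using A by simp
  fix \<epsilon> :: real assume \<epsilon>: "\<epsilon> > 0"
  define B where "B = A \<inter> box 0 One"
  have B: "B \<in> sets borel" using A by (simp add: B_def)
  let ?m = "measure (unit_cube :: 'e measure)"
  have sup: "emeasure unit_cube B = (SUP K \<in> {K. K \<subseteq> B \<and> compact K}. emeasure unit_cube K)"
    by (rule inner_regular) (auto simp: B)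
  have ne: "{K. K \<subseteq> B \<and> compact K} \<noteq> {}" using compact_empty by blast
  have "\<exists>K\<in>{K. K \<subseteq> B \<and> compact K}. emeasure unit_cube B < emeasure unit_cube K + ennreal (\<epsilon> / 4)"
    by (rule SUP_approx_ennreal[OF _ ne sup]) (use \<epsilon> in auto)
  then
  obtain K where K: "K \<subseteq> B" "compact K" "emeasure unit_cube B < emeasure unit_cube K + ennreal (\<epsilon> / 4)"
    by auto
  have "emeasure unit_cube B = (INF U \<in> {U. B \<subseteq> U \<and> open U}. emeasure unit_cube U)"
    by (rule outer_regular) (auto simp: B)
  from INF_approx_ennreal[OF _ this, of "\<epsilon> / 4"] \<epsilon>
  obtain U where U: "B \<subseteq> U" "open U" "emeasure unit_cube U < emeasure unit_cube B + ennreal (\<epsilon> / 4)"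
    by auto
  have "emeasure unit_cube B < ennreal (?m K + \<epsilon> / 4)" "emeasure unit_cube U < ennreal (?m B + \<epsilon> / 4)"
    using K(3) U(3) \<epsilon> by (simp_all add: emeasure_eq_measure ennreal_plus[symmetric] del: ennreal_plus)
  then have "?m B < ?m K + \<epsilon> / 4" "?m U < ?m B + \<epsilon> / 4"
    using \<epsilon> by (simp_all add: emeasure_eq_measure ennreal_less_iff del: ennreal_plus)
  then have "?m U < ?m K + \<epsilon> / 2" by linarith
  define V where "V = U \<inter> box 0 One"
  have V: "open V" "B \<subseteq> V" using U by (auto simp: V_def B_def)
  have "?m (U - K) = ?m U - ?m K"
    using K(1,2) U(1,2) by (intro finite_measure_Diff) (auto simp: compact_imp_closed)
  then have small: "?m (U - K) < \<epsilon>" using \<open>?m U < ?m K + \<epsilon> / 2\<close> \<epsilon> by linarith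
  obtain u :: "'e \<Rightarrow> real" where u: "continuous_on UNIV u" "\<And>x. u x \<in> closed_segment 0 1"
    "\<And>x. x \<in> - V \<Longrightarrow> u x = 0" "\<And>x. x \<in> K \<Longrightarrow> u x = 1"
  proof (rule Urysohn[of "- V" K 0 1])
    show "closed (- V)" "closed K" "- V \<inter> K = {}" using V K by (auto simp: compact_imp_closed)
  qed blast
  have u01: "0 \<le> u x" "u x \<le> 1" for x using u(2)[of x] by (auto simp: closed_segment_eq_real_ivl)
  have "L2_dist unit_cube (indicator A) (\<lambda>x. of_real (u x)) \<le> (\<integral>\<^sup>+x. indicator (U - K) x \<partial>unit_cube)"
    unfolding L2_dist_def
  proof (rule nn_integral_mono_AE, use AE_unit_cube in eventually_elim)
    fix x :: 'e assume x: "x \<in> box 0 One"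
    consider "x \<in> K" | "x \<notin> V" | "x \<in> U - K" by (auto simp: V_def)
    then show "ennreal ((cmod (indicator A x - of_real (u x)))\<^sup>2) \<le> indicator (U - K) x"
    proof cases
      case 1
      then have "x \<in> A" using K(1) by (auto simp: B_def)
      then show ?thesis using u(4)[OF 1] by simp
    next
      case 2
      then have "x \<notin> A" using V(2) x by (auto simp: B_def)
      then show ?thesis using u(3) 2 by simp
    next
      case 3
      have "cmod (indicator A x - of_real (u x)) = \<bar>indicator A x - u x\<bar>"
        by (metis norm_of_real of_real_diff of_real_indicator)
      also have "\<dots> \<le> 1" using u01[of x] by (auto simp: indicator_def)
      finally have "(cmod (indicator A x - of_real (u x)))\<^sup>2 \<le> 1" by (simp add: power_le_one)
      then show ?thesis using 3 by simp
    qed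
  qed
  also have "\<dots> = emeasure unit_cube (U - K)"
    using U(2) K(2) by (subst nn_integral_indicator) (auto simp: compact_imp_closed)
  also have "\<dots> < ennreal \<epsilon>" using small \<epsilon> by (simp add: emeasure_eq_measure ennreal_less_iff)
  finally have "L2_dist unit_cube (indicator A) (\<lambda>x. of_real (u x)) < ennreal \<epsilon>" .
  moreover have "L2_approx unit_cube trig_poly (\<lambda>x. of_real (u x))"
    using u(1,3) by (intro L2_approx_trig_poly_continuous) (auto simp: V_def)
  moreover have "(\<lambda>x. complex_of_real (u x)) \<in> borel_measurable (unit_cube :: 'e measure)"
    using u(1) by (auto intro!: borel_measurable_continuous_onI continuous_intros cong: measurable_cong_sets)
  ultimately show "\<exists>G\<in>borel_measurable unit_cube. L2_approx unit_cube trig_poly G \<and> L2_dist unit_cube (indicator A) G < ennreal \<epsilon>"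
    by blast
qed

theorem Parseval_unit_cube:
  fixes F :: "'e::euclidean_space \<Rightarrow> complex"
  assumes F: "F \<in> borel_measurable borel" and F2: "integrable unit_cube (\<lambda>x. (cmod (F x))\<^sup>2)"
  shows "((\<lambda>k. (cmod (LINT x|unit_cube. F x * cnj (char_fun k x)))\<^sup>2) has_sum
    (LINT x|unit_cube. (cmod (F x))\<^sup>2)) int_lattice"
proof (rule Parseval_of_dense[OF finite_measure_unit_cube])
  have m: "borel_measurable unit_cube = borel_measurable borel" by (rule measurable_cong_sets) auto
  show "char_fun k \<in> borel_measurable unit_cube" "F \<in> borel_measurable unit_cube" for k
    unfolding m using F by auto
  have fin: "(\<integral>\<^sup>+x. ennreal ((cmod (F x))\<^sup>2) \<partial>unit_cube) < \<infinity>"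
    using F2 by (simp add: integrable_iff_bounded)
  have scale: "(\<lambda>x. c * p x) \<in> trig_poly" if "p \<in> trig_poly" for c and p :: "'e \<Rightarrow> complex"
    using trig_poly_mult[OF trig_poly_const that] .
  have "L2_approx unit_cube trig_poly F"
    by (rule L2_approx_from_indicators[OF _ trig_poly_add scale trig_poly_const])
       (use trig_poly_measurable F fin in \<open>auto simp: m intro: L2_approx_trig_poly_indicator\<close>)
  then show "L2_approx unit_cube {\<lambda>x. \<Sum>k\<in>K. c k * char_fun k x | K c. finite K \<and> K \<subseteq> int_lattice} F"
    unfolding trig_poly_def .
  show "(LINT x|unit_cube. char_fun k x * cnj (char_fun l x)) = (if k = l then 1 else 0)"
    if "k \<in> int_lattice" "l \<in> int_lattice" for k l :: 'e
    by (rule char_fun_orthonormal[OF that])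
qed (use F2 in auto)

section \<open>Parseval inequalities for measures comparable to Lebesgue measure\<close>

text \<open>On the set where the density exceeds c, the hypothesis forces the integral of the excess
  to vanish, so the set is null. Finiteness of c times its measure permits cancellation in
  \<open>ennreal\<close>.\<close>

lemma AE_density_le:
  assumes "finite_measure M" and [measurable]: "\<rho> \<in> borel_measurable M" "S \<in> sets M" and "c \<ge> (0::real)"
    and le: "\<And>A. A \<in> sets M \<Longrightarrow> A \<subseteq> S \<Longrightarrow> (\<integral>\<^sup>+x. \<rho> x * indicator A x \<partial>M) \<le> ennreal c * emeasure M A"
  shows "AE x in M. x \<in> S \<longrightarrow> \<rho> x \<le> ennreal c"
proof -
  interpret finite_measure M by fact
  define A where "A = {x \<in> space M. x \<in> S \<and> \<rho> x > ennreal c}"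
  have A[measurable]: "A \<in> sets M" unfolding A_def by measurable
  have fin: "ennreal c * emeasure M A \<noteq> \<infinity>" by (simp add: ennreal_mult_eq_top_iff)
  have "(\<integral>\<^sup>+x. (\<rho> x - ennreal c) * indicator A x \<partial>M) + ennreal c * emeasure M A =
      (\<integral>\<^sup>+x. (\<rho> x - ennreal c) * indicator A x + ennreal c * indicator A x \<partial>M)"
    by (simp add: nn_integral_add nn_integral_cmult)
  also have "\<dots> = (\<integral>\<^sup>+x. \<rho> x * indicator A x \<partial>M)"
    by (intro nn_integral_cong) (auto simp: A_def indicator_def intro: diff_add_cancel_ennreal)
  also have "\<dots> \<le> ennreal c * emeasure M A" by (rule le) (auto simp: A_def)
  finally have "(\<integral>\<^sup>+x. (\<rho> x - ennreal c) * indicator A x \<partial>M) = 0"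
    using fin by (metis add.commute add_0 ennreal_add_left_cancel_le infinity_ennreal_def le_zero_eq)
  then have "AE x in M. (\<rho> x - ennreal c) * indicator A x = 0" by (subst (asm) nn_integral_0_iff_AE) auto
  then show ?thesis
    by (rule AE_mp) (auto intro!: AE_I2 simp: A_def indicator_def not_le diff_eq_0_iff_ennreal split: if_splits)
qed

text \<open>The mirror image, integrating the deficit. Here it is the integral of the density that
  is cancelled, hence the finiteness assumption on it.\<close>

lemma AE_density_ge:
  assumes "finite_measure M" and [measurable]: "\<rho> \<in> borel_measurable M" "S \<in> sets M"
    and ge: "\<And>A. A \<in> sets M \<Longrightarrow> A \<subseteq> S \<Longrightarrow> ennreal c * emeasure M A \<le> (\<integral>\<^sup>+x. \<rho> x * indicator A x \<partial>M)"
    and fin: "(\<integral>\<^sup>+x. \<rho> x \<partial>M) < \<infinity>"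
  shows "AE x in M. x \<in> S \<longrightarrow> ennreal c \<le> \<rho> x"
proof -
  interpret finite_measure M by fact
  define A where "A = {x \<in> space M. x \<in> S \<and> \<rho> x < ennreal c}"
  have A[measurable]: "A \<in> sets M" unfolding A_def by measurable
  have "(\<integral>\<^sup>+x. \<rho> x * indicator A x \<partial>M) \<le> (\<integral>\<^sup>+x. \<rho> x \<partial>M)"
    by (intro nn_integral_mono) (auto simp: indicator_def)
  then have fin: "(\<integral>\<^sup>+x. \<rho> x * indicator A x \<partial>M) \<noteq> \<infinity>" using fin by (auto simp: top_unique)
  have "(\<integral>\<^sup>+x. (ennreal c - \<rho> x) * indicator A x \<partial>M) + (\<integral>\<^sup>+x. \<rho> x * indicator A x \<partial>M) =
      (\<integral>\<^sup>+x. (ennreal c - \<rho> x) * indicator A x + \<rho> x * indicator A x \<partial>M)"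
    by (simp add: nn_integral_add)
  also have "\<dots> = (\<integral>\<^sup>+x. ennreal c * indicator A x \<partial>M)"
    by (intro nn_integral_cong) (auto simp: A_def indicator_def intro: diff_add_cancel_ennreal)
  also have "\<dots> = ennreal c * emeasure M A" by (simp add: nn_integral_cmult)
  also have "\<dots> \<le> (\<integral>\<^sup>+x. \<rho> x * indicator A x \<partial>M)" by (rule ge) (auto simp: A_def)
  finally have "(\<integral>\<^sup>+x. (ennreal c - \<rho> x) * indicator A x \<partial>M) = 0"
    using fin by (metis add.commute add_0 ennreal_add_left_cancel_le infinity_ennreal_def le_zero_eq)
  then have "AE x in M. (ennreal c - \<rho> x) * indicator A x = 0" by (subst (asm) nn_integral_0_iff_AE) auto
  then show ?thesis
    by (rule AE_mp) (auto intro!: AE_I2 simp: A_def indicator_def not_le diff_eq_0_iff_ennreal split: if_splits)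
qed

text \<open>Writing the measure as r dx on the cube, the coefficients of G with respect to it are
  the ordinary Fourier coefficients of r G, whose squares sum to the integral of r^2 |G|^2. As r
  lies in [c1, c2] on \<open>J\<close> and is 0 elsewhere, c1 r <= r^2 <= c2 r almost everywhere,
  which compares this with the integral of r |G|^2.\<close>

theorem weighted_Parseval:
  fixes \<sigma> :: "'e::euclidean_space measure" and G :: "'e \<Rightarrow> complex"
  assumes sets: "sets \<sigma> = sets borel" and J: "J \<in> sets borel" "J \<subseteq> box 0 One" and c: "0 < c1" "c1 \<le> (c2::real)"
    and upper: "\<And>A. A \<in> sets borel \<Longrightarrow> emeasure \<sigma> A \<le> ennreal c2 * emeasure lborel (A \<inter> J)"
    and lower: "\<And>A. A \<in> sets borel \<Longrightarrow> ennreal c1 * emeasure lborel (A \<inter> J) \<le> emeasure \<sigma> A"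
    and G: "G \<in> borel_measurable borel" "integrable \<sigma> (\<lambda>x. (cmod (G x))\<^sup>2)"
  obtains s where "((\<lambda>k. (cmod (LINT x|\<sigma>. G x * cnj (char_fun k x)))\<^sup>2) has_sum s) int_lattice"
    "c1 * (LINT x|\<sigma>. (cmod (G x))\<^sup>2) \<le> s" "s \<le> c2 * (LINT x|\<sigma>. (cmod (G x))\<^sup>2)"
proof -
  let ?U = "unit_cube :: 'e measure"
  interpret finite_measure ?U by (rule finite_measure_unit_cube)
  have J': "A \<inter> J \<inter> box 0 One = A \<inter> J" for A using J(2) by auto
  have ac: "absolutely_continuous ?U \<sigma>" unfolding absolutely_continuous_def
  proof
    fix A assume "A \<in> null_sets ?U"
    then have A: "A \<in> sets borel" "emeasure lborel (A \<inter> box 0 One) = 0"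
      by (auto simp: null_sets_def emeasure_unit_cube)
    have "emeasure lborel (A \<inter> J) \<le> emeasure lborel (A \<inter> box 0 One)"
      using A J by (intro emeasure_mono) auto
    then have "emeasure \<sigma> A \<le> 0" using upper[OF A(1)] A(2) by simp
    then show "A \<in> null_sets \<sigma>" using A sets by auto
  qed
  then obtain \<rho> where \<rho>[measurable]: "\<rho> \<in> borel_measurable ?U" and dens: "density ?U \<rho> = \<sigma>"
    using Radon_Nikodym[OF ac] sets by auto
  have int: "(\<integral>\<^sup>+x. \<rho> x * indicator A x \<partial>?U) = emeasure \<sigma> A" if "A \<in> sets borel" for A
    using that unfolding dens[symmetric] by (subst emeasure_density) auto
  have "emeasure lborel J = emeasure ?U J"
    using J by (subst emeasure_unit_cube) (auto simp: Int_absorb2)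
  also have "\<dots> \<le> emeasure ?U UNIV" using J by (intro emeasure_mono) auto
  finally have "emeasure lborel J \<le> 1" by (simp add: prob_unit_cube)
  then have "ennreal c2 * emeasure lborel J < \<infinity>"
    by (metis ennreal_less_top ennreal_mult_less_top ennreal_one_less_top infinity_ennreal_def le_less_trans)
  then have "emeasure \<sigma> UNIV < \<infinity>" using upper[of UNIV] by (auto intro: le_less_trans)
  then have fin\<rho>: "(\<integral>\<^sup>+x. \<rho> x \<partial>?U) < \<infinity>" using int[of UNIV] by simp
  have 1: "AE x in ?U. x \<in> UNIV \<longrightarrow> \<rho> x \<le> ennreal c2"
  proof (rule AE_density_le[OF finite_measure_unit_cube \<rho>])
    fix A :: "'e set" assume "A \<in> sets ?U"
    then have A: "A \<in> sets borel" by simp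
    have "emeasure lborel (A \<inter> J) \<le> emeasure ?U A"
      using A J by (subst emeasure_unit_cube) (auto intro!: emeasure_mono)
    then have "ennreal c2 * emeasure lborel (A \<inter> J) \<le> ennreal c2 * emeasure ?U A" by (rule mult_left_mono) simp
    then show "(\<integral>\<^sup>+x. \<rho> x * indicator A x \<partial>?U) \<le> ennreal c2 * emeasure ?U A"
      unfolding int[OF A] using upper[OF A] by simp
  qed (use c in auto)
  have 2: "AE x in ?U. x \<in> J \<longrightarrow> ennreal c1 \<le> \<rho> x"
  proof (rule AE_density_ge[OF finite_measure_unit_cube \<rho> _ _ fin\<rho>])
    fix A :: "'e set" assume "A \<in> sets ?U" "A \<subseteq> J"
    then have A: "A \<in> sets borel" "A \<inter> J = A" "A \<inter> box 0 One = A" using J by auto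
    show "ennreal c1 * emeasure ?U A \<le> (\<integral>\<^sup>+x. \<rho> x * indicator A x \<partial>?U)"
      unfolding int[OF A(1)] using lower[OF A(1)] A by (simp add: emeasure_unit_cube)
  qed (use J in auto)
  \<comment> \<open>The upper estimate gives measure 0 to sets disjoint from \<open>J\<close>; the
    density lemma with constant 0 then makes the density vanish there.\<close>
  have 3: "AE x in ?U. x \<in> - J \<longrightarrow> \<rho> x \<le> ennreal 0"
  proof (rule AE_density_le[OF finite_measure_unit_cube \<rho>])
    fix A :: "'e set" assume "A \<in> sets ?U" "A \<subseteq> - J"
    then have A: "A \<in> sets borel" "A \<inter> J = {}" by auto
    show "(\<integral>\<^sup>+x. \<rho> x * indicator A x \<partial>?U) \<le> ennreal 0 * emeasure ?U A"
      unfolding int[OF A(1)] using upper[OF A(1)] A(2) by simp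
  qed (use J in auto)
  define r where "r x = enn2real (\<rho> x)" for x
  have r[measurable]: "r \<in> borel_measurable ?U" unfolding r_def by measurable
  have r0: "r x \<ge> 0" for x by (simp add: r_def)
  have \<rho>r: "AE x in ?U. \<rho> x = ennreal (r x)"
    using 1 by eventually_elim (auto simp: r_def ennreal_enn2real_if top_unique)
  have \<sigma>: "\<sigma> = density ?U (\<lambda>x. ennreal (r x))"
    unfolding dens[symmetric] using \<rho>r by (intro density_cong) auto
  have bounds: "AE x in ?U. c1 * r x \<le> (r x)\<^sup>2 \<and> (r x)\<^sup>2 \<le> c2 * r x"
    using 1 2 3 \<rho>r
  proof eventually_elim
    case (elim x)
    have "r x \<le> c2" using elim c by simp
    moreover have "r x = 0 \<or> c1 \<le> r x"
      using elim r0[of x] c by (cases "x \<in> J") (auto simp: ennreal_eq_0_iff)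
    ultimately show ?case using r0[of x] by (auto simp: power2_eq_square intro: mult_right_mono)
  qed
  have m: "borel_measurable ?U = borel_measurable borel" by (rule measurable_cong_sets) auto
  have Gm[measurable]: "G \<in> borel_measurable ?U" unfolding m by (rule G(1))
  let ?F = "\<lambda>x. of_real (r x) * G x"
  have rG: "integrable ?U (\<lambda>x. r x * (cmod (G x))\<^sup>2)"
    using G(2) unfolding \<sigma> by (subst (asm) integrable_density) (use r0 in auto)
  have I: "(LINT x|\<sigma>. (cmod (G x))\<^sup>2) = (LINT x|?U. r x * (cmod (G x))\<^sup>2)"
    unfolding \<sigma> by (subst integral_density) (use r0 in auto)
  have F2: "integrable ?U (\<lambda>x. (cmod (?F x))\<^sup>2)"
  proof (rule Bochner_Integration.integrable_bound[OF integrable_mult_right[OF rG, of c2]])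
    show "AE x in ?U. norm ((cmod (?F x))\<^sup>2) \<le> norm (c2 * (r x * (cmod (G x))\<^sup>2))"
      using bounds
    proof eventually_elim
      case (elim x)
      then have "(r x)\<^sup>2 * (cmod (G x))\<^sup>2 \<le> (c2 * r x) * (cmod (G x))\<^sup>2" by (intro mult_right_mono) auto
      then show ?case using c r0[of x] by (simp add: norm_mult power_mult_distrib mult.assoc)
    qed
  qed measurable
  have coef: "(LINT x|\<sigma>. G x * cnj (char_fun k x)) = (LINT x|?U. ?F x * cnj (char_fun k x))" for k
  proof -
    have [measurable]: "char_fun k \<in> borel_measurable ?U" unfolding m by measurable
    show ?thesis unfolding \<sigma> by (subst integral_density) (use r0 in \<open>auto simp: scaleR_conv_of_real mult.assoc\<close>)
  qed
  have "((\<lambda>k. (cmod (LINT x|?U. ?F x * cnj (char_fun k x)))\<^sup>2) has_sum (LINT x|?U. (cmod (?F x))\<^sup>2)) int_lattice"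
    by (rule Parseval_unit_cube[OF _ F2]) (simp add: m[symmetric])
  moreover have "c1 * (LINT x|\<sigma>. (cmod (G x))\<^sup>2) \<le> (LINT x|?U. (cmod (?F x))\<^sup>2)"
    unfolding I Bochner_Integration.integral_mult_right_zero[symmetric]
  proof (rule integral_mono_AE)
    show "AE x in ?U. c1 * (r x * (cmod (G x))\<^sup>2) \<le> (cmod (?F x))\<^sup>2"
      using bounds
    proof eventually_elim
      case (elim x)
      then have "(c1 * r x) * (cmod (G x))\<^sup>2 \<le> (r x)\<^sup>2 * (cmod (G x))\<^sup>2" by (intro mult_right_mono) auto
      then show ?case by (simp add: norm_mult power_mult_distrib mult.assoc)
    qed
  qed (use rG F2 in auto)
  moreover have "(LINT x|?U. (cmod (?F x))\<^sup>2) \<le> c2 * (LINT x|\<sigma>. (cmod (G x))\<^sup>2)"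
    unfolding I Bochner_Integration.integral_mult_right_zero[symmetric]
  proof (rule integral_mono_AE)
    show "AE x in ?U. (cmod (?F x))\<^sup>2 \<le> c2 * (r x * (cmod (G x))\<^sup>2)"
      using bounds
    proof eventually_elim
      case (elim x)
      then have "(r x)\<^sup>2 * (cmod (G x))\<^sup>2 \<le> (c2 * r x) * (cmod (G x))\<^sup>2" by (intro mult_right_mono) auto
      then show ?case by (simp add: norm_mult power_mult_distrib mult.assoc)
    qed
  qed (use rG F2 in auto)
  ultimately show thesis using that coef by simp
qed

subsection \<open>Haar measure\<close>

lemma emeasure_differentiable_image_le:
  fixes f :: "real^'n::{finite,wellorder} \<Rightarrow> real^'n::_"
  assumes S: "S \<in> sets borel" "bounded S" and im: "f ` S \<in> sets borel"
    and der: "\<And>x. x \<in> S \<Longrightarrow> (f has_derivative f' x) (at x)"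
    and B: "\<And>x. x \<in> S \<Longrightarrow> \<bar>det (matrix (f' x))\<bar> \<le> B" "B \<ge> 0"
  shows "emeasure lborel (f ` S) \<le> ennreal B * emeasure lborel S"
proof -
  have Sl: "S \<in> lmeasurable" using S by (intro bounded_set_imp_lmeasurable) auto
  have der': "(f has_derivative f' x) (at x within S)" if "x \<in> S" for x
    using der[OF that] by (rule has_derivative_at_withinI)
  have "(\<lambda>x. \<bar>det (matrix (f' x))\<bar>) integrable_on S"
  proof (rule measurable_bounded_by_integrable_imp_integrable[where g = "\<lambda>_. B"])
    have "(\<lambda>x. det (matrix (f' x))) \<in> borel_measurable (lebesgue_on S)"
      by (rule borel_measurable_det_Jacobian) (use Sl der' in auto)
    then show "(\<lambda>x. \<bar>det (matrix (f' x))\<bar>) \<in> borel_measurable (lebesgue_on S)" by measurable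
    show "(\<lambda>_. B) integrable_on S" using Sl by (rule integrable_on_const)
  qed (use Sl B in auto)
  note * = Sl der' this B(1)
  have l: "f ` S \<in> lmeasurable" by (rule measurable_bounded_differentiable_image[OF *])
  have m: "measure lebesgue (f ` S) \<le> B * measure lebesgue S"
    by (rule measure_bounded_differentiable_image[OF *])
  have "emeasure lborel (f ` S) = emeasure lebesgue (f ` S)" using im by simp
  also have "\<dots> = ennreal (measure lebesgue (f ` S))" using l by (simp add: emeasure_eq_measure2)
  also have "\<dots> \<le> ennreal (B * measure lebesgue S)" using m by (rule ennreal_leI)
  also have "\<dots> = ennreal B * emeasure lebesgue S"
    using Sl B(2) by (simp add: ennreal_mult emeasure_eq_measure2)
  also have "emeasure lebesgue S = emeasure lborel S" using S by simp
  finally show ?thesis .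
qed

locale haar = lie G A for G :: "('a::{t2_space, second_countable_topology}) monoid" (structure)
    and A :: "('a, 'g::finite_dim_normed) atlas" +
  fixes \<mu> :: "'a measure"
  assumes haar: "left_haar_measure G \<mu>"
begin

lemma space_mu [simp]: "space \<mu> = carrier G"
  and sets_mu: "sets \<mu> = sets (restrict_space borel (carrier G))"
  and haar_translate: "h \<in> carrier G \<Longrightarrow> E \<in> sets \<mu> \<Longrightarrow> emeasure \<mu> (h <# E) = emeasure \<mu> E"
  and haar_compact: "K \<subseteq> carrier G \<Longrightarrow> compact K \<Longrightarrow> emeasure \<mu> K < \<infinity>"
  and haar_nonzero: "emeasure \<mu> (carrier G) \<noteq> 0"
  using haar unfolding left_haar_measure_def by auto

abbreviation nbhd :: "'a set \<Rightarrow> bool" where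
  "nbhd U \<equiv> openin (top_of_set (carrier G)) U \<and> \<one> \<in> U"

lemma sets_muE:
  assumes "B \<in> sets \<mu>"
  obtains B0 where "B0 \<in> sets borel" "B = carrier G \<inter> B0"
  using assms unfolding sets_mu sets_restrict_space by auto

lemma sets_muI: "B0 \<in> sets borel \<Longrightarrow> carrier G \<inter> B0 \<in> sets \<mu>"
  unfolding sets_mu sets_restrict_space by auto

lemma sets_mu_subset: "B \<in> sets \<mu> \<Longrightarrow> B \<subseteq> carrier G"
  using sets.sets_into_space by fastforce

lemma open_sets_mu: "openin (top_of_set (carrier G)) U \<Longrightarrow> U \<in> sets \<mu>"
  using sets_muI by (auto simp: openin_open)

lemma compact_sets_mu: "K \<subseteq> carrier G \<Longrightarrow> compact K \<Longrightarrow> K \<in> sets \<mu>"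
  using sets_muI[of K] by (simp add: Int_absorb1 compact_imp_closed)

lemma continuous_measurable_mu:
  fixes f :: "'a \<Rightarrow> 'b::topological_space"
  shows "continuous_on (carrier G) f \<Longrightarrow> f \<in> measurable \<mu> borel"
  using borel_measurable_continuous_on_restrict sets_mu measurable_cong_sets by blast

lemma measurable_into_mu:
  assumes "f \<in> measurable M borel" "f ` space M \<subseteq> carrier G"
  shows "f \<in> measurable M \<mu>"
proof -
  have "f \<in> measurable M (restrict_space borel (carrier G))"
    using assms by (intro measurable_restrict_space2) auto
  then show ?thesis using sets_mu measurable_cong_sets by blast
qed

lemma continuous_mult: "continuous_on (carrier G \<times> carrier G) (\<lambda>p. fst p \<otimes> snd p)"
  using lie_group smooth_mapD(2)[of "prod_atlas A A" A "\<lambda>(x, y). x \<otimes> y"]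
  unfolding lie_group_def by (simp add: points_prod_atlas case_prod_beta)

lemma continuous_inv: "continuous_on (carrier G) (\<lambda>x. inv x)"
  using lie_group smooth_mapD(2)[of A A "\<lambda>x. inv x"] unfolding lie_group_def by simp

lemma continuous_on_mult:
  assumes "continuous_on S f" "continuous_on S g" "f ` S \<subseteq> carrier G" "g ` S \<subseteq> carrier G"
  shows "continuous_on S (\<lambda>x. f x \<otimes> g x)"
  using continuous_on_compose2[OF continuous_mult continuous_on_Pair[OF assms(1,2)]] assms(3,4) by auto

lemma continuous_on_inv:
  assumes "continuous_on S f" "f ` S \<subseteq> carrier G"
  shows "continuous_on S (\<lambda>x. inv (f x))"
  using continuous_on_compose2[OF continuous_inv assms] .

lemma measurable_mult: "(\<lambda>p. fst p \<otimes> snd p) \<in> measurable (\<mu> \<Otimes>\<^sub>M \<mu>) \<mu>"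
proof (rule measurable_into_mu)
  have id: "(\<lambda>x. x) \<in> measurable \<mu> borel" by (intro continuous_measurable_mu continuous_on_id)
  have "(\<lambda>p. (fst p, snd p)) \<in> measurable (\<mu> \<Otimes>\<^sub>M \<mu>) (borel \<Otimes>\<^sub>M borel)"
    using measurable_compose[OF measurable_fst id] measurable_compose[OF measurable_snd id]
    by (rule measurable_Pair)
  then have "(\<lambda>p. p) \<in> measurable (\<mu> \<Otimes>\<^sub>M \<mu>) (restrict_space (borel :: ('a \<times> 'a) measure) (carrier G \<times> carrier G))"
    unfolding borel_prod by (intro measurable_restrict_space2) (auto simp: space_pair_measure)
  from measurable_compose[OF this borel_measurable_continuous_on_restrict[OF continuous_mult]]
  show "(\<lambda>p. fst p \<otimes> snd p) \<in> borel_measurable (\<mu> \<Otimes>\<^sub>M \<mu>)" .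
qed (auto simp: space_pair_measure)

lemma measurable_left: "h \<in> carrier G \<Longrightarrow> (\<lambda>x. h \<otimes> x) \<in> measurable \<mu> \<mu>"
  by (intro measurable_into_mu continuous_measurable_mu continuous_on_mult continuous_on_const continuous_on_id) auto

lemma left_vimage: "h \<in> carrier G \<Longrightarrow> E \<subseteq> carrier G \<Longrightarrow> (\<lambda>x. h \<otimes> x) -` E \<inter> carrier G = inv h <# E"
  unfolding l_coset_def
proof safe
  fix x assume "h \<in> carrier G" "E \<subseteq> carrier G" "h \<otimes> x \<in> E" "x \<in> carrier G"
  then show "x \<in> (\<Union>y\<in>E. {inv h \<otimes> y})" by (auto intro!: bexI[of _ "h \<otimes> x"] simp: m_assoc[symmetric])
qed (auto simp: m_assoc[symmetric])

lemma distr_left: "h \<in> carrier G \<Longrightarrow> distr \<mu> \<mu> (\<lambda>x. h \<otimes> x) = \<mu>"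
proof (rule measure_eqI)
  fix E assume h: "h \<in> carrier G" and "E \<in> sets (distr \<mu> \<mu> (\<lambda>x. h \<otimes> x))"
  then have E: "E \<in> sets \<mu>" by simp
  then have "emeasure (distr \<mu> \<mu> (\<lambda>x. h \<otimes> x)) E = emeasure \<mu> (inv h <# E)"
    using h by (simp add: emeasure_distr measurable_left left_vimage sets_mu_subset)
  then show "emeasure (distr \<mu> \<mu> (\<lambda>x. h \<otimes> x)) E = emeasure \<mu> E" using E h by (simp add: haar_translate)
qed simp

lemma open_translate:
  assumes "openin (top_of_set (carrier G)) U" "h \<in> carrier G"
  shows "openin (top_of_set (carrier G)) (h <# U)"
proof -
  have U: "U \<subseteq> carrier G" using openin_imp_subset[OF assms(1)] .
  have "openin (top_of_set (carrier G)) (carrier G \<inter> (\<lambda>x. inv h \<otimes> x) -` U)"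
    by (rule continuous_openin_preimage[OF _ _ assms(1)])
       (use assms(2) in \<open>auto intro!: continuous_on_mult continuous_on_const continuous_on_id\<close>)
  moreover have "carrier G \<inter> (\<lambda>x. inv h \<otimes> x) -` U = h <# U"
    using left_vimage[of "inv h" U] assms(2) U by (simp add: Int_commute)
  ultimately show ?thesis by simp
qed

text \<open>Translates of a nonempty open set cover the group, and by the Lindelof property
  countably many suffice. Were they null, so would be the whole group.\<close>

lemma haar_open_pos:
  assumes U: "openin (top_of_set (carrier G)) U" "x \<in> U"
  shows "emeasure \<mu> U > 0"
proof (rule ccontr)
  assume "\<not> emeasure \<mu> U > 0"
  then have 0: "emeasure \<mu> U = 0" by (simp add: zero_less_iff_neq_zero)
  have Us: "U \<subseteq> carrier G" using openin_imp_subset[OF U(1)] .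
  let ?F = "(\<lambda>h. h <# U) ` carrier G"
  obtain F' where F': "F' \<subseteq> ?F" "countable F'" "\<Union>F' = \<Union>?F"
    using Lindelof_openin[of ?F "carrier G"] open_translate[OF U(1)] by auto
  have "\<Union>?F = carrier G"
  proof
    show "carrier G \<subseteq> \<Union>?F"
    proof
      fix y assume y: "y \<in> carrier G"
      then have "y = (y \<otimes> inv x) \<otimes> x" using U(2) Us by (auto simp: m_assoc)
      then have "y \<in> (y \<otimes> inv x) <# U" unfolding l_coset_def using U(2) by blast
      then show "y \<in> \<Union>?F" using y U(2) Us by auto
    qed
  qed (use Us in \<open>auto simp: l_coset_def\<close>)
  moreover have "\<Union>F' \<in> null_sets \<mu>"
  proof -
    have "V \<in> null_sets \<mu>" if "V \<in> F'" for V
    proof -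
      from F'(1) that have "V \<in> ?F" by (rule subsetD)
      then obtain h where "V = h <# U" "h \<in> carrier G" by (rule imageE)
      then show ?thesis using haar_translate[of h U] open_sets_mu[OF U(1)] open_sets_mu[OF open_translate[OF U(1)]] 0
        by auto
    qed
    then have "(\<Union>V\<in>F'. V) \<in> null_sets \<mu>" by (intro null_sets_UN' F'(2)) auto
    then show ?thesis by simp
  qed
  ultimately show False using F'(3) haar_nonzero by auto
qed

section \<open>Shrinking neighbourhoods of the identity\<close>

lemma nbhd_product:
  assumes "continuous_on (carrier G \<times> carrier G) f" "f (\<one>, \<one>) = \<one>" "f ` (carrier G \<times> carrier G) \<subseteq> carrier G" "nbhd U"
  obtains V where "nbhd V" "\<And>x y. x \<in> V \<Longrightarrow> y \<in> V \<Longrightarrow> f (x, y) \<in> U"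
proof -
  let ?C = "carrier G"
  have "openin (top_of_set (?C \<times> ?C)) ((?C \<times> ?C) \<inter> f -` U)"
    by (rule continuous_openin_preimage[OF assms(1) _ conjunct1[OF assms(4)]]) (use assms(3) in auto)
  then obtain T where T: "open T" "(?C \<times> ?C) \<inter> f -` U = (?C \<times> ?C) \<inter> T" by (auto simp: openin_open)
  have "(\<one>, \<one>) \<in> (?C \<times> ?C) \<inter> f -` U" using assms by auto
  then have "(\<one>, \<one>) \<in> T" using T by auto
  then obtain A B where AB: "open A" "open B" "(\<one>, \<one>) \<in> A \<times> B" "A \<times> B \<subseteq> T"
    using open_prod_elim[OF T(1)] by blast
  show thesis
  proof (rule that[of "?C \<inter> (A \<inter> B)"])
    show "nbhd (?C \<inter> (A \<inter> B))" using AB by (auto intro: openin_open_Int)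
    fix x y assume "x \<in> ?C \<inter> (A \<inter> B)" "y \<in> ?C \<inter> (A \<inter> B)"
    then have "(x, y) \<in> (?C \<times> ?C) \<inter> T" using AB by auto
    then show "f (x, y) \<in> U" using T(2) by auto
  qed
qed

lemma nbhd_Int: "nbhd U \<Longrightarrow> nbhd V \<Longrightarrow> nbhd (U \<inter> V)"
  by auto

lemma nbhd_subset: "nbhd U \<Longrightarrow> U \<subseteq> carrier G"
  by (auto dest: openin_imp_subset)

lemma continuous_fst_on: "continuous_on S fst" and continuous_snd_on: "continuous_on S snd"
  by (auto intro: continuous_on_fst continuous_on_snd continuous_on_id)

text \<open>Bundles the inverse, the product and both one-sided quotients, so that one existence
  statement serves every later shrinking.\<close>

definition quotient_nbhd :: "'a set \<Rightarrow> 'a set \<Rightarrow> bool" where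
  "quotient_nbhd U V \<longleftrightarrow> nbhd V \<and> V \<subseteq> U \<and> (\<forall>x\<in>V. inv x \<in> U) \<and>
    (\<forall>x\<in>V. \<forall>y\<in>V. x \<otimes> y \<in> U \<and> inv x \<otimes> y \<in> U \<and> x \<otimes> inv y \<in> U)"

lemma quotient_nbhdD:
  assumes "quotient_nbhd U V"
  shows "nbhd V" "V \<subseteq> U" "x \<in> V \<Longrightarrow> inv x \<in> U" "x \<in> V \<Longrightarrow> y \<in> V \<Longrightarrow> x \<otimes> y \<in> U"
    "x \<in> V \<Longrightarrow> y \<in> V \<Longrightarrow> inv x \<otimes> y \<in> U" "x \<in> V \<Longrightarrow> y \<in> V \<Longrightarrow> x \<otimes> inv y \<in> U"
  using assms unfolding quotient_nbhd_def by auto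

lemma quotient_nbhd_exists:
  assumes "nbhd U"
  shows "\<exists>V. quotient_nbhd U V"
proof -
  obtain V1 where V1: "nbhd V1" "\<And>x y. x \<in> V1 \<Longrightarrow> y \<in> V1 \<Longrightarrow> fst (x, y) \<otimes> snd (x, y) \<in> U"
    by (rule nbhd_product[OF continuous_mult _ _ assms]) auto
  obtain V2 where V2: "nbhd V2" "\<And>x y. x \<in> V2 \<Longrightarrow> y \<in> V2 \<Longrightarrow> inv (fst (x, y)) \<otimes> snd (x, y) \<in> U"
    by (rule nbhd_product[of "\<lambda>p. inv (fst p) \<otimes> snd p", OF _ _ _ assms])
       (auto intro!: continuous_on_mult continuous_on_inv continuous_fst_on continuous_snd_on)
  obtain V3 where V3: "nbhd V3" "\<And>x y. x \<in> V3 \<Longrightarrow> y \<in> V3 \<Longrightarrow> fst (x, y) \<otimes> inv (snd (x, y)) \<in> U"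
    by (rule nbhd_product[of "\<lambda>p. fst p \<otimes> inv (snd p)", OF _ _ _ assms])
       (auto intro!: continuous_on_mult continuous_on_inv continuous_fst_on continuous_snd_on)
  let ?V = "V1 \<inter> V2 \<inter> V3"
  have V: "nbhd ?V" using V1 V2 V3 by auto
  have sub: "?V \<subseteq> carrier G" using nbhd_subset[OF V] .
  have o: "\<one> \<in> ?V" using V by auto
  have "quotient_nbhd U ?V" unfolding quotient_nbhd_def
  proof (intro conjI ballI)
    fix x y assume "x \<in> ?V" "y \<in> ?V"
    then show "x \<otimes> y \<in> U" "inv x \<otimes> y \<in> U" "x \<otimes> inv y \<in> U"
      using V1(2)[of x y] V2(2)[of x y] V3(2)[of x y] by auto
  next
    show "?V \<subseteq> U" using V1(2)[OF _ , of _ \<one>] o sub by fastforce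
    show "inv x \<in> U" if "x \<in> ?V" for x using V2(2)[of x \<one>] that o sub by fastforce
  qed (use V in auto)
  then show ?thesis by blast
qed

text \<open>Comparison of Haar measure and Lebesgue measure in a chart: the set
  \<open>{(x, y). x \<in> W, x \<otimes> y \<in> B}\<close> is measured in both orders.  Left invariance evaluates the sections in
  one direction, and right translations distort Lebesgue measure by bounded factors only.\<close>

lemma haar_lebesgue:
  fixes \<psi> :: "'a \<Rightarrow> real^'n::{finite,wellorder}" and \<psi>i :: "real^'n::{finite,wellorder} \<Rightarrow> 'a"
    and M1 :: "(real^'n::{finite,wellorder}) \<times> (real^'n::{finite,wellorder}) \<Rightarrow> real^'n::{finite,wellorder} \<Rightarrow> real^'n::{finite,wellorder}"
  assumes V: "nbhd V" and hom: "homeomorphism V (\<psi> ` V) \<psi> \<psi>i" and oV: "open (\<psi> ` V)"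
    and D: "D = {(u, v). u \<in> \<psi> ` V \<and> v \<in> \<psi> ` V \<and> \<psi>i u \<otimes> \<psi>i v \<in> V}"
    and der: "\<And>u v. (u, v) \<in> D \<Longrightarrow> ((\<lambda>u. \<psi> (\<psi>i u \<otimes> \<psi>i v)) has_derivative M1 (u, v)) (at u)"
    and cont: "\<And>a. continuous_on D (\<lambda>p. M1 p a)"
  obtains P c1 c2 where "nbhd P" "P \<subseteq> V" "0 < c1" "0 < (c2::real)" "emeasure \<mu> P < \<infinity>"
    "\<forall>B\<in>sets \<mu>. B \<subseteq> P \<longrightarrow> \<psi> ` B \<in> sets borel \<and> emeasure lborel (\<psi> ` B) < \<infinity> \<and>
      ennreal c1 * emeasure lborel (\<psi> ` B) \<le> emeasure \<mu> B \<and> emeasure \<mu> B \<le> ennreal c2 * emeasure lborel (\<psi> ` B)"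
proof -
  have \<psi>: "\<psi>i (\<psi> x) = x" if "x \<in> V" for x using hom that by (simp add: homeomorphism_def)
  have c\<psi>: "continuous_on V \<psi>" "continuous_on (\<psi> ` V) \<psi>i" using hom by (auto simp: homeomorphism_def)
  have V1: "V \<subseteq> carrier G" "\<one> \<in> V" using V nbhd_subset by auto
  have imgV: "\<psi> ` (V \<inter> X) = \<psi>i -` X \<inter> \<psi> ` V" for X using \<psi> by auto
  have borel: "\<psi> ` B \<in> sets borel" if B: "B \<in> sets \<mu>" "B \<subseteq> V" for B
  proof -
    obtain B0 where B0: "B0 \<in> sets borel" "B = carrier G \<inter> B0" using B(1) by (rule sets_muE)
    have "\<psi>i \<in> measurable (restrict_space borel (\<psi> ` V)) borel"
      using c\<psi>(2) by (rule borel_measurable_continuous_on_restrict)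
    from measurable_sets[OF this B0(1)] have "\<psi>i -` B0 \<inter> \<psi> ` V \<in> sets borel"
      using oV by (simp add: space_restrict_space sets_restrict_space_iff)
    moreover have "B = V \<inter> B0" using B0(2) B(2) V1(1) by auto
    ultimately show ?thesis by (simp add: imgV)
  qed
  have opn: "open (\<psi> ` U)" if "openin (top_of_set (carrier G)) U" "U \<subseteq> V" for U
  proof -
    from that(1) obtain T where T: "open T" "U = carrier G \<inter> T" by (auto simp: openin_open)
    have "U = V \<inter> T" using that(2) T(2) V1(1) by auto
    then have "\<psi> ` U = \<psi> ` V \<inter> \<psi>i -` T" using imgV[of T] by blast
    then show ?thesis using continuous_open_preimage[OF c\<psi>(2) oV T(1)] by simp
  qed
  have nb: "nbhd (V \<inter> \<psi> -` T)" if "open T" "\<psi> \<one> \<in> T" for T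
  proof -
    have "openin (top_of_set V) (V \<inter> \<psi> -` T)" using continuous_openin_preimage_gen[OF c\<psi>(1) that(1)] .
    then show ?thesis using V V1(2) that(2) openin_trans by blast
  qed
  define \<delta> where "\<delta> p = \<bar>det (matrix (M1 p))\<bar>" for p
  have c\<delta>: "continuous_on D \<delta>"
    unfolding \<delta>_def det_def matrix_def by (simp, intro continuous_intros cont)
  let ?u = "\<psi> \<one>"
  \<comment> \<open>By continuity the Jacobian of right translation near the identity stays below
    its value there plus 1; the summand also makes \<open>C\<close> positive.\<close>
  define C where "C = \<delta> (?u, ?u) + 1"
  have C: "C > 0" by (simp add: C_def \<delta>_def add_nonneg_pos)
  obtain P1 where P1: "nbhd P1" "P1 \<subseteq> V" "bounded (\<psi> ` P1)"
    and \<delta>: "\<And>x y. x \<in> P1 \<Longrightarrow> y \<in> P1 \<Longrightarrow> x \<otimes> y \<in> V \<and> \<delta> (\<psi> x, \<psi> y) \<le> C"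
  proof -
    obtain P0 where "quotient_nbhd V P0" using quotient_nbhd_exists[OF V] by (rule exE)
    note P0 = quotient_nbhdD(1,2)[OF this] and PV = quotient_nbhdD(4)[OF this]
    let ?S = "\<psi> ` P0 \<times> \<psi> ` P0"
    have inD: "(\<psi> x, \<psi> y) \<in> D" if "x \<in> P0" "y \<in> P0" for x y
    proof -
      have "x \<in> V" "y \<in> V" "x \<otimes> y \<in> V" using that P0(2) PV by auto
      then show ?thesis unfolding D by (simp add: \<psi>)
    qed
    have SD: "?S \<subseteq> D"
    proof
      fix p assume "p \<in> ?S"
      then obtain x y where "x \<in> P0" "y \<in> P0" "p = (\<psi> x, \<psi> y)" by (elim SigmaE imageE) simp
      then show "p \<in> D" using inD by simp
    qed
    have oS: "open ?S" using opn P0 by (intro open_Times) auto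
    have "continuous_on ?S \<delta>" by (rule continuous_on_subset[OF c\<delta> SD])
    then have o: "open (?S \<inter> \<delta> -` {..<C})" using oS by (intro continuous_open_preimage) auto
    have i: "(?u, ?u) \<in> ?S \<inter> \<delta> -` {..<C}" using P0 by (auto simp: C_def)
    obtain T1 T2 where T: "open T1" "open T2" "(?u, ?u) \<in> T1 \<times> T2" "T1 \<times> T2 \<subseteq> ?S \<inter> \<delta> -` {..<C}"
      by (rule open_prod_elim[OF o i])
    let ?P = "P0 \<inter> (V \<inter> \<psi> -` (T1 \<inter> T2 \<inter> ball ?u 1))"
    show thesis
    proof (rule that[of ?P])
      have "nbhd (V \<inter> \<psi> -` (T1 \<inter> T2 \<inter> ball ?u 1))"
        by (rule nb) (use T in \<open>auto intro: open_Int\<close>)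
      then show "nbhd ?P" by (rule nbhd_Int[OF P0(1)])
      show "?P \<subseteq> V" by auto
      have "\<psi> ` ?P \<subseteq> ball ?u 1" by auto
      then show "bounded (\<psi> ` ?P)" by (rule bounded_subset[OF bounded_ball])
      fix x y assume xy: "x \<in> ?P" "y \<in> ?P"
      then have "(\<psi> x, \<psi> y) \<in> T1 \<times> T2" by auto
      then have "\<delta> (\<psi> x, \<psi> y) < C" using subsetD[OF T(4)] by auto
      then show "x \<otimes> y \<in> V \<and> \<delta> (\<psi> x, \<psi> y) \<le> C" using PV xy by auto
    qed
  qed
  have P1c: "P1 \<subseteq> carrier G" using nbhd_subset P1(1) by blast
  have rt_sets: "(\<lambda>x. x \<otimes> y) ` B \<in> sets \<mu>" if y: "y \<in> carrier G" and B: "B \<in> sets \<mu>" for y B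
  proof -
    have "(\<lambda>x. x \<otimes> inv y) \<in> measurable \<mu> \<mu>"
      using y by (intro measurable_into_mu continuous_measurable_mu continuous_on_mult continuous_on_const continuous_on_id) auto
    from measurable_sets[OF this B] have "(\<lambda>x. x \<otimes> inv y) -` B \<inter> carrier G \<in> sets \<mu>" by simp
    moreover have "(\<lambda>x. x \<otimes> inv y) -` B \<inter> carrier G = (\<lambda>x. x \<otimes> y) ` B"
    proof
      show "(\<lambda>x. x \<otimes> inv y) -` B \<inter> carrier G \<subseteq> (\<lambda>x. x \<otimes> y) ` B"
      proof
        fix x assume "x \<in> (\<lambda>x. x \<otimes> inv y) -` B \<inter> carrier G"
        then show "x \<in> (\<lambda>x. x \<otimes> y) ` B" using y by (auto intro!: image_eqI[of _ _ "x \<otimes> inv y"] simp: m_assoc)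
      qed
      show "(\<lambda>x. x \<otimes> y) ` B \<subseteq> (\<lambda>x. x \<otimes> inv y) -` B \<inter> carrier G"
        using y sets_mu_subset[OF B] by (auto simp: m_assoc subset_iff)
    qed
    ultimately show ?thesis by simp
  qed
  have right: "emeasure lborel (\<psi> ` ((\<lambda>x. x \<otimes> y) ` B)) \<le> ennreal C * emeasure lborel (\<psi> ` B)"
    if y: "y \<in> P1" and B: "B \<in> sets \<mu>" "B \<subseteq> P1" for y B
  proof -
    let ?f = "\<lambda>u. \<psi> (\<psi>i u \<otimes> \<psi>i (\<psi> y))"
    have yV: "y \<in> V" "y \<in> carrier G" using y P1 P1c by auto
    have eq: "?f ` (\<psi> ` B) = \<psi> ` ((\<lambda>x. x \<otimes> y) ` B)"
      using B P1(2) \<psi> yV by (auto simp: image_image subset_iff intro!: image_cong)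
    have "emeasure lborel (?f ` (\<psi> ` B)) \<le> ennreal C * emeasure lborel (\<psi> ` B)"
    proof (rule emeasure_differentiable_image_le)
      show "\<psi> ` B \<in> sets borel" using borel B P1 by auto
      show "bounded (\<psi> ` B)" using P1(3) B(2) bounded_subset by (metis image_mono)
      show "?f ` (\<psi> ` B) \<in> sets borel"
        unfolding eq using \<delta> y B by (intro borel rt_sets yV) auto
      fix u assume "u \<in> \<psi> ` B"
      then obtain x where x: "x \<in> B" "u = \<psi> x" by auto
      then have "x \<in> P1" using B by auto
      then have "x \<in> V" "x \<otimes> y \<in> V" using \<delta>[OF _ y] P1(2) by auto
      then have "(u, \<psi> y) \<in> D" unfolding D x(2) using yV(1) by (simp add: \<psi>)
      then show "(?f has_derivative M1 (u, \<psi> y)) (at u)" by (rule der)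
      show "\<bar>det (matrix (M1 (u, \<psi> y)))\<bar> \<le> C" using \<delta>[OF \<open>x \<in> P1\<close> y] by (simp add: \<delta>_def x)
    qed (use C in auto)
    then show ?thesis unfolding eq .
  qed
  \<comment> \<open>Elements of \<open>P2\<close> have inverses in \<open>P1\<close>, so the
    distortion bound also covers right translation by the inverse of such an element.\<close>
  obtain P2 where "quotient_nbhd P1 P2" using quotient_nbhd_exists[OF P1(1)] by (rule exE)
  note P2 = quotient_nbhdD(1,2,3)[OF this]
  \<comment> \<open>A coordinate ball inside the image of a compact ball, which gives finite Haar
    measure.\<close>
  obtain Q where Q: "nbhd Q" "Q \<subseteq> P2" "emeasure \<mu> Q < \<infinity>"
  proof -
    have "open (\<psi> ` P2)" using P2 P1 by (intro opn) auto
    moreover have "?u \<in> \<psi> ` P2" using P2 by auto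
    ultimately have "\<exists>\<epsilon>>0. cball ?u \<epsilon> \<subseteq> \<psi> ` P2" unfolding open_contains_cball by (rule bspec)
    then obtain \<epsilon> where \<epsilon>: "\<epsilon> > 0" "cball ?u \<epsilon> \<subseteq> \<psi> ` P2" by auto
    let ?K = "\<psi>i ` cball ?u \<epsilon>"
    have sub: "cball ?u \<epsilon> \<subseteq> \<psi> ` V" using \<epsilon>(2) image_mono[OF P2(2), of \<psi>] image_mono[OF P1(2), of \<psi>] by simp
    have K: "?K \<subseteq> P2"
    proof
      fix x assume "x \<in> ?K"
      then obtain u where u: "x = \<psi>i u" "u \<in> cball ?u \<epsilon>" by (rule imageE)
      from subsetD[OF \<epsilon>(2) u(2)] obtain y where "u = \<psi> y" "y \<in> P2" by (rule imageE)
      with u(1) have "x = \<psi>i (\<psi> y)" "y \<in> P2" by auto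
      then show "x \<in> P2" using \<psi>[of y] P2(2) P1(2) by auto
    qed
    have Kc: "?K \<subseteq> carrier G" using K P2(2) P1c by auto
    have "compact ?K" using c\<psi>(2) sub by (intro compact_continuous_image) (auto intro: continuous_on_subset)
    then have fin: "emeasure \<mu> ?K < \<infinity>" "?K \<in> sets \<mu>"
      by (rule haar_compact[OF Kc], rule compact_sets_mu[OF Kc])
    show thesis
    proof (rule that[of "V \<inter> \<psi> -` ball ?u \<epsilon>"])
      show "nbhd (V \<inter> \<psi> -` ball ?u \<epsilon>)" using \<epsilon> by (intro nb) auto
      have *: "V \<inter> \<psi> -` ball ?u \<epsilon> \<subseteq> ?K"
      proof
        fix x assume "x \<in> V \<inter> \<psi> -` ball ?u \<epsilon>"
        then have "x = \<psi>i (\<psi> x)" "\<psi> x \<in> cball ?u \<epsilon>" using \<psi>[of x] by auto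
        then show "x \<in> ?K" by (rule image_eqI)
      qed
      then show "V \<inter> \<psi> -` ball ?u \<epsilon> \<subseteq> P2" using K by (rule order_trans)
      show "emeasure \<mu> (V \<inter> \<psi> -` ball ?u \<epsilon>) < \<infinity>"
        using emeasure_mono[OF * fin(2)] fin(1) by (rule le_less_trans)
    qed
  qed
  \<comment> \<open>For x in \<open>W\<close> and B inside \<open>W\<close>, the translate x^-1 B
    stays in \<open>Q\<close>, so integrating over \<open>Q\<close> loses nothing of it. The set
    \<open>R\<close> chosen next has b y^-1 in \<open>W\<close> for b, y in \<open>R\<close>, so
    that a right translate of a subset of \<open>R\<close> is not truncated by
    \<open>W\<close>.\<close>
  obtain W where "quotient_nbhd Q W" using quotient_nbhd_exists[OF Q(1)] by (rule exE)
  note W = quotient_nbhdD(1,2,5)[OF this]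
  obtain R where "quotient_nbhd W R" using quotient_nbhd_exists[OF W(1)] by (rule exE)
  note R = quotient_nbhdD(1,2,6)[OF this]
  have sub: "R \<subseteq> W" "W \<subseteq> Q" "Q \<subseteq> P2" "P2 \<subseteq> P1" "P1 \<subseteq> V" "P1 \<subseteq> carrier G" "V \<subseteq> carrier G"
    using R W Q P2 P1 P1c V1 by auto
  have WV: "W \<subseteq> V" and QG: "Q \<subseteq> carrier G" and RP1: "R \<subseteq> P1" and RV: "R \<subseteq> V" and WP1: "W \<subseteq> P1" and QP1: "Q \<subseteq> P1" using sub by auto
  have WG: "W \<subseteq> carrier G" and RG: "R \<subseteq> carrier G" and RQ': "R \<subseteq> Q" using sub by auto
  have \<psi>W: "\<psi>i (\<psi> x) = x" if "x \<in> W" for x using that WV \<psi> by auto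
  let ?m = "emeasure lborel"
  have fin\<psi>: "?m (\<psi> ` B) < \<infinity>" if "B \<subseteq> P1" for B
    using P1(3) that by (metis bounded_subset emeasure_bounded_finite image_mono)
  have oW: "open (\<psi> ` W)" using W(1) WV by (intro opn) auto
  have mW: "?m (\<psi> ` W) > 0"
  proof -
    have "?u \<in> \<psi> ` W" using W(1) by auto
    then have "\<not> negligible (\<psi> ` W)" using oW open_not_negligible by fastforce
    then have "emeasure lebesgue (\<psi> ` W) \<noteq> 0"
      using oW by (simp add: negligible_iff_null_sets null_sets_def)
    then show ?thesis using oW by (simp add: zero_less_iff_neq_zero)
  qed
  \<comment> \<open>For fixed x the y-section is x^-1 B, of Haar measure that of B by left
    invariance. Integrated over \<open>W\<close> in Lebesgue measure this gives the left side; the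
    other order gives the right.\<close>
  have Tonelli: "?m (\<psi> ` W) * emeasure \<mu> B = (\<integral>\<^sup>+y. ?m (\<psi> ` {x \<in> W. x \<otimes> y \<in> B}) * indicator Q y \<partial>\<mu>)"
    if B: "B \<in> sets \<mu>" "B \<subseteq> W" for B
  proof -
    \<comment> \<open>Restriction to \<open>W\<close> and \<open>Q\<close> makes both measures
      finite, which justifies the interchange of integrals.\<close>
    let ?M1 = "restrict_space lborel (\<psi> ` W)" and ?M2 = "restrict_space \<mu> Q"
    have Wsets: "\<psi> ` W \<in> sets borel" using oW by simp
    have Qsets: "Q \<in> sets \<mu>" using Q(1) open_sets_mu by blast
    have sp1: "space ?M1 = \<psi> ` W" by (simp add: space_restrict_space)
    have sp2: "space ?M2 = Q" using QG by (simp add: space_restrict_space Int_absorb2)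
    have "finite_measure ?M1"
      using fin\<psi>[OF WP1] Wsets by (intro finite_measureI) (simp add: sp1 emeasure_restrict_space)
    then interpret M1: finite_measure ?M1 .
    have "finite_measure ?M2"
      using Q(3) Qsets QG by (intro finite_measureI) (simp add: sp2 emeasure_restrict_space Int_absorb2)
    then interpret M2: finite_measure ?M2 .
    interpret pair_sigma_finite ?M1 ?M2 ..
    define f :: "real^'n::{finite,wellorder} \<Rightarrow> 'a \<Rightarrow> ennreal" where "f u y = indicator B (\<psi>i u \<otimes> y)" for u y
    have "\<psi>i \<in> measurable (restrict_space borel (\<psi> ` W)) borel"
      using c\<psi>(2) WV by (intro borel_measurable_continuous_on_restrict) (auto intro: continuous_on_subset)
    then have "\<psi>i \<in> measurable ?M1 borel"
      using measurable_cong_sets[OF sets_restrict_space_cong[OF sets_lborel] refl] by blast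
    then have m1: "\<psi>i \<in> measurable ?M1 \<mu>"
      by (rule measurable_into_mu) (use WG in \<open>auto simp: sp1 \<psi>W\<close>)
    have m2: "(\<lambda>y. y) \<in> measurable ?M2 \<mu>" by (rule measurable_restrict_space1) simp
    have "(\<lambda>p. (\<psi>i (fst p), snd p)) \<in> measurable (?M1 \<Otimes>\<^sub>M ?M2) (\<mu> \<Otimes>\<^sub>M \<mu>)"
      using measurable_compose[OF measurable_fst m1] measurable_compose[OF measurable_snd m2]
      by (rule measurable_Pair)
    note prod_m = measurable_compose[OF this measurable_mult]
    have "(indicator B :: 'a \<Rightarrow> ennreal) \<in> borel_measurable \<mu>" using B(1) by (rule borel_measurable_indicator)
    note ind_m = measurable_compose[OF prod_m this]
    have "case_prod f = (\<lambda>p. indicator B (fst (\<psi>i (fst p), snd p) \<otimes> snd (\<psi>i (fst p), snd p)))"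
      by (rule ext) (simp add: f_def case_prod_beta)
    then have fm: "case_prod f \<in> borel_measurable (?M1 \<Otimes>\<^sub>M ?M2)" using ind_m by simp
    have inner1: "(\<integral>\<^sup>+y. f u y \<partial>?M2) = emeasure \<mu> B" if "u \<in> \<psi> ` W" for u
    proof -
      obtain x where x: "x \<in> W" "u = \<psi> x" using \<open>u \<in> \<psi> ` W\<close> by auto
      have xG: "x \<in> carrier G" "\<psi>i u = x" using x WG \<psi>W by auto
      have subQ: "inv x <# B \<subseteq> Q" using W(3)[OF x(1)] B(2) by (auto simp: l_coset_def)
      have "(\<integral>\<^sup>+y. f u y \<partial>?M2) = (\<integral>\<^sup>+y. f u y * indicator Q y \<partial>\<mu>)"
        by (rule nn_integral_restrict_space) (use Qsets QG in \<open>simp_all add: Int_absorb2\<close>)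
      also have "\<dots> = (\<integral>\<^sup>+y. indicator (inv x <# B) y \<partial>\<mu>)"
      proof (rule nn_integral_cong)
        fix y assume "y \<in> space \<mu>"
        then have "x \<otimes> y \<in> B \<longleftrightarrow> y \<in> inv x <# B"
          using left_vimage[OF xG(1) sets_mu_subset[OF B(1)]] by auto
        then show "f u y * indicator Q y = indicator (inv x <# B) y"
          using subQ by (auto simp: f_def xG indicator_def)
      qed
      also have "\<dots> = emeasure \<mu> (inv x <# B)"
        using left_vimage[OF xG(1) sets_mu_subset[OF B(1)]] measurable_sets[OF measurable_left[OF xG(1)] B(1)]
        by (intro nn_integral_indicator) simp
      also have "\<dots> = emeasure \<mu> B" using xG B by (simp add: haar_translate)
      finally show ?thesis .
    qed
    have inner2: "(\<integral>\<^sup>+u. f u y \<partial>?M1) = ?m (\<psi> ` {x \<in> W. x \<otimes> y \<in> B})" if "y \<in> Q" for y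
    proof -
      have yG: "y \<in> carrier G" using that QG by auto
      have "(\<lambda>x. x \<otimes> y) \<in> measurable \<mu> \<mu>"
        using yG by (intro measurable_into_mu continuous_measurable_mu continuous_on_mult continuous_on_const continuous_on_id) auto
      from measurable_sets[OF this B(1)] have "W \<inter> ((\<lambda>x. x \<otimes> y) -` B \<inter> carrier G) \<in> sets \<mu>"
        using W(1) open_sets_mu by auto
      also have "W \<inter> ((\<lambda>x. x \<otimes> y) -` B \<inter> carrier G) = {x \<in> W. x \<otimes> y \<in> B}" using WG by auto
      finally have ps: "\<psi> ` {x \<in> W. x \<otimes> y \<in> B} \<in> sets borel" using WV by (intro borel) auto
      have "(\<integral>\<^sup>+u. f u y \<partial>?M1) = (\<integral>\<^sup>+u. f u y * indicator (\<psi> ` W) u \<partial>lborel)"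
        by (rule nn_integral_restrict_space) (use Wsets in auto)
      also have "\<dots> = (\<integral>\<^sup>+u. indicator (\<psi> ` {x \<in> W. x \<otimes> y \<in> B}) u \<partial>lborel)"
      proof (rule nn_integral_cong)
        fix u
        have "u \<in> \<psi> ` W \<and> \<psi>i u \<otimes> y \<in> B \<longleftrightarrow> u \<in> \<psi> ` {x \<in> W. x \<otimes> y \<in> B}"
          using \<psi>W by auto
        then show "f u y * indicator (\<psi> ` W) u = indicator (\<psi> ` {x \<in> W. x \<otimes> y \<in> B}) u"
          by (auto simp: f_def indicator_def)
      qed
      also have "\<dots> = ?m (\<psi> ` {x \<in> W. x \<otimes> y \<in> B})" using ps by (intro nn_integral_indicator) simp
      finally show ?thesis .
    qed
    have "(\<integral>\<^sup>+y. (\<integral>\<^sup>+u. f u y \<partial>?M1) \<partial>?M2) = (\<integral>\<^sup>+u. (\<integral>\<^sup>+y. f u y \<partial>?M2) \<partial>?M1)"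
      by (rule Fubini'[OF fm])
    also have "\<dots> = (\<integral>\<^sup>+u. emeasure \<mu> B \<partial>?M1)" by (rule nn_integral_cong) (simp add: inner1 sp1)
    also have "\<dots> = ?m (\<psi> ` W) * emeasure \<mu> B"
      using Wsets by (simp add: sp1 emeasure_restrict_space mult.commute)
    also have "(\<integral>\<^sup>+y. (\<integral>\<^sup>+u. f u y \<partial>?M1) \<partial>?M2) = (\<integral>\<^sup>+y. ?m (\<psi> ` {x \<in> W. x \<otimes> y \<in> B}) \<partial>?M2)"
      by (rule nn_integral_cong) (simp add: inner2 sp2)
    also have "\<dots> = (\<integral>\<^sup>+y. ?m (\<psi> ` {x \<in> W. x \<otimes> y \<in> B}) * indicator Q y \<partial>\<mu>)"
      by (rule nn_integral_restrict_space) (use Qsets QG in \<open>simp_all add: Int_absorb2\<close>)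
    finally show ?thesis by simp
  qed
  have QR: "Q \<in> sets \<mu>" "R \<in> sets \<mu>" using Q(1) R(1) open_sets_mu by auto
  have R0: "emeasure \<mu> R > 0" using R(1) haar_open_pos by blast
  have RQ: "emeasure \<mu> R \<le> emeasure \<mu> Q" using QR RQ' by (intro emeasure_mono) auto
  define a q r where "a = measure lborel (\<psi> ` W)" and "q = measure \<mu> Q" and "r = measure \<mu> R"
  have a1: "?m (\<psi> ` W) = ennreal a"
    unfolding a_def by (rule emeasure_eq_ennreal_measure) (use fin\<psi>[OF WP1] in simp)
  have a2: "a > 0" using mW unfolding a1 by simp
  note a = a1 a2
  have q: "emeasure \<mu> Q = ennreal q"
    unfolding q_def by (rule emeasure_eq_ennreal_measure) (use Q(3) in simp)
  have q0: "q \<ge> 0" by (simp add: q_def)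
  have Rfin: "emeasure \<mu> R < \<infinity>" using RQ Q(3) by (rule le_less_trans)
  have r1: "emeasure \<mu> R = ennreal r"
    unfolding r_def by (rule emeasure_eq_ennreal_measure) (use Rfin in simp)
  have r2: "r > 0" using R0 unfolding r1 by simp
  note r = r1 r2
  have "r \<le> q" using RQ q0 unfolding q r1 by (simp add: ennreal_le_iff)
  then have qr: "q \<ge> r" "q > 0" using r2 by simp_all
  \<comment> \<open>Above: for y in \<open>Q\<close> the section lies in B y^-1, so its Lebesgue
    measure is at most C times that of B. Below: for y in \<open>R\<close>, right translation by y
    carries the section onto B, so it has at least 1/C of the measure of B. Integration contributes
    the masses q and r.\<close>
  have up: "ennreal a * emeasure \<mu> B \<le> ennreal (C * q) * ?m (\<psi> ` B)"
    and low: "ennreal (r / C) * ?m (\<psi> ` B) \<le> ennreal a * emeasure \<mu> B" if B: "B \<in> sets \<mu>" "B \<subseteq> R" for B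
  proof -
    have BW: "B \<subseteq> W" "B \<subseteq> P1" "B \<subseteq> carrier G" using B R(2) RP1 RG by auto
    note T = Tonelli[OF B(1) BW(1), unfolded a(1)]
    have "ennreal a * emeasure \<mu> B \<le> (\<integral>\<^sup>+y. (ennreal C * ?m (\<psi> ` B)) * indicator Q y \<partial>\<mu>)"
      unfolding T
    proof (rule nn_integral_mono)
      fix y
      show "?m (\<psi> ` {x \<in> W. x \<otimes> y \<in> B}) * indicator Q y \<le> (ennreal C * ?m (\<psi> ` B)) * indicator Q y"
      proof (cases "y \<in> Q")
        case True
        then have y: "inv y \<in> P1" "y \<in> carrier G" using P2(3) Q(2) QG by auto
        have sub': "{x \<in> W. x \<otimes> y \<in> B} \<subseteq> (\<lambda>x. x \<otimes> inv y) ` B"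
        proof
          fix x assume x: "x \<in> {x \<in> W. x \<otimes> y \<in> B}"
          then have "x \<in> carrier G" using WG by auto
          then show "x \<in> (\<lambda>x. x \<otimes> inv y) ` B" using x y by (auto intro!: image_eqI[of _ _ "x \<otimes> y"] simp: m_assoc)
        qed
        have "(\<lambda>x. x \<otimes> inv y) ` B \<subseteq> V" using \<delta> y(1) BW(2) by auto
        then have "\<psi> ` ((\<lambda>x. x \<otimes> inv y) ` B) \<in> sets borel" using y B(1) by (intro borel rt_sets) auto
        then have "?m (\<psi> ` {x \<in> W. x \<otimes> y \<in> B}) \<le> ?m (\<psi> ` ((\<lambda>x. x \<otimes> inv y) ` B))"
          using sub' by (intro emeasure_mono image_mono) auto
        also have "\<dots> \<le> ennreal C * ?m (\<psi> ` B)" by (rule right[OF y(1) B(1) BW(2)])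
        finally show ?thesis by (intro mult_right_mono) auto
      qed simp
    qed
    also have "\<dots> = ennreal C * ?m (\<psi> ` B) * ennreal q"
      using QR q by (simp add: nn_integral_cmult_indicator)
    also have "\<dots> = ennreal (C * q) * ?m (\<psi> ` B)" using C qr by (simp add: ennreal_mult mult_ac)
    finally show "ennreal a * emeasure \<mu> B \<le> ennreal (C * q) * ?m (\<psi> ` B)" .
    have "(\<integral>\<^sup>+y. (ennreal (1 / C) * ?m (\<psi> ` B)) * indicator R y \<partial>\<mu>) \<le> ennreal a * emeasure \<mu> B"
      unfolding T
    proof (rule nn_integral_mono)
      fix y
      show "(ennreal (1 / C) * ?m (\<psi> ` B)) * indicator R y \<le> ?m (\<psi> ` {x \<in> W. x \<otimes> y \<in> B}) * indicator Q y"
      proof (cases "y \<in> R")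
        case True
        then have y: "y \<in> P1" "y \<in> Q" "y \<in> carrier G" using RP1 RQ' RG by auto
        let ?S = "{x \<in> W. x \<otimes> y \<in> B}"
        have eq: "(\<lambda>x. x \<otimes> y) ` ?S = B"
        proof
          show "B \<subseteq> (\<lambda>x. x \<otimes> y) ` ?S"
          proof
            fix b assume b: "b \<in> B"
            then have "b \<otimes> inv y \<in> W" using R(3) B(2) True by auto
            then show "b \<in> (\<lambda>x. x \<otimes> y) ` ?S" using b y BW by (auto intro!: image_eqI[of _ _ "b \<otimes> inv y"] simp: m_assoc subset_iff)
          qed
        qed auto
        have "(\<lambda>x. x \<otimes> inv y) ` B \<inter> W \<in> sets \<mu>" using rt_sets[of "inv y" B] y B W(1) open_sets_mu by auto
        also have "(\<lambda>x. x \<otimes> inv y) ` B \<inter> W = ?S"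
        proof
          show "?S \<subseteq> (\<lambda>x. x \<otimes> inv y) ` B \<inter> W"
          proof
            fix x assume x: "x \<in> ?S"
            then have "x = (x \<otimes> y) \<otimes> inv y" using y WG by (auto simp: m_assoc)
            then show "x \<in> (\<lambda>x. x \<otimes> inv y) ` B \<inter> W" using x by blast
          qed
          show "(\<lambda>x. x \<otimes> inv y) ` B \<inter> W \<subseteq> ?S" using y BW(3) by (auto simp: m_assoc subset_iff)
        qed
        finally have S: "?S \<in> sets \<mu>" .
        have "?m (\<psi> ` B) \<le> ennreal C * ?m (\<psi> ` ?S)"
          using right[OF y(1) S] WP1 unfolding eq by auto
        then have "ennreal (1 / C) * ?m (\<psi> ` B) \<le> ennreal (1 / C) * (ennreal C * ?m (\<psi> ` ?S))"
          by (rule mult_left_mono) simp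
        also have "\<dots> = ?m (\<psi> ` ?S)" using C by (simp add: mult.assoc[symmetric] ennreal_mult[symmetric])
        finally show ?thesis using True y by simp
      qed simp
    qed
    moreover have "ennreal (r / C) = ennreal (1 / C) * ennreal r"
      using C r by (simp add: ennreal_mult[symmetric])
    then have "(\<integral>\<^sup>+y. (ennreal (1 / C) * ?m (\<psi> ` B)) * indicator R y \<partial>\<mu>) = ennreal (r / C) * ?m (\<psi> ` B)"
      using QR(2) r(1) by (subst nn_integral_cmult_indicator) (simp_all add: mult_ac)
    ultimately show "ennreal (r / C) * ?m (\<psi> ` B) \<le> ennreal a * emeasure \<mu> B" by simp
  qed
  have scale: "ennreal (1 / a) * (ennreal a * x) = x" for x
    using a(2) by (simp add: mult.assoc[symmetric] ennreal_mult[symmetric])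
  show thesis
  proof (rule that[of R "r / (C * a)" "C * q / a"]; (intro ballI impI)?)
    fix B assume B: "B \<in> sets \<mu>" "B \<subseteq> R"
    have e1: "ennreal (r / (C * a)) = ennreal (1 / a) * ennreal (r / C)"
      and e2: "ennreal (C * q / a) = ennreal (1 / a) * ennreal (C * q)"
      using C a r qr by (simp_all add: ennreal_mult[symmetric] mult.commute)
    have "ennreal (1 / a) * (ennreal (r / C) * ?m (\<psi> ` B)) \<le> ennreal (1 / a) * (ennreal a * emeasure \<mu> B)"
      using low[OF B] by (rule mult_left_mono) simp
    then have 1: "ennreal (r / (C * a)) * ?m (\<psi> ` B) \<le> emeasure \<mu> B"
      unfolding scale e1 by (simp only: mult.assoc)
    have "ennreal (1 / a) * (ennreal a * emeasure \<mu> B) \<le> ennreal (1 / a) * (ennreal (C * q) * ?m (\<psi> ` B))"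
      using up[OF B] by (rule mult_left_mono) simp
    then have 2: "emeasure \<mu> B \<le> ennreal (C * q / a) * ?m (\<psi> ` B)"
      unfolding scale e2 by (simp only: mult.assoc)
    show "\<psi> ` B \<in> sets borel \<and> ?m (\<psi> ` B) < \<infinity> \<and>
      ennreal (r / (C * a)) * ?m (\<psi> ` B) \<le> emeasure \<mu> B \<and> emeasure \<mu> B \<le> ennreal (C * q / a) * ?m (\<psi> ` B)"
      using 1 2 borel[OF B(1)] fin\<psi>[of B] B(2) RV RP1 by auto
  qed (use R(1) RV r qr C a Rfin in auto)
qed

end

subsection \<open>From local systems to frames\<close>

text \<open>Transfers sums computed as integrals over counting measure, where Tonelli applies, to
  the unordered sums in the notion of frame.\<close>

lemma has_sum_of_nn_integral:
  fixes t :: "'k \<Rightarrow> real"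
  assumes "\<And>x. x \<in> A \<Longrightarrow> 0 \<le> t x" "0 \<le> r" "(\<integral>\<^sup>+x. ennreal (t x) \<partial>count_space A) = ennreal r"
  shows "(t has_sum r) A"
proof -
  have int: "integrable (count_space A) t"
    by (rule integrableI_nn_integral_finite[OF _ _ assms(3)]) (use assms in \<open>auto simp: AE_count_space\<close>)
  then have abs: "Infinite_Set_Sum.abs_summable_on t A" by (simp add: Infinite_Set_Sum.abs_summable_on_def)
  then have "Infinite_Sum.abs_summable_on t A" by (rule abs_summable_equivalent[THEN iffD2])
  then have sum: "t summable_on A" by (rule abs_summable_summable)
  have "infsum t A = infsetsum t A" using infsetsum_infsum[OF abs] by simp
  also have "\<dots> = r"
    unfolding infsetsum_def
    using integral_eq_nn_integral[of t "count_space A"] assms by (simp add: AE_count_space)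
  finally show ?thesis using has_sum_infsum[OF sum] by simp
qed

section \<open>Compact coordinate neighbourhoods\<close>

lemma compact_cball_finite_dim: "compact (cball (x :: 'a::finite_dim_normed) r)"
proof (cases "dim (UNIV :: 'a set) = 0")
  case True
  then have "(UNIV :: 'a set) \<subseteq> {0}" using dim_0_imp_0[OF True] by auto
  then have "finite (cball x r)" by (meson finite.emptyI finite_insert finite_subset subset_UNIV)
  then show ?thesis by (rule finite_imp_compact)
next
  case False
  then obtain L :: "real ^ 'a coord_index \<Rightarrow> 'a" and L' where L: "bounded_linear L" "bounded_linear L'"
    "\<And>x. L' (L x) = x" "\<And>y. L (L' y) = y"
    using coordinate_homeomorphism[where 'a = 'a] by blast
  have "bounded (L' ` cball x r)" by (rule bounded_linear_image[OF bounded_cball L(2)])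
  moreover have "closed (L' ` cball x r)"
  proof -
    have "L' ` cball x r = L -` cball x r"
    proof
      show "L -` cball x r \<subseteq> L' ` cball x r"
      proof
        fix y assume "y \<in> L -` cball x r"
        then show "y \<in> L' ` cball x r" using L(3)[of y] by (intro image_eqI[of _ _ "L y"]) auto
      qed
    qed (use L(4) in auto)
    then show ?thesis using closed_vimage[OF closed_cball linear_continuous_on[OF L(1)]] by simp
  qed
  ultimately have "compact (L' ` cball x r)" by (simp add: compact_eq_bounded_closed)
  then have "compact (L ` (L' ` cball x r))" using linear_continuous_on[OF L(1)] by (rule compact_continuous_image[rotated])
  then show ?thesis by (simp add: image_image L(4))
qed

context haar
begin

lemma chart_cball:
  assumes "c \<in> A" "x \<in> fst c" "openin (top_of_set (carrier G)) U" "x \<in> U"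
  obtains r where "r > 0" "cball (snd c x) r \<subseteq> snd c ` (fst c \<inter> U)"
    "compact (chart_inv c ` cball (snd c x) r)" "chart_inv c ` cball (snd c x) r \<subseteq> fst c \<inter> U"
    "openin (top_of_set (carrier G)) (fst c \<inter> snd c -` ball (snd c x) r)"
proof -
  have "open (snd c ` (fst c \<inter> U))" by (rule chart_image_open[OF assms(1)]) (use assms(3) in simp)
  moreover have "snd c x \<in> snd c ` (fst c \<inter> U)" using assms by auto
  ultimately have "\<exists>r>0. cball (snd c x) r \<subseteq> snd c ` (fst c \<inter> U)" unfolding open_contains_cball by (rule bspec)
  then obtain r where r: "r > 0" "cball (snd c x) r \<subseteq> snd c ` (fst c \<inter> U)" by auto
  have "continuous_on (cball (snd c x) r) (chart_inv c)"
    by (rule continuous_on_subset[OF continuous_on_chart_inv[OF assms(1)]]) (use r(2) in auto)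
  then have comp: "compact (chart_inv c ` cball (snd c x) r)"
    by (rule compact_continuous_image[OF _ compact_cball_finite_dim])
  have sub: "chart_inv c ` cball (snd c x) r \<subseteq> fst c \<inter> U"
  proof
    fix y assume "y \<in> chart_inv c ` cball (snd c x) r"
    then obtain u where u: "y = chart_inv c u" "u \<in> cball (snd c x) r" by (rule imageE)
    from subsetD[OF r(2) u(2)] obtain z where "u = snd c z" "z \<in> fst c \<inter> U" by (rule imageE)
    then show "y \<in> fst c \<inter> U" using u(1) assms(1) by simp
  qed
  have "openin (top_of_set (fst c)) (fst c \<inter> snd c -` ball (snd c x) r)"
    using continuous_openin_preimage_gen[OF continuous_on_chart[OF assms(1)] open_ball] .
  moreover have "openin (top_of_set (carrier G)) (fst c)" using chart_openin[OF assms(1)] by simp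
  ultimately have "openin (top_of_set (carrier G)) (fst c \<inter> snd c -` ball (snd c x) r)" by (rule openin_trans)
  then show thesis using that r comp sub by blast
qed

lemma compact_nbhd:
  obtains C K where "nbhd C" "C \<subseteq> K" "compact K" "K \<subseteq> carrier G"
proof -
  have 1: "\<one> \<in> points A" by simp
  let ?c = "chart_at A \<one>"
  note c = chart_at[OF 1]
  obtain r where r: "r > 0" "compact (chart_inv ?c ` cball (snd ?c \<one>) r)"
    "chart_inv ?c ` cball (snd ?c \<one>) r \<subseteq> fst ?c \<inter> carrier G"
    "openin (top_of_set (carrier G)) (fst ?c \<inter> snd ?c -` ball (snd ?c \<one>) r)"
    by (rule chart_cball[OF c, of "carrier G"]) auto
  show thesis
  proof (rule that)
    show "nbhd (fst ?c \<inter> snd ?c -` ball (snd ?c \<one>) r)" using r c by auto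
    show "fst ?c \<inter> snd ?c -` ball (snd ?c \<one>) r \<subseteq> chart_inv ?c ` cball (snd ?c \<one>) r"
    proof
      fix x assume "x \<in> fst ?c \<inter> snd ?c -` ball (snd ?c \<one>) r"
      then have "x = chart_inv ?c (snd ?c x)" "snd ?c x \<in> cball (snd ?c \<one>) r" using c by auto
      then show "x \<in> chart_inv ?c ` cball (snd ?c \<one>) r" by (rule image_eqI)
    qed
  qed (use r in auto)
qed

section \<open>Separated sets of translations and frames\<close>

text \<open>The first property says that the translates z W are pairwise disjoint. Zorn's lemma
  gives a maximal such set, and maximality means that no further translate h W avoids all of
  them.\<close>

lemma maximal_separated_set:
  assumes W: "W \<subseteq> carrier G"
  obtains Z where "Z \<subseteq> carrier G"
    "\<And>z z' w w'. z \<in> Z \<Longrightarrow> z' \<in> Z \<Longrightarrow> w \<in> W \<Longrightarrow> w' \<in> W \<Longrightarrow> z \<otimes> w = z' \<otimes> w' \<Longrightarrow> z = z'"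
    "\<And>h. h \<in> carrier G \<Longrightarrow> W \<noteq> {} \<Longrightarrow> \<exists>z\<in>Z. \<exists>w\<in>W. \<exists>w'\<in>W. h \<otimes> w = z \<otimes> w'"
proof -
  define sep where "sep = {Z. Z \<subseteq> carrier G \<and> (\<forall>z\<in>Z. \<forall>z'\<in>Z. \<forall>w\<in>W. \<forall>w'\<in>W. z \<otimes> w = z' \<otimes> w' \<longrightarrow> z = z')}"
  have "\<exists>Z\<in>sep. \<forall>X\<in>sep. Z \<subseteq> X \<longrightarrow> X = Z"
  proof (rule subset_Zorn_nonempty)
    show "sep \<noteq> {}" unfolding sep_def by blast
    fix \<C> assume C: "\<C> \<noteq> {}" "subset.chain sep \<C>"
    show "\<Union>\<C> \<in> sep" unfolding sep_def
    proof (intro CollectI conjI ballI impI)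
      show "\<Union>\<C> \<subseteq> carrier G" using C(2) by (auto simp: subset.chain_def sep_def)
      fix z z' w w' assume z: "z \<in> \<Union>\<C>" "z' \<in> \<Union>\<C>" and w: "w \<in> W" "w' \<in> W" "z \<otimes> w = z' \<otimes> w'"
      then obtain X X' where X: "X \<in> \<C>" "X' \<in> \<C>" "z \<in> X" "z' \<in> X'" by auto
      then have "X \<subseteq> X' \<or> X' \<subseteq> X" using C(2) by (auto simp: subset.chain_def)
      then have "\<exists>Y\<in>\<C>. z \<in> Y \<and> z' \<in> Y" using X by blast
      then obtain Y where "Y \<in> sep" "z \<in> Y" "z' \<in> Y" using C(2) unfolding subset.chain_def by blast
      then show "z = z'" using w unfolding sep_def by blast
    qed
  qed
  then obtain Z where Z: "Z \<in> sep" "\<And>X. X \<in> sep \<Longrightarrow> Z \<subseteq> X \<Longrightarrow> X = Z" by auto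
  show thesis
  proof (rule that[of Z])
    show "Z \<subseteq> carrier G" using Z(1) by (simp add: sep_def)
    show "z = z'" if "z \<in> Z" "z' \<in> Z" "w \<in> W" "w' \<in> W" "z \<otimes> w = z' \<otimes> w'" for z z' w w'
      using Z(1) that unfolding sep_def by blast
    fix h assume h: "h \<in> carrier G" and "W \<noteq> {}"
    show "\<exists>z\<in>Z. \<exists>w\<in>W. \<exists>w'\<in>W. h \<otimes> w = z \<otimes> w'"
    proof (rule ccontr)
      assume neg: "\<not> ?thesis"
      have "insert h Z \<in> sep" unfolding sep_def
      proof (intro CollectI conjI ballI impI)
        show "insert h Z \<subseteq> carrier G" using h Z(1) by (simp add: sep_def)
        fix z z' w w' assume "z \<in> insert h Z" "z' \<in> insert h Z" "w \<in> W" "w' \<in> W" "z \<otimes> w = z' \<otimes> w'"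
        then show "z = z'" using neg Z(1) unfolding sep_def by (metis (mono_tags, lifting) insertE mem_Collect_eq)
      qed
      then have "insert h Z = Z" by (rule Z(2)) auto
      then have "h \<in> Z" by auto
      then show False using neg \<open>W \<noteq> {}\<close> by blast
    qed
  qed
qed

text \<open>The open translates are disjoint, so a countable subfamily with the same union must
  contain every one of them.\<close>

lemma countable_separated_set:
  assumes W: "openin (top_of_set (carrier G)) W" "W \<noteq> {}" and Z: "Z \<subseteq> carrier G"
    "\<And>z z' w w'. z \<in> Z \<Longrightarrow> z' \<in> Z \<Longrightarrow> w \<in> W \<Longrightarrow> w' \<in> W \<Longrightarrow> z \<otimes> w = z' \<otimes> w' \<Longrightarrow> z = z'"
  shows "countable Z"
proof -
  let ?F = "(\<lambda>z. z <# W) ` Z"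
  have W': "W \<subseteq> carrier G" using openin_imp_subset[OF W(1)] .
  have "\<And>S. S \<in> ?F \<Longrightarrow> openin (top_of_set (carrier G)) S" using open_translate[OF W(1)] Z(1) by auto
  then obtain F' where F': "F' \<subseteq> ?F" "countable F'" "\<Union>F' = \<Union>?F" by (rule Lindelof_openin)
  obtain w where w: "w \<in> W" using W(2) by auto
  have "?F \<subseteq> F'"
  proof
    fix S assume "S \<in> ?F"
    then obtain z where z: "S = z <# W" "z \<in> Z" by (rule imageE)
    have "z \<otimes> w \<in> \<Union>?F" using z w by (auto simp: l_coset_def)
    then have "z \<otimes> w \<in> \<Union>F'" using F'(3) by simp
    then obtain T where T: "z \<otimes> w \<in> T" "T \<in> F'" by (rule UnionE)
    from subsetD[OF F'(1) T(2)] obtain z' where z': "T = z' <# W" "z' \<in> Z" by (rule imageE)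
    then obtain w' where "w' \<in> W" "z \<otimes> w = z' \<otimes> w'" using T(1) by (auto simp: l_coset_def)
    then have "z = z'" using Z(2) z z' w by simp
    then show "S \<in> F'" using T z z' by simp
  qed
  then have "countable ?F" using F'(2) by (rule countable_subset)
  moreover have "inj_on (\<lambda>z. z <# W) Z"
  proof (rule inj_onI)
    fix z z' assume z: "z \<in> Z" "z' \<in> Z" "z <# W = z' <# W"
    have "z \<otimes> w \<in> z' <# W" unfolding z(3)[symmetric] using w by (auto simp: l_coset_def)
    then obtain w' where "w' \<in> W" "z \<otimes> w = z' \<otimes> w'" by (auto simp: l_coset_def)
    then show "z = z'" using Z(2) z w by simp
  qed
  ultimately show ?thesis by (rule countable_image_inj_on)
qed

lemma integral_left_translate:
  fixes f :: "'a \<Rightarrow> complex"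
  assumes "z \<in> carrier G" "f \<in> borel_measurable \<mu>"
  shows "(LINT x|\<mu>. f (z \<otimes> x)) = (LINT x|\<mu>. f x)"
  by (subst distr_left[OF assms(1), symmetric], subst integral_distr)
     (use measurable_left[OF assms(1)] assms(2) in auto)

lemma integrable_left_translate:
  fixes f :: "'a \<Rightarrow> real"
  assumes "z \<in> carrier G" "integrable \<mu> f"
  shows "integrable \<mu> (\<lambda>x. f (z \<otimes> x))"
proof -
  have "integrable (distr \<mu> \<mu> (\<lambda>x. z \<otimes> x)) f" using assms by (simp add: distr_left)
  then show ?thesis by (rule integrable_distr[OF measurable_left[OF assms(1)]])
qed

lemma real_integral_left_translate:
  fixes f :: "'a \<Rightarrow> real"
  assumes "z \<in> carrier G" "f \<in> borel_measurable \<mu>"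
  shows "(LINT x|\<mu>. f (z \<otimes> x)) = (LINT x|\<mu>. f x)"
  by (subst distr_left[OF assms(1), symmetric], subst integral_distr)
     (use measurable_left[OF assms(1)] assms(2) in auto)

text \<open>The translates of an open set where the function is bounded away from zero cover the group,
  and those of its support overlap boundedly often, since a separated set has boundedly many points
  in a translate of a compact set.\<close>

lemma bounded_covering:
  fixes f :: "'a \<Rightarrow> complex"
  assumes S: "compact S" "S \<subseteq> carrier G" and f: "continuous_on (carrier G) f"
    and f0: "\<And>x. x \<in> carrier G \<Longrightarrow> x \<notin> S \<Longrightarrow> f x = 0" and h0: "h0 \<in> carrier G" "f h0 \<noteq> 0"
  obtains Z a b where "countable Z" "Z \<subseteq> carrier G" "0 < a" "0 \<le> (b::real)"
    "\<forall>h\<in>carrier G. ennreal a \<le> (\<integral>\<^sup>+z. ennreal ((cmod (f (inv z \<otimes> h)))\<^sup>2) \<partial>count_space Z)"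
    "\<forall>h\<in>carrier G. (\<integral>\<^sup>+z. ennreal ((cmod (f (inv z \<otimes> h)))\<^sup>2) \<partial>count_space Z) \<le> ennreal b"
    "\<forall>x\<in>carrier G. (cmod (f x))\<^sup>2 \<le> b"
proof -
  have "compact (f ` S)" using f S by (intro compact_continuous_image) (auto intro: continuous_on_subset)
  then have "bounded (f ` S)" by (rule compact_imp_bounded)
  then obtain M0 where M0: "\<forall>y\<in>f ` S. norm y \<le> M0" unfolding bounded_iff by (rule exE)
  define M where "M = max M0 0"
  have M: "cmod (f x) \<le> M" if "x \<in> carrier G" for x
    using M0 f0[OF that] by (cases "x \<in> S") (auto simp: M_def)
  have M_nonneg: "M \<ge> 0" by (simp add: M_def)
  define \<delta> where "\<delta> = cmod (f h0) / 2"
  have \<delta>: "\<delta> > 0" using h0 by (simp add: \<delta>_def)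
  \<comment> \<open>The set where |f| exceeds half its value at h0, shifted by h0 so that it becomes
    a neighbourhood of the identity.\<close>
  define W0 where "W0 = carrier G \<inter> (\<lambda>x. cmod (f (h0 \<otimes> x))) -` {\<delta><..}"
  have "continuous_on (carrier G) (\<lambda>x. h0 \<otimes> x)"
    using h0 by (intro continuous_on_mult continuous_on_const continuous_on_id) auto
  from continuous_on_compose2[OF f this] have "continuous_on (carrier G) (\<lambda>x. cmod (f (h0 \<otimes> x)))"
    using h0 by (intro continuous_on_norm) auto
  then have "openin (top_of_set (carrier G)) W0"
    unfolding W0_def by (rule continuous_openin_preimage_gen) auto
  moreover have "\<one> \<in> W0" using h0 \<delta> by (simp add: W0_def \<delta>_def)
  ultimately have W0: "nbhd W0" by simp
  obtain C K where CK: "nbhd C" "C \<subseteq> K" "compact K" "K \<subseteq> carrier G" by (rule compact_nbhd)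
  obtain W where "quotient_nbhd (W0 \<inter> C) W" using quotient_nbhd_exists[OF nbhd_Int[OF W0 CK(1)]] by (rule exE)
  note W = quotient_nbhdD(1,2,6)[OF this]
  have WG: "W \<subseteq> carrier G" by (rule nbhd_subset[OF W(1)])
  have WK: "W \<subseteq> K" using W(2) CK(2) by auto
  have W1: "\<one> \<in> W" "openin (top_of_set (carrier G)) W" using W(1) by auto
  obtain Z0 where Z0: "Z0 \<subseteq> carrier G"
    and sep: "\<And>z z' w w'. z \<in> Z0 \<Longrightarrow> z' \<in> Z0 \<Longrightarrow> w \<in> W \<Longrightarrow> w' \<in> W \<Longrightarrow> z \<otimes> w = z' \<otimes> w' \<Longrightarrow> z = z'"
    and max: "\<And>h. h \<in> carrier G \<Longrightarrow> W \<noteq> {} \<Longrightarrow> \<exists>z\<in>Z0. \<exists>w\<in>W. \<exists>w'\<in>W. h \<otimes> w = z \<otimes> w'"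
    by (rule maximal_separated_set[OF WG]) blast
  have cZ0: "countable Z0" by (rule countable_separated_set[OF W1(2) _ Z0 sep]) (use W1 in auto)
  \<comment> \<open>The shift by the inverse of h0 compensates for centring \<open>W0\<close> at the
    identity: the values of \<open>f\<close> needed are those near h0.\<close>
  define Z where "Z = (\<lambda>z. z \<otimes> inv h0) ` Z0"
  have Z: "countable Z" "Z \<subseteq> carrier G" using cZ0 Z0 h0 by (auto simp: Z_def)
  have ZZ0: "z \<otimes> h0 \<in> Z0" if "z \<in> Z" for z using that Z0 h0 by (auto simp: Z_def m_assoc subset_iff)
  have cover: "\<exists>z\<in>Z. cmod (f (inv z \<otimes> h)) > \<delta>" if h: "h \<in> carrier G" for h
  proof -
    have "W \<noteq> {}" using W1 by auto
    from max[OF h this] obtain z w w' where z: "z \<in> Z0" "w \<in> W" "w' \<in> W" "h \<otimes> w = z \<otimes> w'" by auto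
    have G: "z \<in> carrier G" "w \<in> carrier G" "w' \<in> carrier G" using z Z0 WG by auto
    have "h = z \<otimes> w' \<otimes> inv w" using z(4) G h by (metis inv_solve_right m_closed)
    then have "inv z \<otimes> h = w' \<otimes> inv w" using G by (simp add: m_assoc[symmetric])
    then have "inv z \<otimes> h \<in> W0" using W(3)[OF z(3,2)] by simp
    then have "cmod (f (h0 \<otimes> (inv z \<otimes> h))) > \<delta>" by (simp add: W0_def)
    moreover have "inv (z \<otimes> inv h0) \<otimes> h = h0 \<otimes> (inv z \<otimes> h)" using G h h0 by (simp add: inv_mult_group m_assoc)
    ultimately show ?thesis using z(1) by (auto simp: Z_def intro!: bexI[of _ z])
  qed
  \<comment> \<open>If z^-1 h lies in \<open>S\<close>, then z h0 W is contained in h Y. All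
    translates relevant at h are thus packed into one set whose measure does not depend on
    h.\<close>
  define Y where "Y = (\<lambda>p. inv (fst p) \<otimes> h0 \<otimes> snd p) ` (S \<times> K)"
  have "continuous_on (S \<times> K) (\<lambda>p. inv (fst p) \<otimes> h0 \<otimes> snd p)"
    using S(2) CK(4) h0
    by (intro continuous_on_mult continuous_on_inv continuous_on_const continuous_fst_on continuous_snd_on) (auto simp: subset_iff)
  then have "compact Y" unfolding Y_def by (rule compact_continuous_image[OF _ compact_Times[OF S(1) CK(3)]])
  moreover have YG: "Y \<subseteq> carrier G" using S(2) CK(4) h0 by (auto simp: Y_def subset_iff)
  ultimately have Yfin: "emeasure \<mu> Y < \<infinity>" and Ysets: "Y \<in> sets \<mu>"
    using haar_compact compact_sets_mu by auto
  have Wsets: "W \<in> sets \<mu>" by (rule open_sets_mu[OF W1(2)])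
  have Wpos: "emeasure \<mu> W > 0" by (rule haar_open_pos[OF W1(2,1)])
  have "emeasure \<mu> W \<le> emeasure \<mu> K" using WK compact_sets_mu[OF CK(4,3)] by (rule emeasure_mono)
  then have Wfin: "emeasure \<mu> W < \<infinity>" using haar_compact[OF CK(4,3)] by (rule le_less_trans)
  define m y where "m = measure \<mu> W" and "y = measure \<mu> Y"
  have m: "emeasure \<mu> W = ennreal m"
    unfolding m_def by (rule emeasure_eq_ennreal_measure) (use Wfin in simp)
  have m_pos: "m > 0" using Wpos unfolding m by simp
  have y: "emeasure \<mu> Y = ennreal y"
    unfolding y_def by (rule emeasure_eq_ennreal_measure) (use Yfin in simp)
  have y0: "y \<ge> 0" by (simp add: y_def)
  \<comment> \<open>The largest number of disjoint sets of measure m that fit into a set of measure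
    y.\<close>
  define B where "B = nat \<lfloor>y / m\<rfloor>"
  have overlap: "finite {z \<in> Z. inv z \<otimes> h \<in> S} \<and> card {z \<in> Z. inv z \<otimes> h \<in> S} \<le> B" if h: "h \<in> carrier G" for h
  proof (rule finite_if_finite_subsets_card_bdd)
    fix T assume T: "T \<subseteq> {z \<in> Z. inv z \<otimes> h \<in> S}" "finite T"
    let ?V = "\<lambda>z. (z \<otimes> h0) <# W"
    have TG: "z \<in> carrier G" "z \<otimes> h0 \<in> carrier G" if "z \<in> T" for z using that T(1) Z(2) h0 by auto
    have V: "?V z \<in> sets \<mu>" "emeasure \<mu> (?V z) = ennreal m" if "z \<in> T" for z
      using open_sets_mu[OF open_translate[OF W1(2) TG(2)[OF that]]] haar_translate[OF TG(2)[OF that] Wsets] m by auto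
    have sub: "?V z \<subseteq> h <# Y" if "z \<in> T" for z
    proof
      fix x assume "x \<in> ?V z"
      then obtain w where w: "w \<in> W" "x = z \<otimes> h0 \<otimes> w" by (auto simp: l_coset_def)
      have s: "inv z \<otimes> h \<in> S" using that T(1) by auto
      have wG: "w \<in> carrier G" using w WG by auto
      have "inv (inv z \<otimes> h) \<otimes> h0 \<otimes> w \<in> Y" unfolding Y_def using s w(1) WK by (intro image_eqI[of _ _ "(inv z \<otimes> h, w)"]) auto
      moreover have "h \<otimes> (inv (inv z \<otimes> h) \<otimes> h0 \<otimes> w) = x"
        using TG[OF that] h h0 wG w(2) by (simp add: inv_mult_group m_assoc[symmetric])
      ultimately show "x \<in> h <# Y" unfolding l_coset_def by blast
    qed
    have disj: "disjoint_family_on ?V T" unfolding disjoint_family_on_def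
    proof (intro ballI impI)
      fix z z' assume z: "z \<in> T" "z' \<in> T" "z \<noteq> z'"
      show "?V z \<inter> ?V z' = {}"
      proof (rule ccontr)
        assume "?V z \<inter> ?V z' \<noteq> {}"
        then obtain w w' where "w \<in> W" "w' \<in> W" "(z \<otimes> h0) \<otimes> w = (z' \<otimes> h0) \<otimes> w'" by (auto simp: l_coset_def)
        moreover have "z \<otimes> h0 \<in> Z0" "z' \<otimes> h0 \<in> Z0" using ZZ0 z T(1) by auto
        ultimately have "z \<otimes> h0 = z' \<otimes> h0" using sep by simp
        then show False using z TG(1) h0 by (simp add: right_cancel)
      qed
    qed
    have "ennreal (card T * m) = (\<Sum>z\<in>T. emeasure \<mu> (?V z))"
      using V(2) m_pos by (simp add: ennreal_mult ennreal_of_nat_eq_real_of_nat)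
    also have "\<dots> = emeasure \<mu> (\<Union>z\<in>T. ?V z)"
      by (rule sum_emeasure) (use V(1) disj T(2) in auto)
    also have "\<dots> \<le> emeasure \<mu> (h <# Y)"
    proof (rule emeasure_mono)
      have "(\<lambda>x. inv h \<otimes> x) -` Y \<inter> space \<mu> \<in> sets \<mu>"
        using h by (intro measurable_sets[OF measurable_left Ysets]) auto
      then show "h <# Y \<in> sets \<mu>" using left_vimage[of "inv h" Y] h YG by simp
    qed (use sub in auto)
    also have "\<dots> = ennreal y" using haar_translate[OF h Ysets] y by simp
    finally have "card T * m \<le> y" using y0 by (simp add: ennreal_le_iff)
    then have "real (card T) \<le> y / m" using m_pos by (simp add: field_simps)
    then show "card T \<le> B" unfolding B_def by (simp add: le_nat_iff le_floor_iff)
  qed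
  \<comment> \<open>At most \<open>B\<close> terms are nonzero, each at most M^2. The maximum with
    M^2 makes the same constant a pointwise bound for |f|^2.\<close>
  show thesis
  proof (rule that[of Z "\<delta>\<^sup>2" "max (M\<^sup>2) (M\<^sup>2 * B)"]; (intro ballI)?)
    fix h assume h: "h \<in> carrier G"
    from cover[OF h] obtain z where z: "z \<in> Z" "cmod (f (inv z \<otimes> h)) > \<delta>" by (rule bexE)
    have "ennreal (\<delta>\<^sup>2) \<le> ennreal ((cmod (f (inv z \<otimes> h)))\<^sup>2)"
      using z(2) \<delta> by (intro ennreal_leI power_mono) auto
    also have "\<dots> \<le> (\<integral>\<^sup>+z. ennreal ((cmod (f (inv z \<otimes> h)))\<^sup>2) \<partial>count_space Z)"
      by (rule nn_integral_ge_point[OF z(1)])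
    finally show "ennreal (\<delta>\<^sup>2) \<le> (\<integral>\<^sup>+z. ennreal ((cmod (f (inv z \<otimes> h)))\<^sup>2) \<partial>count_space Z)" .
    let ?X = "{z \<in> Z. inv z \<otimes> h \<in> S}"
    have "(\<integral>\<^sup>+z. ennreal ((cmod (f (inv z \<otimes> h)))\<^sup>2) \<partial>count_space Z) \<le> (\<integral>\<^sup>+z. ennreal (M\<^sup>2) * indicator ?X z \<partial>count_space Z)"
    proof (rule nn_integral_mono)
      fix z assume "z \<in> space (count_space Z)"
      then have zG: "inv z \<otimes> h \<in> carrier G" "z \<in> Z" using Z(2) h by auto
      show "ennreal ((cmod (f (inv z \<otimes> h)))\<^sup>2) \<le> ennreal (M\<^sup>2) * indicator ?X z"
      proof (cases "inv z \<otimes> h \<in> S")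
        case True
        have "ennreal ((cmod (f (inv z \<otimes> h)))\<^sup>2) \<le> ennreal (M\<^sup>2)"
          using M[OF zG(1)] by (intro ennreal_leI power_mono) auto
        then show ?thesis using True zG by simp
      qed (simp add: f0[OF zG(1)])
    qed
    also have "\<dots> = ennreal (M\<^sup>2) * emeasure (count_space Z) ?X"
      by (rule nn_integral_cmult_indicator) simp
    also have "\<dots> = ennreal (M\<^sup>2) * ennreal (card ?X)"
      using overlap[OF h] by (subst emeasure_count_space_finite) (auto simp: ennreal_of_nat_eq_real_of_nat)
    also have "\<dots> \<le> ennreal (M\<^sup>2) * ennreal B"
      using overlap[OF h] by (intro mult_left_mono ennreal_leI) auto
    also have "\<dots> = ennreal (M\<^sup>2 * B)" by (simp add: ennreal_mult)
    also have "\<dots> \<le> ennreal (max (M\<^sup>2) (M\<^sup>2 * B))" by (intro ennreal_leI) simp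
    finally show "(\<integral>\<^sup>+z. ennreal ((cmod (f (inv z \<otimes> h)))\<^sup>2) \<partial>count_space Z) \<le> ennreal (max (M\<^sup>2) (M\<^sup>2 * B))" .
    show "(cmod (f h))\<^sup>2 \<le> max (M\<^sup>2) (M\<^sup>2 * B)"
      using power_mono[OF M[OF h], of 2] by simp
  next
    show "0 \<le> max (M\<^sup>2) (M\<^sup>2 * B)" by (rule max.coboundedI1) simp
  qed (use Z \<delta> in auto)
qed

text \<open>The local hypothesis concerns functions vanishing off \<open>S\<close>, whereas the
  product of \<open>g\<close> with a translate of \<open>f\<close> lives on z S; left invariance
  moves it back. Nonnegativity allows the sums over \<open>I\<close> and then \<open>Z\<close> to be
  read as one unordered sum over pairs.\<close>

theorem frame_of_local_system:
  fixes e :: "'k \<Rightarrow> 'a \<Rightarrow> complex" and f :: "'a \<Rightarrow> complex"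
  assumes S: "compact S" "S \<subseteq> carrier G" and c: "0 < c1" "c1 \<le> c2"
    and e: "\<And>k. k \<in> I \<Longrightarrow> e k \<in> borel_measurable \<mu>" "\<And>k x. cmod (e k x) = 1"
    and loc: "\<And>F. F \<in> borel_measurable \<mu> \<Longrightarrow> integrable \<mu> (\<lambda>x. (cmod (F x))\<^sup>2) \<Longrightarrow>
      (\<And>x. x \<in> carrier G \<Longrightarrow> x \<notin> S \<Longrightarrow> F x = 0) \<Longrightarrow>
      \<exists>s. ((\<lambda>k. (cmod (LINT x|\<mu>. F x * cnj (e k x)))\<^sup>2) has_sum s) I \<and>
        c1 * (LINT x|\<mu>. (cmod (F x))\<^sup>2) \<le> s \<and> s \<le> c2 * (LINT x|\<mu>. (cmod (F x))\<^sup>2)"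
    and f: "continuous_on (carrier G) f" "\<And>x. x \<in> carrier G \<Longrightarrow> x \<notin> S \<Longrightarrow> f x = 0" "h0 \<in> carrier G" "f h0 \<noteq> 0"
  obtains Z a b where "countable Z" "Z \<subseteq> carrier G" "0 < a" "a \<le> (b::real)"
    "\<And>z k. z \<in> Z \<Longrightarrow> k \<in> I \<Longrightarrow> (\<lambda>h. e k (inv z \<otimes> h) * f (inv z \<otimes> h)) \<in> L2_functions \<mu>"
    "\<And>g. g \<in> L2_functions \<mu> \<Longrightarrow>
      \<exists>r. ((\<lambda>p. (cmod (L2_inner \<mu> g (\<lambda>h. e (snd p) (inv (fst p) \<otimes> h) * f (inv (fst p) \<otimes> h))))\<^sup>2) has_sum r) (Z \<times> I) \<and>
        a * L2_norm_sq \<mu> g \<le> r \<and> r \<le> b * L2_norm_sq \<mu> g"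
proof -
  have fm[measurable]: "f \<in> borel_measurable \<mu>" by (rule continuous_measurable_mu[OF f(1)])
  obtain Z a b where Z: "countable Z" "Z \<subseteq> carrier G" and ab: "0 < a" "0 \<le> (b::real)"
    and low': "\<forall>h\<in>carrier G. ennreal a \<le> (\<integral>\<^sup>+z. ennreal ((cmod (f (inv z \<otimes> h)))\<^sup>2) \<partial>count_space Z)"
    and up': "\<forall>h\<in>carrier G. (\<integral>\<^sup>+z. ennreal ((cmod (f (inv z \<otimes> h)))\<^sup>2) \<partial>count_space Z) \<le> ennreal b"
    and fb': "\<forall>x\<in>carrier G. (cmod (f x))\<^sup>2 \<le> b"
    by (rule bounded_covering[OF S f])
  note low = bspec[OF low'] and up = bspec[OF up'] and fb = bspec[OF fb']
  have ZG: "z \<in> carrier G" "inv z \<in> carrier G" if "z \<in> Z" for z using that Z(2) by auto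
  have fz[measurable]: "(\<lambda>h. f (inv z \<otimes> h)) \<in> borel_measurable \<mu>" if "z \<in> Z" for z
    by (rule measurable_compose[OF measurable_left[OF ZG(2)[OF that]] fm])
  have ez[measurable]: "(\<lambda>h. e k (inv z \<otimes> h)) \<in> borel_measurable \<mu>" if "z \<in> Z" "k \<in> I" for z k
    by (rule measurable_compose[OF measurable_left[OF ZG(2)[OF that(1)]] e(1)[OF that(2)]])
  have f2: "integrable \<mu> (\<lambda>h. (cmod (f h))\<^sup>2)"
  proof (rule Bochner_Integration.integrable_bound)
    have "emeasure \<mu> S < \<infinity>" "S \<in> sets \<mu>" using haar_compact compact_sets_mu S by auto
    then show "integrable \<mu> (\<lambda>h. b * indicator S h)" by (intro integrable_mult_right integrable_real_indicator) auto
    show "AE h in \<mu>. norm ((cmod (f h))\<^sup>2) \<le> norm (b * indicator S h)"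
      using fb f(2) ab(2) by (intro AE_I2) (auto simp: indicator_def)
  qed measurable
  have v2: "(\<lambda>h. e k (inv z \<otimes> h) * f (inv z \<otimes> h)) \<in> L2_functions \<mu>" if z: "z \<in> Z" "k \<in> I" for z k
  proof -
    have "(\<lambda>h. e k (inv z \<otimes> h) * f (inv z \<otimes> h)) \<in> borel_measurable \<mu>" using z by measurable
    moreover have "integrable \<mu> (\<lambda>h. (cmod (f (inv z \<otimes> h)))\<^sup>2)"
      using integrable_left_translate[OF ZG(2)[OF z(1)] f2] .
    ultimately show ?thesis by (simp add: L2_functions_def norm_mult e(2))
  qed
  show thesis
  proof (rule that[OF Z _ _ v2])
    show "0 < c1 * a" using c ab by simp
    \<comment> \<open>The maximum puts the two bounds into the required order.\<close>
    show "c1 * a \<le> c2 * max a b" using c ab by (intro mult_mono) auto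
    fix g assume "g \<in> L2_functions \<mu>"
    then have g[measurable]: "g \<in> borel_measurable \<mu>" and g2: "integrable \<mu> (\<lambda>x. (cmod (g x))\<^sup>2)"
      by (auto simp: L2_functions_def)
    define n where "n = L2_norm_sq \<mu> g"
    have n0: "n \<ge> 0" unfolding n_def L2_norm_sq_def by (intro integral_nonneg_AE) auto
    have n: "(\<integral>\<^sup>+h. ennreal ((cmod (g h))\<^sup>2) \<partial>\<mu>) = ennreal n"
      unfolding n_def L2_norm_sq_def by (rule nn_integral_eq_integral[OF g2]) simp
    define \<phi> where "\<phi> z h = (cmod (g h))\<^sup>2 * (cmod (f (inv z \<otimes> h)))\<^sup>2" for z h
    have \<phi>m[measurable]: "\<phi> z \<in> borel_measurable \<mu>" if "z \<in> Z" for z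
      unfolding \<phi>_def using that by measurable
    have \<phi>i: "integrable \<mu> (\<phi> z)" if z: "z \<in> Z" for z
    proof (rule Bochner_Integration.integrable_bound[OF integrable_mult_right[OF g2, of b]])
      show "AE h in \<mu>. norm (\<phi> z h) \<le> norm (b * (cmod (g h))\<^sup>2)"
      proof (rule AE_I2)
        fix h assume "h \<in> space \<mu>"
        then have "(cmod (g h))\<^sup>2 * (cmod (f (inv z \<otimes> h)))\<^sup>2 \<le> (cmod (g h))\<^sup>2 * b"
          using ZG[OF z] by (intro mult_left_mono fb) auto
        then show "norm (\<phi> z h) \<le> norm (b * (cmod (g h))\<^sup>2)" using ab by (simp add: \<phi>_def mult.commute)
      qed
    qed (use \<phi>m z in auto)
    define t where "t z = (LINT h|\<mu>. \<phi> z h)" for z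
    have t0: "t z \<ge> 0" for z unfolding t_def by (intro integral_nonneg_AE) (auto simp: \<phi>_def)
    have "(\<integral>\<^sup>+z. ennreal (t z) \<partial>count_space Z) = (\<integral>\<^sup>+z. (\<integral>\<^sup>+h. ennreal (\<phi> z h) \<partial>\<mu>) \<partial>count_space Z)"
      unfolding t_def by (intro nn_integral_cong nn_integral_eq_integral[symmetric]) (auto simp: \<phi>i, auto simp: \<phi>_def)
    also have "\<dots> = (\<integral>\<^sup>+h. (\<integral>\<^sup>+z. ennreal (\<phi> z h) \<partial>count_space Z) \<partial>\<mu>)"
      by (rule nn_integral_count_space_nn_integral[symmetric, OF Z(1)]) (use \<phi>m in measurable)
    also have "\<dots> = (\<integral>\<^sup>+h. ennreal ((cmod (g h))\<^sup>2) * (\<integral>\<^sup>+z. ennreal ((cmod (f (inv z \<otimes> h)))\<^sup>2) \<partial>count_space Z) \<partial>\<mu>)"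
      by (intro nn_integral_cong) (simp add: \<phi>_def ennreal_mult nn_integral_cmult)
    \<comment> \<open>By Tonelli the local energies t z add up to the integral of |g|^2 weighted by
      the sum of the squared translates of f, which the covering bounds trap between a and
      b.\<close>
    finally have sum: "(\<integral>\<^sup>+z. ennreal (t z) \<partial>count_space Z) = \<dots>" .
    have "(\<integral>\<^sup>+z. ennreal (t z) \<partial>count_space Z) \<le> (\<integral>\<^sup>+h. ennreal b * ennreal ((cmod (g h))\<^sup>2) \<partial>\<mu>)"
      unfolding sum
    proof (rule nn_integral_mono)
      fix h assume h: "h \<in> space \<mu>"
      have "ennreal ((cmod (g h))\<^sup>2) * (\<integral>\<^sup>+z. ennreal ((cmod (f (inv z \<otimes> h)))\<^sup>2) \<partial>count_space Z) \<le> ennreal ((cmod (g h))\<^sup>2) * ennreal b"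
        by (rule mult_left_mono[OF up]) (use h in auto)
      then show "ennreal ((cmod (g h))\<^sup>2) * (\<integral>\<^sup>+z. ennreal ((cmod (f (inv z \<otimes> h)))\<^sup>2) \<partial>count_space Z) \<le> ennreal b * ennreal ((cmod (g h))\<^sup>2)" by (simp only: mult.commute[of "ennreal b"])
    qed
    also have "\<dots> = ennreal (b * n)" using ab n0 by (simp add: nn_integral_cmult n ennreal_mult)
    finally have sup: "(\<integral>\<^sup>+z. ennreal (t z) \<partial>count_space Z) \<le> ennreal (b * n)" .
    have "ennreal (a * n) = (\<integral>\<^sup>+h. ennreal a * ennreal ((cmod (g h))\<^sup>2) \<partial>\<mu>)"
      using ab n0 by (simp add: nn_integral_cmult n ennreal_mult)
    also have "\<dots> \<le> (\<integral>\<^sup>+z. ennreal (t z) \<partial>count_space Z)"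
      unfolding sum
    proof (rule nn_integral_mono)
      fix h assume h: "h \<in> space \<mu>"
      have "ennreal ((cmod (g h))\<^sup>2) * ennreal a \<le> ennreal ((cmod (g h))\<^sup>2) * (\<integral>\<^sup>+z. ennreal ((cmod (f (inv z \<otimes> h)))\<^sup>2) \<partial>count_space Z)"
        by (rule mult_left_mono[OF low]) (use h in auto)
      then show "ennreal a * ennreal ((cmod (g h))\<^sup>2) \<le> ennreal ((cmod (g h))\<^sup>2) * (\<integral>\<^sup>+z. ennreal ((cmod (f (inv z \<otimes> h)))\<^sup>2) \<partial>count_space Z)" by (simp only: mult.commute[of "ennreal a"])
    qed
    finally have slow: "ennreal (a * n) \<le> (\<integral>\<^sup>+z. ennreal (t z) \<partial>count_space Z)" .
    define r where "r = enn2real (\<integral>\<^sup>+z. ennreal (t z) \<partial>count_space Z)"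
    have "(\<integral>\<^sup>+z. ennreal (t z) \<partial>count_space Z) < \<infinity>" using sup by (rule le_less_trans) simp
    then have r: "(\<integral>\<^sup>+z. ennreal (t z) \<partial>count_space Z) = ennreal r" by (simp add: r_def)
    have r0: "r \<ge> 0" by (simp add: r_def)
    have rb: "a * n \<le> r" "r \<le> b * n"
      using slow sup n0 r0 ab unfolding r by (simp_all add: ennreal_le_iff)
    have tr: "(t has_sum r) Z" by (rule has_sum_of_nn_integral[OF t0 r0 r])
    let ?q = "\<lambda>z k. (cmod (L2_inner \<mu> g (\<lambda>h. e k (inv z \<otimes> h) * f (inv z \<otimes> h))))\<^sup>2"
    have "\<exists>s. (?q z has_sum s) I \<and> c1 * t z \<le> s \<and> s \<le> c2 * t z" if z: "z \<in> Z" for z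
    proof -
      \<comment> \<open>The product pulled back by z: its squared norm is t z and its coefficients
        are the inner products of \<open>g\<close> with the translated modulations.\<close>
      define F where "F x = g (z \<otimes> x) * cnj (f x)" for x
      have gz[measurable]: "(\<lambda>x. g (z \<otimes> x)) \<in> borel_measurable \<mu>"
        by (rule measurable_compose[OF measurable_left[OF ZG(1)[OF z]] g])
      have Fm: "F \<in> borel_measurable \<mu>" unfolding F_def by measurable
      have F\<phi>: "(cmod (F x))\<^sup>2 = \<phi> z (z \<otimes> x)" if "x \<in> carrier G" for x
        using that ZG[OF z] by (simp add: F_def \<phi>_def norm_mult power_mult_distrib m_assoc[symmetric])
      have "integrable \<mu> (\<lambda>x. \<phi> z (z \<otimes> x))" by (rule integrable_left_translate[OF ZG(1)[OF z] \<phi>i[OF z]])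
      then have Fi: "integrable \<mu> (\<lambda>x. (cmod (F x))\<^sup>2)"
        by (subst Bochner_Integration.integrable_cong[OF refl, of \<mu> _ "\<lambda>x. \<phi> z (z \<otimes> x)"]) (auto simp: F\<phi>)
      have "(LINT x|\<mu>. (cmod (F x))\<^sup>2) = (LINT x|\<mu>. \<phi> z (z \<otimes> x))"
        by (rule Bochner_Integration.integral_cong) (auto simp: F\<phi>)
      also have "\<dots> = t z"
        unfolding t_def by (rule real_integral_left_translate[OF ZG(1)[OF z] \<phi>m[OF z]])
      finally have Ft: "(LINT x|\<mu>. (cmod (F x))\<^sup>2) = t z" .
      have coef: "(LINT x|\<mu>. F x * cnj (e k x)) = L2_inner \<mu> g (\<lambda>h. e k (inv z \<otimes> h) * f (inv z \<otimes> h))"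
        if k: "k \<in> I" for k
      proof -
        let ?\<psi> = "\<lambda>h. g h * cnj (e k (inv z \<otimes> h) * f (inv z \<otimes> h))"
        have "?\<psi> \<in> borel_measurable \<mu>" using z k by measurable
        from integral_left_translate[OF ZG(1)[OF z] this]
        have "(LINT h|\<mu>. ?\<psi> h) = (LINT x|\<mu>. ?\<psi> (z \<otimes> x))" by simp
        also have "\<dots> = (LINT x|\<mu>. F x * cnj (e k x))"
          by (rule Bochner_Integration.integral_cong[OF refl])
             (use ZG[OF z] in \<open>simp add: F_def m_assoc[symmetric]\<close>)
        finally show ?thesis by (simp add: L2_inner_def)
      qed
      have "F x = 0" if "x \<in> carrier G" "x \<notin> S" for x using f(2)[OF that] by (simp add: F_def)
      from loc[OF Fm Fi this] obtain s where
        s: "((\<lambda>k. (cmod (LINT x|\<mu>. F x * cnj (e k x)))\<^sup>2) has_sum s) I" "c1 * t z \<le> s" "s \<le> c2 * t z"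
        unfolding Ft by auto
      have "(?q z has_sum s) I"
        using s(1) by (rule has_sum_cong[THEN iffD1, rotated]) (simp add: coef)
      then show ?thesis using s by blast
    qed
    then have "\<forall>z\<in>Z. \<exists>s. (?q z has_sum s) I \<and> c1 * t z \<le> s \<and> s \<le> c2 * t z" by (rule ballI)
    then obtain s where s: "\<forall>z\<in>Z. (?q z has_sum s z) I \<and> c1 * t z \<le> s z \<and> s z \<le> c2 * t z"
      by (rule bchoice[THEN exE])
    have s0: "0 \<le> s z" if "z \<in> Z" for z
    proof -
      have "0 \<le> c1 * t z" using c t0 by simp
      also have "\<dots> \<le> s z" using s that by blast
      finally show ?thesis .
    qed
    have c1t: "((\<lambda>z. c1 * t z) has_sum (c1 * r)) Z" and c2t: "((\<lambda>z. c2 * t z) has_sum (c2 * r)) Z"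
      using tr by (auto intro: has_sum_cmult_right)
    have ssum: "s summable_on Z"
      by (rule summable_on_comparison_test[OF has_sum_imp_summable[OF c2t]]) (use s s0 in auto)
    have si: "(s has_sum infsum s Z) Z" using ssum by (rule has_sum_infsum)
    have b1: "c1 * r \<le> infsum s Z" by (rule has_sum_mono[OF c1t si]) (use s in auto)
    have b2: "infsum s Z \<le> c2 * r" by (rule has_sum_mono[OF si c2t]) (use s in auto)
    have qs: "(?q z has_sum s z) I" if "z \<in> Z" for z using s that by blast
    let ?Q = "\<lambda>p. ?q (fst p) (snd p)"
    have qs': "((\<lambda>k. ?Q (z, k)) has_sum s z) I" if "z \<in> Z" for z using qs[OF that] by simp
    have "?Q summable_on (Z \<times> I)"
      by (rule summable_on_SigmaI[where g = s]) (use qs' ssum in auto)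
    then have "(?Q has_sum infsum s Z) (Z \<times> I)"
      by (rule has_sum_SigmaI[where g = s, rotated 2]) (use qs' si in auto)
    moreover have "c1 * a * n \<le> infsum s Z"
    proof -
      have "c1 * (a * n) \<le> c1 * r" using rb(1) c by (intro mult_left_mono) auto
      then show ?thesis using b1 by (simp add: mult.assoc)
    qed
    moreover have "infsum s Z \<le> c2 * max a b * n"
    proof -
      have "r \<le> max a b * n" using rb(2) n0 by (meson max.cobounded2 mult_right_mono order_trans)
      then have "c2 * r \<le> c2 * (max a b * n)" using c by (intro mult_left_mono) auto
      then show ?thesis using b2 by (simp add: mult.assoc)
    qed
    ultimately show "\<exists>r. (?Q has_sum r) (Z \<times> I) \<and> c1 * a * L2_norm_sq \<mu> g \<le> r \<and> r \<le> c2 * max a b * L2_norm_sq \<mu> g"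
      unfolding n_def by blast
  qed
qed

end

subsection \<open>Coordinates from a functional-valued immersion\<close>

lemma continuous_det_matrix:
  fixes D :: "'a::topological_space \<Rightarrow> real^'n \<Rightarrow> real^'n"
  assumes "\<And>a. continuous_on S (\<lambda>x. D x a)"
  shows "continuous_on S (\<lambda>x. det (matrix (D x)))"
  unfolding det_def matrix_def by (simp, intro continuous_intros assms)

text \<open>Continuity of the derivative at x0, where it is the identity, gives local injectivity,
  and continuity of the determinant keeps the Jacobian near 1. The factors 1/2 and 2 are any fixed
  bounds around 1.\<close>

lemma near_identity:
  fixes T :: "real^'n::{finite,wellorder} \<Rightarrow> real^'n::_"
  assumes U: "open U" "x0 \<in> U"
    and der: "\<And>x. x \<in> U \<Longrightarrow> (T has_derivative D x) (at x)" and D0: "D x0 = id"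
    and cont: "\<And>a. continuous_on U (\<lambda>x. D x a)"
  obtains r where "r > 0" "cball x0 r \<subseteq> U" "inj_on T (cball x0 r)"
    "\<forall>x\<in>cball x0 r. 1/2 \<le> \<bar>det (matrix (D x))\<bar> \<and> \<bar>det (matrix (D x))\<bar> \<le> 2"
proof -
  \<comment> \<open>Continuity is given direction by direction; the sum over a basis dominates the
    operator norm of the difference and upgrades it to norm continuity.\<close>
  let ?n = "\<lambda>x. \<Sum>b\<in>Basis. norm (D x b - D x0 b)"
  have cn: "continuous_on U ?n" by (intro continuous_intros cont)
  have "\<exists>d>0. \<forall>x. dist x0 x < d \<longrightarrow> x \<in> U \<and> ?n x < e" if e: "e > 0" for e :: real
  proof -
    have "open (U \<inter> ?n -` {..<e})" by (rule continuous_open_preimage[OF cn U(1)]) simp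
    moreover have "x0 \<in> U \<inter> ?n -` {..<e}" using U e by simp
    ultimately obtain d where "d > 0" "ball x0 d \<subseteq> U \<inter> ?n -` {..<e}" by (rule openE)
    then show ?thesis by (intro exI[of _ d]) (auto simp: subset_iff)
  qed
  then have small: "\<exists>d>0. \<forall>x. dist x0 x < d \<longrightarrow> onorm (\<lambda>v. D x v - D x0 v) < e" if "e > 0" for e :: real
  proof -
    from \<open>\<And>e. 0 < e \<Longrightarrow> \<exists>d>0. \<forall>x. dist x0 x < d \<longrightarrow> x \<in> U \<and> ?n x < e\<close>[OF that]
    obtain d where d: "d > 0" "\<forall>x. dist x0 x < d \<longrightarrow> x \<in> U \<and> ?n x < e" by auto
    have "onorm (\<lambda>v. D x v - D x0 v) < e" if "dist x0 x < d" for x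
    proof -
      have xU: "x \<in> U" "?n x < e" using d that by auto
      have lin: "linear (\<lambda>v. D x v - D x0 v)"
        using has_derivative_linear[OF der[OF xU(1)]] has_derivative_linear[OF der[OF U(2)]]
        by (rule linear_compose_sub)
      have "norm (D x v - D x0 v) \<le> ?n x * norm v" for v
      proof -
        have "D x v - D x0 v = (\<lambda>v. D x v - D x0 v) (\<Sum>b\<in>Basis. (v \<bullet> b) *\<^sub>R b)" by (simp add: euclidean_representation)
        also have "\<dots> = (\<Sum>b\<in>Basis. (v \<bullet> b) *\<^sub>R (D x b - D x0 b))"
          unfolding linear_sum[OF lin] linear_scale[OF lin] ..
        also have "norm \<dots> \<le> (\<Sum>b\<in>Basis. norm v * norm (D x b - D x0 b))"
          by (rule sum_norm_le) (simp add: mult_right_mono Basis_le_norm)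
        finally show ?thesis by (simp add: sum_distrib_left mult.commute)
      qed
      then have "onorm (\<lambda>v. D x v - D x0 v) \<le> ?n x" by (rule onorm_le)
      then show ?thesis using xU(2) by simp
    qed
    then show ?thesis using d(1) by blast
  qed
  obtain r1 where r1: "r1 > 0" "ball x0 r1 \<subseteq> U" "inj_on T (ball x0 r1)"
  proof (rule has_derivative_locally_injective[OF U(2,1), of id D T])
    show "id \<circ> D x0 = id" by (simp add: D0)
  qed (use der small in \<open>auto simp: id_def bounded_linear_ident\<close>)
  let ?d = "\<lambda>x. \<bar>det (matrix (D x))\<bar>"
  have "continuous_on U ?d" by (intro continuous_intros continuous_det_matrix cont)
  then have "open (U \<inter> ?d -` {1/2<..<2})" by (rule continuous_open_preimage[OF _ U(1)]) simp
  moreover have "x0 \<in> U \<inter> ?d -` {1/2<..<2}" using U D0 by (simp add: matrix_id[unfolded id_def] id_def)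
  ultimately obtain r2 where r2: "r2 > 0" "ball x0 r2 \<subseteq> U \<inter> ?d -` {1/2<..<2}" by (rule openE)
  define r where "r = min r1 r2 / 2"
  have r: "r > 0" "cball x0 r \<subseteq> ball x0 r1" "cball x0 r \<subseteq> ball x0 r2" using r1 r2 by (auto simp: r_def)
  show thesis
  proof (rule that[OF r(1)])
    show "cball x0 r \<subseteq> U" using r(2) r1(2) by simp
    show "inj_on T (cball x0 r)" using r1(3) r(2) by (rule inj_on_subset)
    have "cball x0 r \<subseteq> U \<inter> ?d -` {1/2<..<2}" using r(3) r2(2) by (rule order_trans)
    then show "\<forall>x\<in>cball x0 r. 1/2 \<le> ?d x \<and> ?d x \<le> 2" by (auto simp: subset_iff)
  qed
qed

text \<open>For an injective map the change of variables formula is an equality, so a lower bound on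
  the Jacobian integrates to a lower bound on the image; the upper bound makes the Jacobian
  integrable.\<close>

lemma emeasure_differentiable_image_ge:
  fixes f :: "real^'n::{finite,wellorder} \<Rightarrow> real^'n::_"
  assumes S: "S \<in> sets borel" "bounded S" and im: "f ` S \<in> sets borel" and inj: "inj_on f S"
    and der: "\<And>x. x \<in> S \<Longrightarrow> (f has_derivative f' x) (at x)"
    and B: "\<And>x. x \<in> S \<Longrightarrow> C \<le> \<bar>det (matrix (f' x))\<bar> \<and> \<bar>det (matrix (f' x))\<bar> \<le> B" "C \<ge> 0"
  shows "ennreal C * emeasure lborel S \<le> emeasure lborel (f ` S)"
proof -
  have Sl: "S \<in> lmeasurable" using S by (intro bounded_set_imp_lmeasurable) auto
  have der': "(f has_derivative f' x) (at x within S)" if "x \<in> S" for x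
    using der[OF that] by (rule has_derivative_at_withinI)
  have int: "(\<lambda>x. \<bar>det (matrix (f' x))\<bar>) integrable_on S"
  proof (rule measurable_bounded_by_integrable_imp_integrable[where g = "\<lambda>_. B"])
    have "(\<lambda>x. det (matrix (f' x))) \<in> borel_measurable (lebesgue_on S)"
      by (rule borel_measurable_det_Jacobian) (use Sl der' in auto)
    then show "(\<lambda>x. \<bar>det (matrix (f' x))\<bar>) \<in> borel_measurable (lebesgue_on S)" by measurable
    show "(\<lambda>_. B) integrable_on S" using Sl by (rule integrable_on_const)
  qed (use Sl B in auto)
  have "C * measure lebesgue S = integral S (\<lambda>_. C)"
    using Sl integral_mult_right[of S C "\<lambda>_. 1"] by (simp add: lmeasure_integral)
  also have "\<dots> \<le> integral S (\<lambda>x. \<bar>det (matrix (f' x))\<bar>)"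
    by (rule integral_le[OF integrable_on_const[OF Sl] int]) (use B in auto)
  also have "\<dots> = measure lebesgue (f ` S)"
    by (rule measure_differentiable_image_eq[symmetric]) (use Sl der' inj int in auto)
  finally have m: "C * measure lebesgue S \<le> measure lebesgue (f ` S)" .
  have l: "f ` S \<in> lmeasurable"
    by (rule measurable_bounded_differentiable_image[OF Sl der' int, of B]) (use B in auto)
  have "ennreal C * emeasure lborel S = ennreal C * emeasure lebesgue S" using S by simp
  also have "\<dots> = ennreal (C * measure lebesgue S)"
    using Sl B(2) by (simp add: ennreal_mult emeasure_eq_measure2)
  also have "\<dots> \<le> ennreal (measure lebesgue (f ` S))" using m by (rule ennreal_leI)
  also have "\<dots> = emeasure lborel (f ` S)" using emeasure_eq_measure2[OF l] im by simp
  finally show ?thesis .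
qed

text \<open>The map w represents Y by the functional a -> A a Y through the inner product. A vector
  orthogonal to its range would pair to zero with every Y, so w is onto, and \<open>R\<close> is a
  linear right inverse.\<close>

lemma dual_vectors:
  fixes A :: "'e::euclidean_space \<Rightarrow> 'n::real_vector \<Rightarrow> real"
  assumes lin1: "\<And>Y. linear (\<lambda>a. A a Y)" and lin2: "\<And>a. linear (A a)"
    and inj: "\<And>a. (\<And>Y. A a Y = 0) \<Longrightarrow> a = 0"
  obtains R where "linear R" "\<forall>a b. A a (R b) = a \<bullet> b"
proof -
  define w where "w Y = (\<Sum>b\<in>Basis. A b Y *\<^sub>R b)" for Y
  have w: "A a Y = a \<bullet> w Y" for a Y
  proof -
    have "A a Y = (\<lambda>a. A a Y) (\<Sum>b\<in>Basis. (a \<bullet> b) *\<^sub>R b)" by (simp add: euclidean_representation)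
    also have "\<dots> = (\<Sum>b\<in>Basis. (a \<bullet> b) * A b Y)"
      unfolding linear_sum[OF lin1] linear_scale[OF lin1] by simp
    finally show ?thesis by (simp add: w_def inner_sum_right mult.commute)
  qed
  have linw: "linear w"
    by (rule linearI) (simp_all add: w_def linear_add[OF lin2] linear_scale[OF lin2] scaleR_add_left sum.distrib scaleR_sum_right)
  have "span (range w) = UNIV"
  proof (rule ccontr)
    assume "span (range w) \<noteq> UNIV"
    then obtain a where a: "a \<noteq> 0" "\<forall>x\<in>span (range w). a \<bullet> x = 0" using span_not_UNIV_orthogonal by blast
    then have "A a Y = 0" for Y unfolding w by (simp add: span_base)
    then show False using inj a(1) by blast
  qed
  moreover have "span (range w) = range w"
    using linear_subspace_image[OF linw subspace_UNIV] by (simp add: span_eq_iff)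
  ultimately have "surj w" by simp
  then obtain R where R: "linear R" "w \<circ> R = id" using linear_surjective_right_inverse[OF linw] by blast
  have "A a (R b) = a \<bullet> b" for a b unfolding w using R(2) by (metis comp_apply id_apply)
  then show thesis using that R(1) by blast
qed

text \<open>Provides the Jacobian data for \<open>haar_lebesgue\<close>: right translation in
  coordinates is differentiated as the partial derivative of multiplication in its first argument,
  which is continuous in both arguments.\<close>

lemma (in haar) haar_lebesgue_chart:
  fixes L :: "real ^ 'g coord_index \<Rightarrow> 'g"
  assumes L: "bounded_linear L" "bounded_linear L'" "\<And>x. L' (L x) = x" "\<And>y. L (L' y) = y"
    and c: "c \<in> A" "\<one> \<in> fst c"
  obtains P c1 c2 where "nbhd P" "P \<subseteq> fst c" "0 < c1" "0 < (c2::real)" "emeasure \<mu> P < \<infinity>"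
    "\<forall>B\<in>sets \<mu>. B \<subseteq> P \<longrightarrow> (\<lambda>x. L' (snd c x)) ` B \<in> sets borel \<and> emeasure lborel ((\<lambda>x. L' (snd c x)) ` B) < \<infinity> \<and>
      ennreal c1 * emeasure lborel ((\<lambda>x. L' (snd c x)) ` B) \<le> emeasure \<mu> B \<and>
      emeasure \<mu> B \<le> ennreal c2 * emeasure lborel ((\<lambda>x. L' (snd c x)) ` B)"
proof -
  let ?V = "fst c" and ?\<psi> = "\<lambda>x. L' (snd c x)" and ?\<psi>i = "\<lambda>u. chart_inv c (L u)"
  interpret P: manifold "prod_atlas A A" by standard (rule smooth_manifold_prod[OF smooth_manifold smooth_manifold])
  have V: "nbhd ?V" using chart_openin[OF c(1)] c(2) by simp
  have img: "?\<psi> ` ?V = L -` (snd c ` ?V)"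
  proof
    show "L -` (snd c ` ?V) \<subseteq> ?\<psi> ` ?V"
    proof
      fix u assume "u \<in> L -` (snd c ` ?V)"
      then obtain x where "L u = snd c x" "x \<in> ?V" by auto
      then show "u \<in> ?\<psi> ` ?V" using L(3)[of u] by (intro image_eqI[of _ _ x]) auto
    qed
  qed (use L(4) in auto)
  have oV: "open (?\<psi> ` ?V)"
    unfolding img by (rule open_vimage[OF chart_open_image[OF c(1)] linear_continuous_on[OF L(1)]])
  have hom: "homeomorphism ?V (?\<psi> ` ?V) ?\<psi> ?\<psi>i"
  proof (rule homeomorphismI)
    show "continuous_on ?V ?\<psi>"
      by (rule bounded_linear.continuous_on[OF L(2) continuous_on_chart[OF c(1)]])
    show "continuous_on (?\<psi> ` ?V) ?\<psi>i"
      by (rule continuous_on_compose2[OF continuous_on_chart_inv[OF c(1)] linear_continuous_on[OF L(1)]]) (use img in auto)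
  qed (use c L in auto)
  let ?p = "(?V \<times> ?V, map_prod (snd c) (snd c))"
  have p: "?p \<in> prod_atlas A A" unfolding prod_atlas_def using c(1) by blast
  note inv = chart_inv_prod[OF inj_on_chart[OF c(1)] inj_on_chart[OF c(1)]]
  have S: "smooth_map (prod_atlas A A) A (\<lambda>p. fst p \<otimes> snd p)"
    using lie_group unfolding lie_group_def by (simp add: case_prod_beta')
  define Q where "Q = snd ?p ` (fst ?p \<inter> (\<lambda>p. fst p \<otimes> snd p) -` ?V)"
  define q where "q w = snd c ((\<lambda>p. fst p \<otimes> snd p) (chart_inv ?p w))" for w
  have q: "smooth_on Q q" unfolding Q_def q_def
    by (rule P.smooth_map_imp_chart[OF S p c(1)])
  define D where "D = {(u, v). u \<in> ?\<psi> ` ?V \<and> v \<in> ?\<psi> ` ?V \<and> ?\<psi>i u \<otimes> ?\<psi>i v \<in> ?V}"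
  have DQ: "(L u, L v) \<in> Q" if uv: "(u, v) \<in> D" for u v
  proof -
    have "u \<in> ?\<psi> ` ?V" "v \<in> ?\<psi> ` ?V" "?\<psi>i u \<otimes> ?\<psi>i v \<in> ?V" using uv by (auto simp: D_def)
    then have *: "L u \<in> snd c ` ?V" "L v \<in> snd c ` ?V" "?\<psi>i u \<otimes> ?\<psi>i v \<in> ?V" unfolding img by auto
    then have "(?\<psi>i u, ?\<psi>i v) \<in> fst ?p \<inter> (\<lambda>p. fst p \<otimes> snd p) -` ?V" using chart_inv_in[OF c(1)] by auto
    moreover have "(L u, L v) = snd ?p (?\<psi>i u, ?\<psi>i v)" using * chart_chart_inv[OF c(1)] by simp
    ultimately show ?thesis unfolding Q_def by (rule image_eqI[rotated])
  qed
  define M1 where "M1 p a = L' (frechet_derivative q (at (L (fst p), L (snd p))) (L a, 0))" for p a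
  have der: "((\<lambda>u. ?\<psi> (?\<psi>i u \<otimes> ?\<psi>i v)) has_derivative M1 (u, v)) (at u)" if uv: "(u, v) \<in> D" for u v
  proof -
    have dq: "(q has_derivative frechet_derivative q (at (L u, L v))) (at (L u, L v))"
      using smooth_on_differentiable[OF q DQ[OF uv]] by (simp add: frechet_derivative_works)
    have "((\<lambda>u. (L u, L v)) has_derivative (\<lambda>a. (L a, 0))) (at u)"
      by (intro has_derivative_Pair bounded_linear_imp_has_derivative L(1) has_derivative_const)
    from has_derivative_compose[OF this dq]
    have "((\<lambda>u. L' (q (L u, L v))) has_derivative M1 (u, v)) (at u)"
      unfolding M1_def by (intro bounded_linear.has_derivative[OF L(2)]) simp
    then show ?thesis
    proof (rule has_derivative_transform_within_open[OF _ oV])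
      show "u \<in> ?\<psi> ` ?V" using uv by (simp add: D_def)
      fix u' assume "u' \<in> ?\<psi> ` ?V"
      then have "L u' \<in> snd c ` ?V" "L v \<in> snd c ` ?V" using uv unfolding img D_def by auto
      then show "L' (q (L u', L v)) = ?\<psi> (?\<psi>i u' \<otimes> ?\<psi>i v)" by (simp add: q_def inv)
    qed
  qed
  have cont: "continuous_on D (\<lambda>p. M1 p a)" for a
    unfolding M1_def
  proof (rule bounded_linear.continuous_on[OF L(2)], rule continuous_on_compose2[of Q "\<lambda>w. frechet_derivative q (at w) (L a, 0)" D "\<lambda>p. (L (fst p), L (snd p))"])
    show "continuous_on Q (\<lambda>w. frechet_derivative q (at w) (L a, 0))"
      by (rule Ck_on_imp_continuous[OF smooth_on_imp_Ck[OF smooth_on_frechet_derivative[OF q]]])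
    show "continuous_on D (\<lambda>p. (L (fst p), L (snd p)))"
      by (intro continuous_on_Pair bounded_linear.continuous_on[OF L(1)] continuous_fst_on continuous_snd_on)
    show "(\<lambda>p. (L (fst p), L (snd p))) ` D \<subseteq> Q" using DQ by auto
  qed
  show thesis
    by (rule haar_lebesgue[OF V hom oV D_def der cont]) (assumption, rule that)
qed

subsection \<open>The local system of characters\<close>

locale semidirect = lie_pair G AG N AN H AH for G :: "('a::{t2_space, second_countable_topology}) monoid" (structure)
    and AG :: "('a, 'g::finite_dim_normed) atlas" and N :: "'a set"
    and AN :: "('a, 'n::finite_dim_normed) atlas" and H :: "'a set"
    and AH :: "('a, 'h::finite_dim_normed) atlas" +
  fixes \<mu> :: "'a measure" and lam :: "'n \<Rightarrow>\<^sub>L real"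
  assumes haarH: "left_haar_measure (G\<lparr>carrier := H\<rparr>) \<mu>"
    and immersion: "immersion_at AH vector_space_atlas (\<lambda>h. coad G AG AN (inv h) lam) \<one>"
begin

sublocale HH: haar "G\<lparr>carrier := H\<rparr>" AH \<mu>
  by unfold_locales (rule haarH)

definition orbit :: "'a \<Rightarrow> 'n \<Rightarrow> real" where
  "orbit h Y = blinfun_apply (coad G AG AN (inv h) lam) Y"

text \<open>The character of \<open>N\<close> with functional Ad(h^-1)^* lambda at exp Y, regarded
  as a function of h: the factor by which exp Y acts.\<close>

definition orbit_char :: "'n \<Rightarrow> 'a \<Rightarrow> complex" where
  "orbit_char Y h = exp (2 * of_real pi * \<i> * of_real (orbit h Y))"

lemma orbit_char_cis: "orbit_char Y h = cis (2 * pi * orbit h Y)"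
  by (simp add: orbit_char_def cis_conv_exp mult_ac)

lemma linear_orbit: "linear (orbit h)"
  unfolding orbit_def by (intro bounded_linear.linear blinfun.bounded_linear_right)

lemma invH: "h \<in> H \<Longrightarrow> inv\<^bsub>G\<lparr>carrier := H\<rparr>\<^esub> h = inv h"
  using m_inv_consistent[OF subgroupH] .

lemma smooth_orbit: "smooth_map AH vector_space_atlas (\<lambda>h. orbit h Y)"
  unfolding orbit_def by (rule smooth_coad_apply)

lemma continuous_orbit: "continuous_on H (\<lambda>h. orbit h Y)"
  using smooth_mapD(2)[OF smooth_orbit] pointsH by metis

lemma measurable_orbit_char: "orbit_char Y \<in> borel_measurable \<mu>"
proof (rule HH.continuous_measurable_mu)
  show "continuous_on (carrier (G\<lparr>carrier := H\<rparr>)) (orbit_char Y)"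
    unfolding orbit_char_def by (intro continuous_intros) (simp add: continuous_orbit)
qed

text \<open>The characters indexed by \<open>K\<close> satisfy frame inequalities for functions
  vanishing off \<open>S\<close>. No function \<open>f\<close> occurs, so one neighbourhood serves
  all of them.\<close>

definition local_system :: "'a set \<Rightarrow> 'n set \<Rightarrow> real \<Rightarrow> real \<Rightarrow> bool" where
  "local_system S K c1 c2 \<longleftrightarrow> compact S \<and> S \<subseteq> H \<and> (\<exists>U. openin (top_of_set H) U \<and> \<one> \<in> U \<and> U \<subseteq> S) \<and>
    countable K \<and> 0 < c1 \<and> c1 \<le> c2 \<and>
    (\<forall>F. F \<in> borel_measurable \<mu> \<longrightarrow> integrable \<mu> (\<lambda>x. (cmod (F x))\<^sup>2) \<longrightarrow> (\<forall>x\<in>H. x \<notin> S \<longrightarrow> F x = 0) \<longrightarrow>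
      (\<exists>s. ((\<lambda>Y. (cmod (LINT x|\<mu>. F x * cnj (orbit_char Y x)))\<^sup>2) has_sum s) K \<and>
        c1 * (LINT x|\<mu>. (cmod (F x))\<^sup>2) \<le> s \<and> s \<le> c2 * (LINT x|\<mu>. (cmod (F x))\<^sup>2)))"

lemma one_H: "\<one> \<in> H" "\<one> \<in> points AH"
  using subgroupH by (auto simp: pointsH subgroup.one_closed)

text \<open>The chart at the identity has a one-point domain, so the identity is an open point of
  positive mass m. Functions supported there are determined by one value, and the trivial character
  alone gives |m F|^2 = m (m |F|^2).\<close>

lemma local_system_dim_0:
  assumes dim: "dim (UNIV :: 'h set) = 0"
  shows "\<exists>S K c1 c2. local_system S K c1 c2"
proof -
  let ?c = "chart_at AH \<one>"
  note c = LH.chart_at[OF one_H(2)]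
  have "x = \<one>" if "x \<in> fst ?c" for x
    using LH.inj_on_chart[OF c(1)] that c(2) dim_0_imp_0[OF dim] by (metis inj_onD)
  then have fc: "fst ?c = {\<one>}" using c(2) by auto
  have op: "openin (top_of_set H) {\<one>}" using LH.chart_openin[OF c(1)] unfolding fc pointsH .
  have sets: "{\<one>} \<in> sets \<mu>" using HH.open_sets_mu[of "{\<one>}"] op by simp
  define m where "m = measure \<mu> {\<one>}"
  have fin: "emeasure \<mu> {\<one>} < \<infinity>" using HH.haar_compact[of "{\<one>}"] one_H by simp
  have "emeasure \<mu> {\<one>} > 0" using HH.haar_open_pos[of "{\<one>}" \<one>] op by simp
  then have m: "m > 0" using fin unfolding m_def
    by (simp add: measure_def enn2real_positive_iff less_top[symmetric])
  have int: "(LINT x|\<mu>. f x) = m *\<^sub>R f \<one>" if "\<And>x. x \<in> H \<Longrightarrow> x \<noteq> \<one> \<Longrightarrow> f x = 0"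
    for f :: "'a \<Rightarrow> 'b::{banach, second_countable_topology}"
  proof -
    have "(LINT x|\<mu>. f x) = (LINT x|\<mu>. indicator {\<one>} x *\<^sub>R f \<one>)"
      by (rule Bochner_Integration.integral_cong) (use that in \<open>auto simp: indicator_def\<close>)
    also have "\<dots> = m *\<^sub>R f \<one>"
      unfolding m_def using sets fin one_H
      by (subst integral_scaleR_left) (auto intro: integrable_real_indicator)
    finally show ?thesis .
  qed
  have "local_system {\<one>} {0} m m" unfolding local_system_def
  proof (intro conjI allI impI)
    show "\<exists>U. openin (top_of_set H) U \<and> \<one> \<in> U \<and> U \<subseteq> {\<one>}" using op by blast
    fix F assume F: "\<forall>x\<in>H. x \<notin> {\<one>} \<longrightarrow> F x = (0 :: complex)"
    have z: "orbit_char 0 x = 1" for x by (simp add: orbit_char_def linear_0[OF linear_orbit])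
    have 1: "(LINT x|\<mu>. F x * cnj (orbit_char 0 x)) = m *\<^sub>R F \<one>" unfolding z using F by (subst int) auto
    have 2: "(LINT x|\<mu>. (cmod (F x))\<^sup>2) = m * (cmod (F \<one>))\<^sup>2" using F by (subst int) auto
    have "((\<lambda>Y. (cmod (LINT x|\<mu>. F x * cnj (orbit_char Y x)))\<^sup>2) has_sum (\<Sum>Y\<in>{0}. (cmod (LINT x|\<mu>. F x * cnj (orbit_char Y x)))\<^sup>2)) {0}"
      by (rule has_sum_finite) simp
    moreover have "(\<Sum>Y\<in>{0}. (cmod (LINT x|\<mu>. F x * cnj (orbit_char Y x)))\<^sup>2) = m * (LINT x|\<mu>. (cmod (F x))\<^sup>2)"
      unfolding 2 using m by (simp add: 1 power_mult_distrib power2_eq_square[of m])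
    ultimately show "\<exists>s. ((\<lambda>Y. (cmod (LINT x|\<mu>. F x * cnj (orbit_char Y x)))\<^sup>2) has_sum s) {0} \<and>
        m * (LINT x|\<mu>. (cmod (F x))\<^sup>2) \<le> s \<and> s \<le> m * (LINT x|\<mu>. (cmod (F x))\<^sup>2)" by auto
  qed (use m one_H in auto)
  then show ?thesis by blast
qed

lemma tangent_orbit:
  "frechet_derivative (\<lambda>u. orbit (chart_inv (chart_at AH \<one>) u) Y) (at (snd (chart_at AH \<one>) \<one>)) v =
    blinfun_apply (tangent_map AH vector_space_atlas (\<lambda>h. coad G AG AN (inv h) lam) \<one> v) Y"
  unfolding tangent_coad by (simp add: tangent_map_def orbit_def comp_def)

lemma smooth_on_orbit:
  assumes "c \<in> AH"
  shows "smooth_on (snd c ` fst c) (\<lambda>u. orbit (chart_inv c u) Y)"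
  using LH.smooth_map_imp_chart[OF smooth_orbit assms, of "(UNIV, id)" Y] by (simp add: vector_space_atlas_def)

text \<open>The derivatives of the functions \<open>h \<mapsto> orbit h Y\<close> separate the tangent vectors, so some of these
  functions form a coordinate system whose derivative at the identity is the identity.\<close>

lemma orbit_dual_vectors:
  fixes L :: "real ^ 'h coord_index \<Rightarrow> 'h"
  assumes L: "bounded_linear L" "bounded_linear L'" "\<And>x. L' (L x) = x" "\<And>y. L (L' y) = y"
  obtains R where "linear R"
    "\<forall>a b. frechet_derivative (\<lambda>u. orbit (chart_inv (chart_at AH \<one>) u) (R b)) (at (snd (chart_at AH \<one>) \<one>)) (L a) = a \<bullet> b"
proof -
  let ?c = "chart_at AH \<one>"
  note c = LH.chart_at[OF one_H(2)]
  let ?T = "tangent_map AH vector_space_atlas (\<lambda>h. coad G AG AN (inv h) lam) \<one>"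
  define A where "A a Y = frechet_derivative (\<lambda>u. orbit (chart_inv ?c u) Y) (at (snd ?c \<one>)) (L a)" for a Y
  have AT: "A a Y = blinfun_apply (?T (L a)) Y" for a Y unfolding A_def tangent_orbit ..
  have lin0: "linear (frechet_derivative (\<lambda>u. orbit (chart_inv ?c u) Y) (at (snd ?c \<one>)))" for Y
    by (rule linear_frechet_derivative, rule smooth_on_differentiable[OF smooth_on_orbit[OF c(1)]]) (use c in auto)
  have linA: "linear (\<lambda>a. A a Y)" for Y
    unfolding A_def using linear_compose[OF bounded_linear.linear[OF L(1)] lin0] by (simp add: comp_def)
  have linA': "linear (A a)" for a
    unfolding AT[abs_def] by (intro bounded_linear.linear blinfun.bounded_linear_right)
  have T0: "?T 0 = 0"
    by (rule blinfun_eqI) (simp add: tangent_orbit[symmetric] linear_0[OF lin0])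
  have "a = 0" if "\<And>Y. A a Y = 0" for a
  proof -
    have "?T (L a) = 0" by (rule blinfun_eqI) (use that in \<open>simp add: AT[symmetric]\<close>)
    then have "L a = 0" using T0 immersion unfolding immersion_at_def by (metis injD)
    then show "a = 0" using L(3)[of a] L(3)[of 0] linear_0[OF bounded_linear.linear[OF L(1)]] by simp
  qed
  from dual_vectors[OF linA linA' this] obtain R where "linear R" "\<forall>a b. A a (R b) = a \<bullet> b" by blast
  then show thesis using that unfolding A_def by blast
qed

text \<open>The dual vectors \<open>R\<close> fix the lattice; the neighbourhood is then shrunk
  until its coordinate image fits into the unit cube. Haar measure pushed forward to that image is
  comparable to Lebesgue measure there, so \<open>weighted_Parseval\<close> applies.\<close>

lemma local_system_exists:
  assumes dim: "dim (UNIV :: 'h set) \<noteq> 0"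
  shows "\<exists>S K c1 c2. local_system S K c1 c2"
proof -
  obtain L :: "real ^ 'h coord_index \<Rightarrow> 'h" and L' where L: "bounded_linear L" "bounded_linear L'"
    "\<And>x. L' (L x) = x" "\<And>y. L (L' y) = y"
    using coordinate_homeomorphism[OF dim] by blast
  let ?c = "chart_at AH \<one>"
  note c = LH.chart_at[OF one_H(2)]
  have c1: "\<one>\<^bsub>G\<lparr>carrier := H\<rparr>\<^esub> \<in> fst ?c" using c(2) by simp
  let ?\<psi> = "\<lambda>x. L' (snd ?c x)" and ?\<psi>i = "\<lambda>u. chart_inv ?c (L u)"
  obtain P a1 a2 where P': "openin (top_of_set (carrier (G\<lparr>carrier := H\<rparr>))) P \<and> \<one>\<^bsub>G\<lparr>carrier := H\<rparr>\<^esub> \<in> P"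
      "P \<subseteq> fst ?c" and a: "0 < a1" "0 < (a2::real)" and Pfin: "emeasure \<mu> P < \<infinity>"
    and comp: "\<forall>B\<in>sets \<mu>. B \<subseteq> P \<longrightarrow> ?\<psi> ` B \<in> sets borel \<and> emeasure lborel (?\<psi> ` B) < \<infinity> \<and>
      ennreal a1 * emeasure lborel (?\<psi> ` B) \<le> emeasure \<mu> B \<and>
      emeasure \<mu> B \<le> ennreal a2 * emeasure lborel (?\<psi> ` B)"
    by (rule HH.haar_lebesgue_chart[OF L c(1) c1])
  have P: "openin (top_of_set H) P" "\<one> \<in> P" "P \<subseteq> fst ?c" "P \<subseteq> H"
    using P' by (auto dest: openin_imp_subset)
  obtain R where R: "linear R"
    "\<forall>a b. frechet_derivative (\<lambda>u. orbit (chart_inv ?c u) (R b)) (at (snd ?c \<one>)) (L a) = a \<bullet> b"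
    by (rule orbit_dual_vectors[OF L])
  let ?V = "L -` (snd ?c ` fst ?c)"
  let ?x0 = "?\<psi> \<one>"
  let ?o = "\<lambda>Y u. orbit (chart_inv ?c u) Y"
  \<comment> \<open>The shift places the identity at the centre of the unit cube. It alters
    characters only by constant phases, invisible in absolute values.\<close>
  define d where "d = (1/2) *\<^sub>R One - (\<Sum>b\<in>Basis. orbit \<one> (R b) *\<^sub>R b)"
  define T where "T x = (\<Sum>b\<in>Basis. ?o (R b) (L x) *\<^sub>R b) + d" for x
  define D where "D x a = (\<Sum>b\<in>Basis. frechet_derivative (?o (R b)) (at (L x)) (L a) *\<^sub>R b)" for x a
  have oV: "open ?V" by (rule open_vimage[OF LH.chart_open_image[OF c(1)] linear_continuous_on[OF L(1)]])
  have Lx0: "L ?x0 = snd ?c \<one>" by (rule L(4))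
  have der: "(T has_derivative D x) (at x)" if x: "x \<in> ?V" for x
  proof -
    have "((\<lambda>x. ?o (R b) (L x)) has_derivative (\<lambda>a. frechet_derivative (?o (R b)) (at (L x)) (L a))) (at x)" for b
    proof (rule has_derivative_compose[OF bounded_linear_imp_has_derivative[OF L(1)]])
      show "(?o (R b) has_derivative frechet_derivative (?o (R b)) (at (L x))) (at (L x))"
        using smooth_on_differentiable[OF smooth_on_orbit[OF c(1)]] x by (simp add: frechet_derivative_works)
    qed
    then have "((\<lambda>x. (\<Sum>b\<in>Basis. ?o (R b) (L x) *\<^sub>R b) + d) has_derivative (\<lambda>a. D x a + 0)) (at x)"
      unfolding D_def by (intro has_derivative_add has_derivative_sum has_derivative_scaleR_left has_derivative_const)
    then show ?thesis by (simp add: T_def[abs_def])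
  qed
  have D0: "D ?x0 = id" unfolding D_def Lx0 using R(2) by (auto simp: euclidean_representation)
  have contD: "continuous_on ?V (\<lambda>x. D x a)" for a
  proof -
    have "continuous_on ?V (\<lambda>x. frechet_derivative (?o (R b)) (at (L x)) (L a))" for b
    proof (rule continuous_on_compose2[of "snd ?c ` fst ?c" "\<lambda>w. frechet_derivative (?o (R b)) (at w) (L a)" ?V L])
      show "continuous_on (snd ?c ` fst ?c) (\<lambda>w. frechet_derivative (?o (R b)) (at w) (L a))"
        by (rule Ck_on_imp_continuous[OF smooth_on_imp_Ck[OF smooth_on_frechet_derivative[OF smooth_on_orbit[OF c(1)]]]])
    qed (auto intro: linear_continuous_on[OF L(1)])
    then show ?thesis unfolding D_def by (intro continuous_intros)
  qed
  have contT: "continuous_on ?V T"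
    using der oV by (meson continuous_on_eq_continuous_at has_derivative_continuous)
  have T0: "T ?x0 = (1/2) *\<^sub>R One" using c by (simp add: T_def Lx0 d_def)
  have oP: "open (L -` (snd ?c ` P))"
  proof -
    have "open (snd ?c ` (fst ?c \<inter> P))" by (rule LH.chart_image_open[OF c(1)]) (use P(1) pointsH in simp)
    moreover have "fst ?c \<inter> P = P" using P(3) by auto
    ultimately show ?thesis by (intro open_vimage linear_continuous_on[OF L(1)]) simp
  qed
  have "open (?V \<inter> T -` box 0 One)" by (rule continuous_open_preimage[OF contT oV open_box])
  \<comment> \<open>Imposed before the ball is chosen: the image must lie in the open cube for
    Parseval, and the points in \<open>P\<close> for the comparison with Haar measure.\<close>
  then have oU: "open ((?V \<inter> T -` box 0 One) \<inter> L -` (snd ?c ` P))" (is "open ?U") using oP by (rule open_Int)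
  have xU: "?x0 \<in> ?U" using c P(2) T0 Lx0 by (auto simp: mem_box inner_sum_left inner_Basis)
  have derU: "(T has_derivative D x) (at x)" if "x \<in> ?U" for x using der that by auto
  have contU: "continuous_on ?U (\<lambda>x. D x a)" for a by (rule continuous_on_subset[OF contD]) auto
  obtain r where r: "r > 0" "cball ?x0 r \<subseteq> ?U" "inj_on T (cball ?x0 r)"
    and det: "\<forall>x\<in>cball ?x0 r. 1/2 \<le> \<bar>det (matrix (D x))\<bar> \<and> \<bar>det (matrix (D x))\<bar> \<le> 2"
    by (rule near_identity[OF oU xU derU D0 contU])
  let ?C = "cball ?x0 r"
  define S where "S = ?\<psi>i ` ?C"
  have \<psi>\<psi>i: "?\<psi> (?\<psi>i u) = u" if "u \<in> ?C" for u
  proof -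
    have "L u \<in> snd ?c ` fst ?c" using that r(2) by auto
    then show ?thesis using LH.chart_chart_inv[OF c(1)] L(3) by simp
  qed
  have \<psi>i\<psi>: "?\<psi>i (?\<psi> h) = h" if "h \<in> fst ?c" for h using that c(1) L(4) by simp
  have SP: "S \<subseteq> P"
  proof
    fix h assume "h \<in> S"
    then obtain u where u: "h = ?\<psi>i u" "u \<in> ?C" unfolding S_def by (rule imageE)
    then have "L u \<in> snd ?c ` P" using r(2) by auto
    then obtain h' where "L u = snd ?c h'" "h' \<in> P" by (rule imageE)
    then show "h \<in> P" using u(1) P(3) c(1) by auto
  qed
  have SH: "S \<subseteq> H" and Sc: "S \<subseteq> fst ?c" using SP P by auto
  have \<psi>S: "?\<psi> h \<in> ?C" if "h \<in> S" for h using that \<psi>\<psi>i by (auto simp: S_def)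
  have cont\<psi>i: "continuous_on ?C ?\<psi>i"
    by (rule continuous_on_compose2[OF LH.continuous_on_chart_inv[OF c(1)] linear_continuous_on[OF L(1)]]) (use r(2) in auto)
  then have cS: "compact S" unfolding S_def by (rule compact_continuous_image) simp
  have Ssets: "S \<in> sets \<mu>" using HH.compact_sets_mu cS SH by simp
  have "openin (top_of_set (fst ?c)) (fst ?c \<inter> ?\<psi> -` ball ?x0 r)"
    by (rule continuous_openin_preimage_gen[OF bounded_linear.continuous_on[OF L(2) LH.continuous_on_chart[OF c(1)]]]) simp
  moreover have "openin (top_of_set H) (fst ?c)" using LH.chart_openin[OF c(1)] unfolding pointsH .
  ultimately have "openin (top_of_set H) (fst ?c \<inter> ?\<psi> -` ball ?x0 r)" by (rule openin_trans)
  moreover have "\<one> \<in> fst ?c \<inter> ?\<psi> -` ball ?x0 r" using c r(1) by simp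
  moreover have "fst ?c \<inter> ?\<psi> -` ball ?x0 r \<subseteq> S"
  proof
    fix h assume "h \<in> fst ?c \<inter> ?\<psi> -` ball ?x0 r"
    then have "h = ?\<psi>i (?\<psi> h)" "?\<psi> h \<in> ?C" using \<psi>i\<psi> by auto
    then show "h \<in> S" unfolding S_def by (rule image_eqI)
  qed
  ultimately have nbhdS: "\<exists>U. openin (top_of_set H) U \<and> \<one> \<in> U \<and> U \<subseteq> S" by blast
  define \<Phi> where "\<Phi> h = T (?\<psi> h)" for h
  have cont\<Phi>: "continuous_on S \<Phi>" unfolding \<Phi>_def
    by (rule continuous_on_compose2[OF contT bounded_linear.continuous_on[OF L(2) continuous_on_subset[OF LH.continuous_on_chart[OF c(1)] Sc]]])
       (use \<psi>S r(2) in auto)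
  have inj\<Phi>: "inj_on \<Phi> S"
  proof (rule inj_onI)
    fix x y assume xy: "x \<in> S" "y \<in> S" "\<Phi> x = \<Phi> y"
    then have "?\<psi> x = ?\<psi> y" using inj_onD[OF r(3)] \<psi>S unfolding \<Phi>_def by blast
    then show "x = y" using \<psi>i\<psi> xy Sc by (metis subsetD)
  qed
  define J where "J = \<Phi> ` S"
  have cJ: "compact J" unfolding J_def by (rule compact_continuous_image[OF cont\<Phi> cS])
  have "T (?\<psi> h) \<in> box 0 One" if "h \<in> S" for h using subsetD[OF r(2) \<psi>S[OF that]] by auto
  then have Jbox: "J \<subseteq> box 0 One" unfolding J_def \<Phi>_def by auto
  have Jsets: "J \<in> sets borel" using cJ by (simp add: borel_compact)
  let ?MS = "restrict_space \<mu> S"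
  have spMS: "space ?MS = S" using SH by (simp add: space_restrict_space Int_absorb2)
  have Sint: "S \<inter> space \<mu> \<in> sets \<mu>" using Ssets SH by (simp add: Int_absorb2)
  have setsMS: "sets ?MS = sets (restrict_space borel S)"
    using HH.sets_mu SH by (simp add: sets_restrict_space_cong[OF HH.sets_mu] sets_restrict_restrict_space Int_absorb1)
  have \<Phi>m: "\<Phi> \<in> measurable ?MS borel"
    using borel_measurable_continuous_on_restrict[OF cont\<Phi>] measurable_cong_sets[OF setsMS refl] by blast
  define \<sigma> where "\<sigma> = distr ?MS borel \<Phi>"
  \<comment> \<open>The Haar constants a1, a2 belong to the chart coordinates; passing to the
    coordinates \<open>\<Phi>\<close> costs a factor 2 on either side, from the Jacobian
    bounds.\<close>
  have bounds: "emeasure \<sigma> A \<le> ennreal (2 * a2) * emeasure lborel (A \<inter> J) \<and>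
      ennreal (a1 / 2) * emeasure lborel (A \<inter> J) \<le> emeasure \<sigma> A" if A: "A \<in> sets borel" for A
  proof -
    let ?B = "\<Phi> -` A \<inter> S"
    have BMS: "?B \<in> sets ?MS" using measurable_sets[OF \<Phi>m A] by (simp add: spMS)
    then have B: "?B \<in> sets \<mu>" using Sint by (simp add: sets_restrict_space_iff)
    have BP: "?B \<subseteq> P" using SP by auto
    have \<sigma>A: "emeasure \<sigma> A = emeasure \<mu> ?B"
      unfolding \<sigma>_def using A \<Phi>m Sint BMS by (simp add: emeasure_distr spMS emeasure_restrict_space)
    have im: "T ` (?\<psi> ` ?B) = A \<inter> J" by (auto simp: J_def \<Phi>_def)
    have sub: "?\<psi> ` ?B \<subseteq> ?C" using \<psi>S by auto
    have bs: "?\<psi> ` ?B \<in> sets borel" using comp B BP by blast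
    have bb: "bounded (?\<psi> ` ?B)" by (rule bounded_subset[OF bounded_cball sub])
    have ims: "T ` (?\<psi> ` ?B) \<in> sets borel" unfolding im using A Jsets by auto
    have dT: "(T has_derivative D x) (at x)" if "x \<in> ?\<psi> ` ?B" for x
      using derU subsetD[OF r(2)] subsetD[OF sub that] by blast
    have dd: "1/2 \<le> \<bar>det (matrix (D x))\<bar> \<and> \<bar>det (matrix (D x))\<bar> \<le> 2" if "x \<in> ?\<psi> ` ?B" for x
      using det subsetD[OF sub that] by blast
    have up: "emeasure lborel (A \<inter> J) \<le> ennreal 2 * emeasure lborel (?\<psi> ` ?B)"
      using emeasure_differentiable_image_le[OF bs bb ims dT, of 2] dd unfolding im by auto
    have low: "ennreal (1/2) * emeasure lborel (?\<psi> ` ?B) \<le> emeasure lborel (A \<inter> J)"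
      using emeasure_differentiable_image_ge[OF bs bb ims inj_on_subset[OF r(3) sub] dT dd] unfolding im by auto
    have \<mu>1: "ennreal a1 * emeasure lborel (?\<psi> ` ?B) \<le> emeasure \<mu> ?B"
      and \<mu>2: "emeasure \<mu> ?B \<le> ennreal a2 * emeasure lborel (?\<psi> ` ?B)" using comp B BP by blast+
    have "ennreal 2 * ennreal (1/2) = 1" by (subst ennreal_mult[symmetric]) simp_all
    then have "emeasure lborel (?\<psi> ` ?B) = (ennreal 2 * ennreal (1/2)) * emeasure lborel (?\<psi> ` ?B)" by (simp only: mult_1_left)
    also have "\<dots> = ennreal 2 * (ennreal (1/2) * emeasure lborel (?\<psi> ` ?B))" by (rule mult.assoc)
    also have "\<dots> \<le> ennreal 2 * emeasure lborel (A \<inter> J)" by (rule mult_left_mono[OF low]) simp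
    finally have "ennreal a2 * emeasure lborel (?\<psi> ` ?B) \<le> ennreal a2 * (ennreal 2 * emeasure lborel (A \<inter> J))"
      by (rule mult_left_mono) simp
    also have "\<dots> = ennreal (2 * a2) * emeasure lborel (A \<inter> J)"
    proof -
      have "ennreal (2 * a2) = ennreal a2 * ennreal 2" using a by (subst ennreal_mult[symmetric]) (simp_all add: mult.commute)
      then show ?thesis by (simp only: mult.assoc)
    qed
    finally have 1: "emeasure \<mu> ?B \<le> ennreal (2 * a2) * emeasure lborel (A \<inter> J)" using \<mu>2 by (rule order_trans[rotated])
    have "ennreal (a1 / 2) * emeasure lborel (A \<inter> J) \<le> ennreal (a1 / 2) * (ennreal 2 * emeasure lborel (?\<psi> ` ?B))"
      by (rule mult_left_mono[OF up]) simp
    also have "\<dots> = ennreal a1 * emeasure lborel (?\<psi> ` ?B)"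
    proof -
      have "ennreal a1 = ennreal (a1 / 2) * ennreal 2" using a by (subst ennreal_mult[symmetric]) simp_all
      then show ?thesis by (simp only: mult.assoc)
    qed
    also note \<mu>1
    finally show ?thesis using 1 unfolding \<sigma>A by blast
  qed
  \<comment> \<open>Linearity of \<open>R\<close> and of the orbit functional turns the integer
    combination of coordinates k . Phi(h) into one orbit function, that of
    \<open>R k\<close>.\<close>
  have phase: "char_fun k (\<Phi> h) = cis (2 * pi * (k \<bullet> d)) * orbit_char (R k) h" if h: "h \<in> S" for k h
  proof -
    have "orbit h (R k) = orbit h (R (\<Sum>b\<in>Basis. (k \<bullet> b) *\<^sub>R b))" by (simp add: euclidean_representation)
    also have "\<dots> = (\<Sum>b\<in>Basis. (k \<bullet> b) * orbit h (R b))"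
      unfolding linear_sum[OF R(1)] linear_scale[OF R(1)] linear_sum[OF linear_orbit] linear_scale[OF linear_orbit] by simp
    finally have "k \<bullet> \<Phi> h = orbit h (R k) + k \<bullet> d"
      using \<psi>i\<psi>[of h] h Sc by (auto simp: \<Phi>_def T_def inner_add_right inner_sum_right mult.commute)
    then show ?thesis by (simp add: char_fun_def orbit_char_cis cis_mult algebra_simps)
  qed
  \<comment> \<open>If \<open>R k = 0\<close>, the derivative pairing gives k . k = 0. Hence
    indexing by the vectors in \<open>K\<close> repeats no lattice point.\<close>
  have injR: "inj R"
    unfolding linear_injective_0[OF R(1)]
  proof (intro allI impI)
    fix k assume "R k = 0"
    have "frechet_derivative (?o (R k)) (at (snd ?c \<one>)) = (\<lambda>_. 0)"
      unfolding \<open>R k = 0\<close> by (simp add: linear_0[OF linear_orbit] frechet_derivative_const)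
    then have "k \<bullet> k = 0" using R(2) by metis
    then show "k = 0" by simp
  qed
  define K where "K = R ` int_lattice"
  have "local_system S K (a1 / 2) (max (a1 / 2) (2 * a2))"
    unfolding local_system_def
  proof (intro conjI allI impI)
    fix F assume F: "F \<in> borel_measurable \<mu>" "integrable \<mu> (\<lambda>x. (cmod (F x))\<^sup>2)" "\<forall>x\<in>H. x \<notin> S \<longrightarrow> F x = 0"
    define \<Psi> where "\<Psi> = the_inv_into S \<Phi>"
    have \<Psi>: "\<Psi> (\<Phi> h) = h" if "h \<in> S" for h unfolding \<Psi>_def by (rule the_inv_into_f_f[OF inj\<Phi> that])
    have "continuous_on J \<Psi>" unfolding J_def \<Psi>_def by (rule continuous_on_inv_into[OF cont\<Phi> cS inj\<Phi>])
    then have "\<Psi> \<in> measurable (restrict_space borel J) borel" by (rule borel_measurable_continuous_on_restrict)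
    then have \<Psi>m: "\<Psi> \<in> measurable (restrict_space borel J) \<mu>"
      by (rule HH.measurable_into_mu) (use \<Psi> SH in \<open>auto simp: J_def space_restrict_space\<close>)
    \<comment> \<open>\<open>F\<close> transported to the cube and extended by 0;
      \<open>\<Psi>\<close> is continuous on the compact image \<open>J\<close>, so
      \<open>Gf\<close> is Borel.\<close>
    define Gf where "Gf x = indicator J x *\<^sub>R F (\<Psi> x)" for x
    have Gm: "Gf \<in> borel_measurable borel"
      unfolding Gf_def using measurable_compose[OF \<Psi>m F(1)] Jsets
      by (subst borel_measurable_restrict_space_iff[symmetric]) auto
    have GF: "Gf (\<Phi> h) = F h" if "h \<in> S" for h using that \<Psi> by (auto simp: Gf_def J_def)
    have push: "(LINT x|\<sigma>. f x) = (LINT h|\<mu>. indicator S h *\<^sub>R f (\<Phi> h))"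
      if "f \<in> borel_measurable borel" for f :: "real ^ 'h coord_index \<Rightarrow> 'z::{banach, second_countable_topology}"
      unfolding \<sigma>_def using that \<Phi>m Sint by (simp add: integral_distr integral_restrict_space)
    have G2m: "(\<lambda>x. (cmod (Gf x))\<^sup>2) \<in> borel_measurable borel" using Gm by measurable
    have sq: "indicator S h *\<^sub>R (cmod (Gf (\<Phi> h)))\<^sup>2 = (cmod (F h))\<^sup>2" if "h \<in> H" for h
      using that F(3) GF by (cases "h \<in> S") auto
    have "integrable \<mu> (\<lambda>h. indicator S h *\<^sub>R (cmod (Gf (\<Phi> h)))\<^sup>2)"
      using F(2) by (subst Bochner_Integration.integrable_cong[OF refl sq]) auto
    then have G2: "integrable \<sigma> (\<lambda>x. (cmod (Gf x))\<^sup>2)"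
      unfolding \<sigma>_def using \<Phi>m G2m Sint by (simp add: integrable_distr_eq integrable_restrict_space)
    have norm: "(LINT x|\<sigma>. (cmod (Gf x))\<^sup>2) = (LINT h|\<mu>. (cmod (F h))\<^sup>2)"
      unfolding push[OF G2m] by (rule Bochner_Integration.integral_cong[OF refl]) (use sq in simp)
    have coef: "(cmod (LINT x|\<sigma>. Gf x * cnj (char_fun k x)))\<^sup>2 = (cmod (LINT h|\<mu>. F h * cnj (orbit_char (R k) h)))\<^sup>2" for k
    proof -
      have "(\<lambda>x. Gf x * cnj (char_fun k x)) \<in> borel_measurable borel" using Gm by measurable
      from push[OF this] have "(LINT x|\<sigma>. Gf x * cnj (char_fun k x)) =
          (LINT h|\<mu>. indicator S h *\<^sub>R (Gf (\<Phi> h) * cnj (char_fun k (\<Phi> h))))" .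
      also have "\<dots> = (LINT h|\<mu>. cnj (cis (2 * pi * (k \<bullet> d))) * (F h * cnj (orbit_char (R k) h)))"
      proof (rule Bochner_Integration.integral_cong[OF refl])
        fix h assume "h \<in> space \<mu>"
        then have "h \<in> H" by simp
        then show "indicator S h *\<^sub>R (Gf (\<Phi> h) * cnj (char_fun k (\<Phi> h))) = cnj (cis (2 * pi * (k \<bullet> d))) * (F h * cnj (orbit_char (R k) h))"
          using F(3) GF[of h] phase[of h k] by (cases "h \<in> S") (auto simp: mult_ac)
      qed
      also have "\<dots> = cnj (cis (2 * pi * (k \<bullet> d))) * (LINT h|\<mu>. F h * cnj (orbit_char (R k) h))" by simp
      finally show ?thesis by (simp add: norm_mult)
    qed
    have up: "emeasure \<sigma> A \<le> ennreal (max (a1 / 2) (2 * a2)) * emeasure lborel (A \<inter> J)" if "A \<in> sets borel" for A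
    proof -
      have "ennreal (2 * a2) * emeasure lborel (A \<inter> J) \<le> ennreal (max (a1 / 2) (2 * a2)) * emeasure lborel (A \<inter> J)"
        by (intro mult_right_mono ennreal_leI) auto
      then show ?thesis using bounds[OF that] by (blast intro: order_trans)
    qed
    have low: "ennreal (a1 / 2) * emeasure lborel (A \<inter> J) \<le> emeasure \<sigma> A" if "A \<in> sets borel" for A
      using bounds[OF that] by blast
    have pos: "0 < a1 / 2" "a1 / 2 \<le> max (a1 / 2) (2 * a2)" using a by auto
    have sets\<sigma>: "sets \<sigma> = sets borel" by (simp add: \<sigma>_def)
    obtain s where s: "((\<lambda>k. (cmod (LINT x|\<sigma>. Gf x * cnj (char_fun k x)))\<^sup>2) has_sum s) int_lattice"
      "a1 / 2 * (LINT x|\<sigma>. (cmod (Gf x))\<^sup>2) \<le> s" "s \<le> max (a1 / 2) (2 * a2) * (LINT x|\<sigma>. (cmod (Gf x))\<^sup>2)"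
      by (rule weighted_Parseval[OF sets\<sigma> Jsets Jbox pos up low Gm G2])
    have "((\<lambda>Y. (cmod (LINT x|\<mu>. F x * cnj (orbit_char Y x)))\<^sup>2) has_sum s) K"
      unfolding K_def using s(1) unfolding coef
      by (subst has_sum_reindex[OF inj_on_subset[OF injR]]) (auto simp: comp_def)
    then show "\<exists>s. ((\<lambda>Y. (cmod (LINT x|\<mu>. F x * cnj (orbit_char Y x)))\<^sup>2) has_sum s) K \<and>
        a1 / 2 * (LINT x|\<mu>. (cmod (F x))\<^sup>2) \<le> s \<and> s \<le> max (a1 / 2) (2 * a2) * (LINT x|\<mu>. (cmod (F x))\<^sup>2)"
      using s(2,3) unfolding norm by blast
  next
    show "countable K" unfolding K_def by (rule countable_image[OF countable_int_lattice])
  qed (use a cS SH nbhdS in auto)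
  then show ?thesis by blast
qed

end

subsection \<open>Smooth bump functions\<close>

text \<open>The functions p(1/t) exp(-1/t) extended by 0. The polynomial is carried along because
  this class is closed under differentiation, which yields smoothness by induction on the
  order.\<close>

definition flat :: "real poly \<Rightarrow> real \<Rightarrow> real" where
  "flat p t = (if t > 0 then poly p (1 / t) * exp (- (1 / t)) else 0)"

lemma poly_times_exp_tendsto_0: "((\<lambda>s. poly p s * exp (- s)) \<longlongrightarrow> (0 :: real)) at_top"
proof -
  have "((\<lambda>s. \<Sum>i\<le>degree p. coeff p i * (s ^ i / exp s)) \<longlongrightarrow> (\<Sum>i\<le>degree p. coeff p i * 0)) at_top"
    by (intro tendsto_sum tendsto_mult tendsto_const tendsto_power_div_exp_0)
  then show ?thesis
    by (simp add: poly_altdef sum_distrib_right exp_minus divide_inverse mult.assoc)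
qed

text \<open>With s = 1/t, differentiating p(s) exp(-s) in t yields s^2 (p - p')(s) exp(-s), whence
  the factor \<open>[:0, 0, 1:]\<close>. At 0 this is a limit computation.\<close>

lemma flat_has_derivative:
  "(flat p has_real_derivative flat ([:0, 0, 1:] * (p - pderiv p)) t) (at t)"
proof -
  let ?q = "[:0, 0, 1:] * (p - pderiv p)"
  consider "t > 0" | "t < 0" | "t = 0" by linarith
  then show ?thesis
  proof cases
    case 1
    have "((\<lambda>t. poly p (1 / t) * exp (- (1 / t))) has_real_derivative flat ?q t) (at t)"
      using 1 by (auto intro!: derivative_eq_intros DERIV_chain2[OF poly_DERIV] simp: flat_def field_simps power2_eq_square)
    then show ?thesis
      by (rule has_field_derivative_transform_within_open[of _ _ _ "{0<..}"]) (use 1 in \<open>auto simp: flat_def\<close>)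
  next
    case 2
    have "((\<lambda>t. 0) has_real_derivative flat ?q t) (at t)" using 2 by (simp add: flat_def)
    then show ?thesis
      by (rule has_field_derivative_transform_within_open[of _ _ _ "{..<0}"]) (use 2 in \<open>auto simp: flat_def\<close>)
  next
    case 3
    \<comment> \<open>The right difference quotient at 0 is s p(s) exp(-s) with s = 1/h tending to
      infinity; the left one is identically 0.\<close>
    have "((\<lambda>h. poly (p * [:0, 1:]) (inverse h) * exp (- inverse h)) \<longlongrightarrow> 0) (at_right 0)"
      by (rule filterlim_compose[OF poly_times_exp_tendsto_0 filterlim_inverse_at_top_right])
    then have "((\<lambda>h. (flat p (0 + h) - flat p 0) / h) \<longlongrightarrow> 0) (at_right 0)"
      by (rule Lim_transform_eventually)
         (auto simp: eventually_at_right_field flat_def divide_inverse mult_ac intro!: exI[of _ 1])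
    moreover have "((\<lambda>h. (flat p (0 + h) - flat p 0) / h) \<longlongrightarrow> 0) (at_left 0)"
      by (rule Lim_transform_eventually[OF tendsto_const])
         (auto simp: eventually_at_left_field flat_def intro!: exI[of _ "-1"])
    ultimately have "((\<lambda>h. (flat p (0 + h) - flat p 0) / h) \<longlongrightarrow> 0) (at 0)"
      by (simp add: filterlim_split_at)
    then show ?thesis using 3 by (simp add: DERIV_def flat_def)
  qed
qed

lemma Ck_on_flat: "Ck_on k UNIV (flat p)"
proof (induction k arbitrary: p)
  case 0
  show ?case using flat_has_derivative by (auto intro!: continuous_at_imp_continuous_on DERIV_isCont)
next
  case (Suc k)
  show ?case
  proof (rule Ck_on_SucI[OF open_UNIV])
    show "(flat p has_derivative (*) (flat ([:0, 0, 1:] * (p - pderiv p)) t)) (at t)" for t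
      using flat_has_derivative[of p t] by (simp add: has_field_derivative_def)
    show "Ck_on k UNIV (\<lambda>t. flat ([:0, 0, 1:] * (p - pderiv p)) t * v)" for v
      by (rule Ck_on_bounded_linear_compose[OF open_UNIV bounded_linear_mult_left Suc.IH])
  qed
qed

text \<open>The given norm need not be differentiable, so a sum of squared basis coordinates
  replaces it, and the bump is \<open>flat 1\<close> of 1 - M / \<epsilon>^2.\<close>

lemma smooth_bump:
  fixes x0 :: "'a::finite_dim_normed"
  assumes "r > 0"
  obtains b :: "'a \<Rightarrow> real" where "smooth_on UNIV b" "b x0 \<noteq> 0" "\<forall>x. b x \<noteq> 0 \<longrightarrow> x \<in> cball x0 r"
proof -
  obtain B :: "'a set" where B: "finite B" "independent B" "span B = UNIV"
    using finite_basis_exists by blast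
  \<comment> \<open>Coordinates of size at most \<epsilon> give norm at most r by the triangle
    inequality; the added 1 covers an empty basis.\<close>
  define \<epsilon> where "\<epsilon> = r / ((\<Sum>b\<in>B. norm b) + 1)"
  have pos: "(\<Sum>b\<in>B. norm b) + 1 > 0" by (simp add: add_nonneg_pos sum_nonneg)
  have \<epsilon>: "\<epsilon> > 0" using assms pos by (simp add: \<epsilon>_def)
  define \<rho> where "\<rho> b x = representation B x b + - representation B x0 b" for b x
  define M where "M x = (\<Sum>b\<in>B. \<rho> b x *\<^sub>R \<rho> b x)" for x
  have "Ck_on k UNIV (\<rho> b)" for k b
    unfolding \<rho>_def[abs_def]
    by (intro Ck_on_add open_UNIV Ck_on_const Ck_on_bounded_linear bounded_linear_representation[OF B(2,3)])
  then have M: "Ck_on k UNIV M" for k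
    unfolding M_def[abs_def] by (intro Ck_on_sum Ck_on_scaleR open_UNIV)
  have "bounded_linear (\<lambda>y :: real. - (1 / \<epsilon>\<^sup>2) * y)" by (rule bounded_linear_mult_right)
  from Ck_on_bounded_linear_compose[OF open_UNIV this M]
  have "Ck_on k UNIV (\<lambda>x. 1 + - (1 / \<epsilon>\<^sup>2) * M x)" for k
    by (intro Ck_on_add open_UNIV Ck_on_const)
  from Ck_on_compose[OF open_UNIV open_UNIV _ this Ck_on_flat]
  have sm: "smooth_on UNIV (\<lambda>x. flat 1 (1 + - (1 / \<epsilon>\<^sup>2) * M x))"
    unfolding smooth_on_def by auto
  show thesis
  proof (rule that[OF sm _ allI[OF impI]])
    show "flat 1 (1 + - (1 / \<epsilon>\<^sup>2) * M x0) \<noteq> 0" by (simp add: M_def \<rho>_def flat_def)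
    fix x assume "flat 1 (1 + - (1 / \<epsilon>\<^sup>2) * M x) \<noteq> 0"
    then have "1 + - (1 / \<epsilon>\<^sup>2) * M x > 0" by (auto simp: flat_def split: if_splits)
    then have Mx: "M x < \<epsilon>\<^sup>2" using \<epsilon> by (simp add: field_simps)
    have small: "\<bar>\<rho> b x\<bar> \<le> \<epsilon>" if b: "b \<in> B" for b
    proof -
      have "(\<rho> b x)\<^sup>2 \<le> M x"
        unfolding M_def power2_eq_square real_scaleR_def
        by (rule member_le_sum[OF b, of "\<lambda>b. \<rho> b x * \<rho> b x"]) (use B(1) in auto)
      then have "\<bar>\<rho> b x\<bar>\<^sup>2 \<le> \<epsilon>\<^sup>2" using Mx by simp
      then show ?thesis by (rule power2_le_imp_le[OF _ less_imp_le[OF \<epsilon>]])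
    qed
    have rep: "y = (\<Sum>b\<in>B. representation B y b *\<^sub>R b)" for y
      using sum_representation_eq[of B y B] B by simp
    have "x - x0 = (\<Sum>b\<in>B. representation B x b *\<^sub>R b) - (\<Sum>b\<in>B. representation B x0 b *\<^sub>R b)"
      by (simp only: rep[symmetric])
    also have "\<dots> = (\<Sum>b\<in>B. \<rho> b x *\<^sub>R b)"
      by (simp add: \<rho>_def sum_subtractf scaleR_diff_left)
    finally have "norm (x - x0) \<le> (\<Sum>b\<in>B. \<epsilon> * norm b)"
      using small by (auto intro!: sum_norm_le mult_right_mono)
    also have "\<dots> = \<epsilon> * (\<Sum>b\<in>B. norm b)" by (simp add: sum_distrib_left)
    also have "\<dots> \<le> \<epsilon> * ((\<Sum>b\<in>B. norm b) + 1)" using \<epsilon> by simp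
    also have "\<dots> = r" using pos by (simp add: \<epsilon>_def)
    finally show "x \<in> cball x0 r" by (simp add: dist_norm norm_minus_commute)
  qed
qed

context semidirect
begin

lemma closedin_compact: "compact C \<Longrightarrow> C \<subseteq> H \<Longrightarrow> closedin (top_of_set H) C"
  by (intro closed_subset compact_imp_closed)

text \<open>A bump in a coordinate ball is extended by 0. The closed ball corresponds to a compact,
  hence closed, subset of \<open>H\<close>; the chart domain and its complement are two open sets
  covering \<open>H\<close>, and the function is visibly smooth on each.\<close>

lemma smooth_function_supported:
  assumes U: "openin (top_of_set H) U" "\<one> \<in> U" "U \<subseteq> S"
  obtains f where "smooth_map AH (vector_space_atlas :: (complex, complex) atlas) f" "\<exists>h\<in>H. f h \<noteq> 0" "supported_on H f S"
proof -
  let ?c = "chart_at AH \<one>"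
  note c = LH.chart_at[OF one_H(2)]
  obtain r where r: "r > 0" "cball (snd ?c \<one>) r \<subseteq> snd ?c ` (fst ?c \<inter> U)"
    "compact (chart_inv ?c ` cball (snd ?c \<one>) r)" "chart_inv ?c ` cball (snd ?c \<one>) r \<subseteq> fst ?c \<inter> U"
    "openin (top_of_set (carrier (G\<lparr>carrier := H\<rparr>))) (fst ?c \<inter> snd ?c -` ball (snd ?c \<one>) r)"
    by (rule HH.chart_cball[OF c]) (use U in auto)
  let ?C = "chart_inv ?c ` cball (snd ?c \<one>) r"
  obtain b :: "'h \<Rightarrow> real" where b': "smooth_on UNIV b" "b (snd ?c \<one>) \<noteq> 0" "\<forall>x. b x \<noteq> 0 \<longrightarrow> x \<in> cball (snd ?c \<one>) r"
    by (rule smooth_bump[OF r(1), of "snd ?c \<one>"])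
  note b = b'(1,2) b'(3)[rule_format]
  define f where "f h = (if h \<in> fst ?c then complex_of_real (b (snd ?c h)) else 0)" for h
  have fC: "h \<in> ?C" if "f h \<noteq> 0" for h
  proof -
    have "h \<in> fst ?c" "b (snd ?c h) \<noteq> 0" using that by (auto simp: f_def split: if_splits)
    then have "h = chart_inv ?c (snd ?c h)" "snd ?c h \<in> cball (snd ?c \<one>) r" using b(3) c by auto
    then show ?thesis by (rule image_eqI)
  qed
  have CH: "?C \<subseteq> H" using r(4) U(1) openin_imp_subset by blast
  have Ccl: "closedin (top_of_set H) ?C" by (rule closedin_compact[OF r(3) CH])
  have bc: "smooth_on UNIV (\<lambda>x. complex_of_real (b x))"
    using b(1) Ck_on_bounded_linear_compose[OF open_UNIV bounded_linear_of_real] unfolding smooth_on_def by blast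
  show thesis
  proof (rule that)
    show "\<exists>h\<in>H. f h \<noteq> 0" using one_H b(2) c by (auto simp: f_def intro!: bexI[of _ \<one>])
    have "top_of_set H closure_of {h \<in> H. f h \<noteq> 0} \<subseteq> ?C"
      by (rule closure_of_minimal[OF _ Ccl]) (use fC in auto)
    then show "supported_on H f S" unfolding supported_on_def using r(4) U(3) by blast
    show "smooth_map AH vector_space_atlas f"
    proof (rule smooth_map_to_vector_space[OF LH.smooth_manifold])
      fix d assume d: "d \<in> AH"
      have o1: "open (snd d ` (fst d \<inter> fst ?c))" by (rule LH.chart_image_open[OF d LH.chart_openin[OF c(1)]])
      have "openin (top_of_set H) (H - ?C)" using Ccl by (simp add: openin_diff)
      then have o2: "open (snd d ` (fst d \<inter> (H - ?C)))" using LH.chart_image_open[OF d] unfolding pointsH by blast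
      have 1: "smooth_on (snd d ` (fst d \<inter> fst ?c)) (\<lambda>u. f (chart_inv d u))"
      proof (rule smooth_on_eq[OF o1])
        show "smooth_on (snd d ` (fst d \<inter> fst ?c)) (\<lambda>u. complex_of_real (b ((snd ?c \<circ> chart_inv d) u)))"
          by (rule smooth_on_compose[OF o1 open_UNIV _ LH.transition_smooth[OF d c(1)] bc]) simp
      qed (use d in \<open>auto simp: f_def\<close>)
      have 2: "smooth_on (snd d ` (fst d \<inter> (H - ?C))) (\<lambda>u. f (chart_inv d u))"
      proof (rule smooth_on_eq[OF o2 _ smooth_on_const[OF o2, of 0]])
        fix u assume "u \<in> snd d ` (fst d \<inter> (H - ?C))"
        then have "chart_inv d u \<notin> ?C" using d by auto
        then show "0 = f (chart_inv d u)" using fC by metis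
      qed
      show "smooth_on (snd d ` fst d) (\<lambda>u. f (chart_inv d u))"
      proof (rule smooth_on_local)
        fix u assume "u \<in> snd d ` fst d"
        then obtain x where x: "u = snd d x" "x \<in> fst d" by (rule imageE)
        have xH: "x \<in> H" using x(2) LH.chart_subset[OF d] unfolding pointsH by auto
        show "\<exists>T. open T \<and> u \<in> T \<and> smooth_on T (\<lambda>u. f (chart_inv d u))"
        proof (cases "x \<in> fst ?c")
          case True
          then show ?thesis using o1 1 x by blast
        next
          case False
          then have "x \<in> H - ?C" using r(4) xH by blast
          then show ?thesis using o2 2 x by blast
        qed
      qed
    qed
  qed
qed

section \<open>The frame generated by one function\<close>

text \<open>The frame inequalities are available for a family indexed by pairs (z, Y), while the
  conclusion asks for a set of group elements. Unique factorisation evaluates the representation,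
  and injectivity of the reindexing preserves the sums.\<close>

lemma frame_exists:
  assumes NH: "N <#> H = carrier G" "N \<inter> H = {\<one>}"
    and exp: "bij_betw (lie_exp (G\<lparr>carrier := N\<rparr>) AN) UNIV N"
    and ls: "local_system S K c1 c2"
    and f: "continuous_on H f" "h0 \<in> H" "f h0 \<noteq> 0" "supported_on H f S"
  shows "\<exists>\<Gamma>. countable \<Gamma> \<and> \<Gamma> \<subseteq> carrier G \<and> L2_frame \<mu> \<Gamma> (\<lambda>\<gamma>. induced_rep G AG N AN H lam \<gamma> f)"
proof -
  have ls': "compact S" "S \<subseteq> H" "countable K" "0 < c1" "c1 \<le> c2"
    and loc: "\<And>F. F \<in> borel_measurable \<mu> \<Longrightarrow> integrable \<mu> (\<lambda>x. (cmod (F x))\<^sup>2) \<Longrightarrow> (\<forall>x\<in>H. x \<notin> S \<longrightarrow> F x = 0) \<Longrightarrow>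
      \<exists>s. ((\<lambda>Y. (cmod (LINT x|\<mu>. F x * cnj (orbit_char Y x)))\<^sup>2) has_sum s) K \<and>
        c1 * (LINT x|\<mu>. (cmod (F x))\<^sup>2) \<le> s \<and> s \<le> c2 * (LINT x|\<mu>. (cmod (F x))\<^sup>2)"
    using ls unfolding local_system_def by blast+
  have f0: "f x = 0" if "x \<in> H" "x \<notin> S" for x
  proof (rule ccontr)
    assume "f x \<noteq> 0"
    then have "x \<in> {h \<in> H. f h \<noteq> 0}" using that by simp
    moreover have "{h \<in> H. f h \<noteq> 0} \<subseteq> top_of_set H closure_of {h \<in> H. f h \<noteq> 0}"
      by (rule closure_of_subset) auto
    ultimately show False using that f(4) unfolding supported_on_def by blast
  qed
  let ?v = "\<lambda>z Y h. orbit_char Y (inv z \<otimes> h) * f (inv z \<otimes> h)"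
  have "\<exists>Z a b. countable Z \<and> Z \<subseteq> H \<and> 0 < a \<and> a \<le> (b::real) \<and>
    (\<forall>z\<in>Z. \<forall>Y\<in>K. (\<lambda>h. orbit_char Y (inv\<^bsub>G\<lparr>carrier := H\<rparr>\<^esub> z \<otimes> h) * f (inv\<^bsub>G\<lparr>carrier := H\<rparr>\<^esub> z \<otimes> h)) \<in> L2_functions \<mu>) \<and>
    (\<forall>g\<in>L2_functions \<mu>. \<exists>r. ((\<lambda>p. (cmod (L2_inner \<mu> g (\<lambda>h. orbit_char (snd p) (inv\<^bsub>G\<lparr>carrier := H\<rparr>\<^esub> (fst p) \<otimes> h) * f (inv\<^bsub>G\<lparr>carrier := H\<rparr>\<^esub> (fst p) \<otimes> h))))\<^sup>2) has_sum r) (Z \<times> K) \<and>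
        a * L2_norm_sq \<mu> g \<le> r \<and> r \<le> b * L2_norm_sq \<mu> g)"
  proof (rule HH.frame_of_local_system[of S c1 c2 K orbit_char f h0], goal_cases)
    case (7 F) then show ?case by (intro loc) auto
  next
    case (12 Z a b)
    show ?case
      by (rule exI[of _ Z], rule exI[of _ a], rule exI[of _ b], intro conjI ballI)
         (fact 12(1), fact 12(2)[simplified], fact 12(3), fact 12(4), erule 12(5)[simplified], assumption, erule 12(6)[simplified])
  qed (use ls' measurable_orbit_char f f0 in \<open>auto simp: orbit_char_cis\<close>)
  then obtain Z a b where Z: "countable Z" "Z \<subseteq> H" and ab: "0 < a" "a \<le> (b::real)"
    and v': "\<forall>z\<in>Z. \<forall>Y\<in>K. (\<lambda>h. orbit_char Y (inv\<^bsub>G\<lparr>carrier := H\<rparr>\<^esub> z \<otimes> h) * f (inv\<^bsub>G\<lparr>carrier := H\<rparr>\<^esub> z \<otimes> h)) \<in> L2_functions \<mu>"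
    and bnd': "\<forall>g\<in>L2_functions \<mu>. \<exists>r. ((\<lambda>p. (cmod (L2_inner \<mu> g (\<lambda>h. orbit_char (snd p) (inv\<^bsub>G\<lparr>carrier := H\<rparr>\<^esub> (fst p) \<otimes> h) * f (inv\<^bsub>G\<lparr>carrier := H\<rparr>\<^esub> (fst p) \<otimes> h))))\<^sup>2) has_sum r) (Z \<times> K) \<and>
        a * L2_norm_sq \<mu> g \<le> r \<and> r \<le> b * L2_norm_sq \<mu> g" by (elim exE conjE)
  have v: "?v z Y \<in> L2_functions \<mu>" if "z \<in> Z" "Y \<in> K" for z Y
    using bspec[OF bspec[OF v' that(1)] that(2)] invH[OF subsetD[OF Z(2) that(1)]] by simp
  let ?exp = "lie_exp (G\<lparr>carrier := N\<rparr>) AN"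
  have expN: "?exp X \<in> N" for X using exp by (auto simp: bij_betw_def)
  have injexp: "inj ?exp" using exp by (simp add: bij_betw_def)
  \<comment> \<open>The element x'^-1 x = z' z^-1 lies in both subgroups, hence is the identity.
    This also makes the description in \<open>induced_rep\<close> denote.\<close>
  have decomp: "x = x' \<and> z = z'" if xz: "x \<in> N" "x' \<in> N" "z \<in> H" "z' \<in> H" "x \<otimes> z = x' \<otimes> z'" for x x' z z'
  proof -
    have G: "x \<in> carrier G" "x' \<in> carrier G" "z \<in> carrier G" "z' \<in> carrier G" using xz N_carrier H_carrier by auto
    have "inv x' \<otimes> x = inv x' \<otimes> (x \<otimes> z) \<otimes> inv z" using G by (simp add: m_assoc)
    also have "\<dots> = inv x' \<otimes> (x' \<otimes> z') \<otimes> inv z" by (simp only: xz(5))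
    also have "\<dots> = z' \<otimes> inv z" using G by (simp add: m_assoc[symmetric])
    finally have eq: "inv x' \<otimes> x = z' \<otimes> inv z" .
    have "inv x' \<otimes> x \<in> N" using subgroupN xz by (simp add: subgroup.m_closed subgroup.m_inv_closed)
    moreover have "z' \<otimes> inv z \<in> H" using subgroupH xz by (simp add: subgroup.m_closed subgroup.m_inv_closed)
    ultimately have "inv x' \<otimes> x = \<one>" "z' \<otimes> inv z = \<one>" using eq NH(2) by auto
    moreover from \<open>inv x' \<otimes> x = \<one>\<close> have "x = x'"
    proof -
      have "inv x = inv x'" using inv_equality[of "inv x'" x] G \<open>inv x' \<otimes> x = \<one>\<close> by simp
      then have "inv (inv x) = inv (inv x')" by (rule arg_cong)
      then show ?thesis using G by simp
    qed
    moreover from \<open>z' \<otimes> inv z = \<one>\<close> have "z' = z" using inv_equality[of z' "inv z"] G by simp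
    ultimately show ?thesis by simp
  qed
  \<comment> \<open>The factor \<open>Ad z\<close> cancels against \<open>Ad (h\<^sup>-\<^sup>1)\<close>: the character of \<open>exp (Ad z Y)\<close> at \<open>h\<close> is
    that of \<open>exp Y\<close> at \<open>z\<^sup>-\<^sup>1 h\<close>, so \<open>\<pi>(\<gamma> (z, Y)) f\<close> is the \<open>z\<close>-translate of a modulation of \<open>f\<close>.\<close>
  define \<gamma> where "\<gamma> p = ?exp (Ad_on G AG AN (fst p) (snd p)) \<otimes> fst p" for p
  have \<gamma>G: "\<gamma> p \<in> carrier G" if "fst p \<in> Z" for p
    unfolding \<gamma>_def using expN N_carrier H_carrier Z(2) that by (intro m_closed) auto
  \<comment> \<open>The factorisation recovers z and exp(Ad(z) Y); then Y follows since exp is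
    injective and Ad(z) invertible.\<close>
  have inj: "inj_on \<gamma> (Z \<times> K)"
  proof (rule inj_onI)
    fix p p' assume p: "p \<in> Z \<times> K" "p' \<in> Z \<times> K" "\<gamma> p = \<gamma> p'"
    have zH: "fst p \<in> H" "fst p' \<in> H" using p Z(2) by auto
    have "?exp (Ad_on G AG AN (fst p) (snd p)) = ?exp (Ad_on G AG AN (fst p') (snd p')) \<and> fst p = fst p'"
      by (rule decomp) (use zH expN p(3) in \<open>auto simp: \<gamma>_def\<close>)
    then have e: "Ad_on G AG AN (fst p) (snd p) = Ad_on G AG AN (fst p) (snd p')" "fst p = fst p'"
      using injexp by (auto dest: injD)
    have zG: "fst p \<in> carrier G" using zH H_carrier by auto
    have cancel: "Ad_on G AG AN (inv (fst p)) (Ad_on G AG AN (fst p) Y) = Y" for Y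
      using zG by (simp add: Ad_on_mult[symmetric] Ad_on_one)
    have "snd p = snd p'" using cancel[of "snd p"] cancel[of "snd p'"] unfolding e(1) by (rule trans[OF sym])
    with e(2) show "p = p'" by (rule prod_eqI)
  qed
  have rep: "induced_rep G AG N AN H lam (\<gamma> p) f h = ?v (fst p) (snd p) h" if p: "p \<in> Z \<times> K" and h: "h \<in> H" for p h
  proof -
    let ?x = "?exp (Ad_on G AG AN (fst p) (snd p))" and ?z = "fst p"
    have zH: "?z \<in> H" using p Z(2) by auto
    have "(THE (x, z). x \<in> N \<and> z \<in> H \<and> \<gamma> p = x \<otimes> z) = (?x, ?z)"
    proof (rule the_equality)
      show "case (?x, ?z) of (x, z) \<Rightarrow> x \<in> N \<and> z \<in> H \<and> \<gamma> p = x \<otimes> z" using expN zH by (simp add: \<gamma>_def)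
      fix q assume "case q of (x, z) \<Rightarrow> x \<in> N \<and> z \<in> H \<and> \<gamma> p = x \<otimes> z"
      then have q: "fst q \<in> N" "snd q \<in> H" "fst q \<otimes> snd q = ?x \<otimes> ?z" by (auto simp: \<gamma>_def)
      show "q = (?x, ?z)" using decomp[OF q(1) expN q(2) zH q(3)] by (simp add: prod_eq_iff)
    qed
    then have "induced_rep G AG N AN H lam (\<gamma> p) f h = rep_N G AG N AN lam ?x (rep_H G ?z f) h"
      unfolding induced_rep_def by simp
    moreover have "lie_log (G\<lparr>carrier := N\<rparr>) AN ?x = Ad_on G AG AN ?z (snd p)"
      unfolding lie_log_def by (rule the_inv_into_f_f[OF injexp]) simp
    ultimately show ?thesis
      using coad_mult[OF H_carrier[OF h] H_carrier[OF zH]]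
      by (simp add: rep_N_def rep_H_def orbit_char_def orbit_def)
  qed
  have frame: "L2_frame \<mu> (\<gamma> ` (Z \<times> K)) (\<lambda>\<gamma>. induced_rep G AG N AN H lam \<gamma> f)"
    unfolding L2_frame_def
  proof (intro conjI ballI)
    show "countable (\<gamma> ` (Z \<times> K))" using Z(1) ls'(3) by (intro countable_image countable_SIGMA)
    fix g assume "g \<in> \<gamma> ` (Z \<times> K)"
    then obtain p where p: "g = \<gamma> p" "p \<in> Z \<times> K" by (rule imageE)
    have "?v (fst p) (snd p) \<in> L2_functions \<mu>" using v p(2) by auto
    \<comment> \<open>The two functions are known to agree only on \<open>H\<close>, which is the
      space of the measure; measurability and integrability depend on nothing else.\<close>
    moreover have "(induced_rep G AG N AN H lam g f \<in> L2_functions \<mu>) = (?v (fst p) (snd p) \<in> L2_functions \<mu>)"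
      unfolding L2_functions_def mem_Collect_eq
      by (intro arg_cong2[of _ _ _ _ "(\<and>)"] measurable_cong Bochner_Integration.integrable_cong refl)
         (simp_all add: p(1) rep[OF p(2)])
    ultimately show "induced_rep G AG N AN H lam g f \<in> L2_functions \<mu>" by blast
  next
    show "\<exists>a b. 0 < a \<and> a \<le> b \<and> (\<forall>g\<in>L2_functions \<mu>.
        (\<lambda>k. (cmod (L2_inner \<mu> g (induced_rep G AG N AN H lam k f)))\<^sup>2) summable_on \<gamma> ` (Z \<times> K) \<and>
        a * L2_norm_sq \<mu> g \<le> (\<Sum>\<^sub>\<infinity>k\<in>\<gamma> ` (Z \<times> K). (cmod (L2_inner \<mu> g (induced_rep G AG N AN H lam k f)))\<^sup>2) \<and>
        (\<Sum>\<^sub>\<infinity>k\<in>\<gamma> ` (Z \<times> K). (cmod (L2_inner \<mu> g (induced_rep G AG N AN H lam k f)))\<^sup>2) \<le> b * L2_norm_sq \<mu> g)"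
    proof (rule exI[of _ a], rule exI[of _ b], intro conjI ballI ab)
      fix g assume g: "g \<in> L2_functions \<mu>"
      from bspec[OF bnd' g] obtain r where
        r: "((\<lambda>p. (cmod (L2_inner \<mu> g (\<lambda>h. orbit_char (snd p) (inv\<^bsub>G\<lparr>carrier := H\<rparr>\<^esub> (fst p) \<otimes> h) * f (inv\<^bsub>G\<lparr>carrier := H\<rparr>\<^esub> (fst p) \<otimes> h))))\<^sup>2) has_sum r) (Z \<times> K)"
        "a * L2_norm_sq \<mu> g \<le> r" "r \<le> b * L2_norm_sq \<mu> g" by auto
      let ?q = "\<lambda>k. (cmod (L2_inner \<mu> g (induced_rep G AG N AN H lam k f)))\<^sup>2"
      have eq: "(cmod (L2_inner \<mu> g (\<lambda>h. orbit_char (snd p) (inv\<^bsub>G\<lparr>carrier := H\<rparr>\<^esub> (fst p) \<otimes> h) * f (inv\<^bsub>G\<lparr>carrier := H\<rparr>\<^esub> (fst p) \<otimes> h))))\<^sup>2 = ?q (\<gamma> p)"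
        if p: "p \<in> Z \<times> K" for p
      proof -
        have "inv\<^bsub>G\<lparr>carrier := H\<rparr>\<^esub> (fst p) = inv (fst p)" using invH p Z(2) by auto
        then show ?thesis unfolding L2_inner_def
          by (intro arg_cong[of _ _ "\<lambda>x. (cmod x)\<^sup>2"] Bochner_Integration.integral_cong refl) (simp add: rep[OF p])
      qed
      have "((?q \<circ> \<gamma>) has_sum r) (Z \<times> K)"
        using r(1) by (rule has_sum_cong[THEN iffD1, rotated]) (simp add: eq)
      then have hs: "(?q has_sum r) (\<gamma> ` (Z \<times> K))" by (rule has_sum_reindex[OF inj, THEN iffD2])
      then show "?q summable_on \<gamma> ` (Z \<times> K)" by (rule has_sum_imp_summable)
      show "a * L2_norm_sq \<mu> g \<le> infsum ?q (\<gamma> ` (Z \<times> K))" "infsum ?q (\<gamma> ` (Z \<times> K)) \<le> b * L2_norm_sq \<mu> g"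
        using infsumI[OF hs] r by auto
    qed
  qed
  have "countable (\<gamma> ` (Z \<times> K))" using Z(1) ls'(3) by (intro countable_image countable_SIGMA)
  moreover have "\<gamma> ` (Z \<times> K) \<subseteq> carrier G" using \<gamma>G by auto
  ultimately show ?thesis using frame by blast
qed

end

theorem theorem1:
  fixes G :: "('a::{t2_space, second_countable_topology}) monoid"
    and AG :: "('a, 'g::finite_dim_normed) atlas"
    and N :: "'a set" and AN :: "('a, 'n::finite_dim_normed) atlas"
    and H :: "'a set" and AH :: "('a, 'h::finite_dim_normed) atlas"
    and \<mu> :: "'a measure"
    and lam :: "'n \<Rightarrow>\<^sub>L real"
  assumes "lie_group G AG"
    and "closed_lie_subgroup G AG N AN" and "connected N" and "N \<lhd> G"
    and "closed_lie_subgroup G AG H AH" and "connected H"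
    and "N <#>\<^bsub>G\<^esub> H = carrier G" and "N \<inter> H = {\<one>\<^bsub>G\<^esub>}"
    and "lie_ideal (lie_bracket G AG) (sub_lie_algebra G AG AN)"
    and "lie_subalgebra (lie_bracket G AG) (sub_lie_algebra G AG AH)"
    and "direct_sum_decomposition (sub_lie_algebra G AG AN) (sub_lie_algebra G AG AH)"
    and "dim (sub_lie_algebra G AG AH) \<le> dim (sub_lie_algebra G AG AN)"
    and "exponential_solvable (G\<lparr>carrier := N\<rparr>) AN"
    and "left_haar_measure (G\<lparr>carrier := H\<rparr>) \<mu>"
    and "\<forall>X Y. blinfun_apply lam (lie_bracket (G\<lparr>carrier := N\<rparr>) AN X Y) = 0"
    and "immersion_at AH vector_space_atlas (\<lambda>h. coad G AG AN (inv\<^bsub>G\<^esub> h) lam) \<one>\<^bsub>G\<^esub>"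
  shows "\<exists>S. relatively_compact_nbhd H \<one>\<^bsub>G\<^esub> S \<and>
    (\<forall>f. continuous_on H f \<and> (\<exists>h\<in>H. f h \<noteq> 0) \<and> supported_on H f S \<longrightarrow>
       (\<exists>\<Gamma>. countable \<Gamma> \<and> \<Gamma> \<subseteq> carrier G \<and>
          L2_frame \<mu> \<Gamma> (\<lambda>\<gamma>. induced_rep G AG N AN H lam \<gamma> f))) \<and>
    (\<exists>f. smooth_map AH vector_space_atlas f \<and> (\<exists>h\<in>H. f h \<noteq> 0) \<and> supported_on H f S \<and>
       (\<exists>\<Gamma>. countable \<Gamma> \<and> \<Gamma> \<subseteq> carrier G \<and>
          L2_frame \<mu> \<Gamma> (\<lambda>\<gamma>. induced_rep G AG N AN H lam \<gamma> f)))"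
proof -
  have "lie G AG" by (rule lie.intro[OF assms(1)])
  then have "lie_pair G AG N AN H AH" using assms(2,4,5) by (intro lie_pair.intro lie_pair_axioms.intro)
  then interpret semidirect G AG N AN H AH \<mu> lam
    using assms(14,16) by (intro semidirect.intro semidirect_axioms.intro)
  have exp: "bij_betw (lie_exp (G\<lparr>carrier := N\<rparr>) AN) UNIV N"
    using assms(13) unfolding exponential_solvable_def diffeomorphism_def by (simp add: pointsN)
  have "\<exists>S K c1 c2. local_system S K c1 c2"
    by (cases "dim (UNIV :: 'h set) = 0") (rule local_system_dim_0 local_system_exists, assumption)+
  then obtain S K c1 c2 where ls: "local_system S K c1 c2" by (elim exE)
  then have S: "compact S" "S \<subseteq> H" "\<exists>U. openin (top_of_set H) U \<and> \<one>\<^bsub>G\<^esub> \<in> U \<and> U \<subseteq> S"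
    unfolding local_system_def by auto
  have "top_of_set H closure_of S = S"
    using closedin_compact[OF S(1,2)] by (simp add: closure_of_eq)
  then have nbhd: "relatively_compact_nbhd H \<one>\<^bsub>G\<^esub> S"
    using S unfolding relatively_compact_nbhd_def by simp
  have frame: "\<exists>\<Gamma>. countable \<Gamma> \<and> \<Gamma> \<subseteq> carrier G \<and> L2_frame \<mu> \<Gamma> (\<lambda>\<gamma>. induced_rep G AG N AN H lam \<gamma> f)"
    if f: "continuous_on H f" "\<exists>h\<in>H. f h \<noteq> 0" "supported_on H f S" for f
  proof -
    from f(2) obtain h0 where "h0 \<in> H" "f h0 \<noteq> 0" by (rule bexE)
    then show ?thesis using frame_exists[OF assms(7,8) exp ls f(1)] f(3) by simp
  qed
  from S(3) obtain U where U: "openin (top_of_set H) U" "\<one>\<^bsub>G\<^esub> \<in> U" "U \<subseteq> S" by auto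
  obtain f where f: "smooth_map AH (vector_space_atlas :: (complex, complex) atlas) f" "\<exists>h\<in>H. f h \<noteq> 0" "supported_on H f S"
    by (rule smooth_function_supported[OF U])
  \<comment> \<open>A smooth function is continuous, so the statement for all continuous functions
    applies to it; being smooth of all orders, it covers every prescribed finite class.\<close>
  have "continuous_on H f" using smooth_mapD(2)[OF f(1)] unfolding pointsH .
  from frame[OF this f(2,3)] have smooth: "\<exists>f. smooth_map AH vector_space_atlas f \<and> (\<exists>h\<in>H. f h \<noteq> 0) \<and> supported_on H f S \<and>
       (\<exists>\<Gamma>. countable \<Gamma> \<and> \<Gamma> \<subseteq> carrier G \<and>
          L2_frame \<mu> \<Gamma> (\<lambda>\<gamma>. induced_rep G AG N AN H lam \<gamma> f))"
    using f by (intro exI[of _ f] conjI)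
  show ?thesis
    by (rule exI[of _ S], intro conjI nbhd smooth allI impI, rule frame) auto
qed

end
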